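(* For any $\mu\in\mathfrak{W}$, $$\dim_{\mathrm H}(\mu)\ge 1+\frac{\kappa'(1)}{\log m}.$$ This inequality is sharp in the sense that for any choice of $m$ and $W$ there exists $\mu\in\mathfrak{W}$ for which it turns into an equality.
   Context: Fix integers $m\ge 3$ and $\ell\ge 1$. Consider a probability space with an $m$-uniform filtration $\mathcal{F}=\{\mathcal{F}_n\}_{n\ge0}$: $\mathcal{F}_0$ is trivial, each $\mathcal{F}_n$ is a finite algebra with set of atoms $\mathcal{AF}_n$, and each atom in $\mathcal{F}_n$ is split into $m$ atoms of $\mathcal{F}_{n+1}$ (its children) of equal probability. The probability space is identified with the compact metric space $\mathbb{T}$ of infinite paths $\gamma=(\gamma(0)\supset\gamma(1)\supset\cdots)$, $\gamma(n)\in\mathcal{AF}_n$, in the tree of atoms, with $\mathrm{dist}(\gamma_1,\gamma_2)=m^{-d}$, $d=\max\{n : \gamma_1(j)=\gamma_2(j)\text{ for all }j<n\}$ for $\gamma_1\ne\gamma_2$; an atom $\omega\in\mathcal{AF}_n$ is identified with the cylinder $\{\gamma : \gamma(n)=\omega\}$, of probability $m^{-n}$. Let $V=\{v\in\mathbb{R}^m : \sum_{j=1}^m v_j=0\}$. Elements of $V^\ell$ are identified with $m$-tuples $\{b_j\}_{j=1}^m$ of vectors $b_j\in\mathbb{R}^\ell$ with $\sum_j b_j=0$; for $v\in V$, $a\in\mathbb{R}^\ell$, $v\otimes a=\{v_j a\}_{j=1}^m$. For each $n$ and $\omega\in\mathcal{AF}_n$ fix a bijection $J_\omega$ from $\{1,\dots,m\}$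 onto the set of children of $\omega$; for $b\in V^\ell$ let $J_\omega[b]$ be the function on $\omega$ equal to $b_j$ on the child $J_\omega(j)$. Let $W$ be a linear subspace of $V^\ell$. With $f_{n+1}=F_{n+1}-F_n$, let $\mathfrak{W}$ be the space of $\mathbb{R}^\ell$-valued martingales $F=\{F_n\}_{n\ge0}$ adapted to $\mathcal{F}$ with $\sup_n\mathbb{E}\|F_n\|<\infty$ and $f_{n+1}|_\omega\in J_\omega[W]$ for all $n\ge0$, $\omega\in\mathcal{AF}_n$. Each $\mathbb{R}^\ell$-valued Borel measure $\mu$ of bounded variation on $\mathbb{T}$ generates the martingale $F_n=\sum_{\omega\in\mathcal{AF}_n}m^n\mu(\omega)\chi_\omega$; this is a one-to-one correspondence with $L_1$-bounded martingales, and $\mu\in\mathfrak{W}$ means that this martingale lies in $\mathfrak{W}$. The lower Hausdorff dimension is $$\dim_{\mathrm H}\mu=\inf\{\alpha : \exists\text{ Borel }E\subset\mathbb{T}\text{ with }\mu(E)\ne0,\ \dim_{\mathrm H}E\le\alpha\}.$$ For $v\in V$ and $\theta\in[0,\infty)$ put $\kappa_v(\theta)=\theta\log\big(\frac1m\sum_{j=1}^m|1+v_j|^{1/\theta}\big)$, with $\kappa_v(0)=\log\max_j|1+v_j|$, and $$\kappa(\theta)=\sup\{\kappa_v(\theta) : v\in V,\ \exists a\in\mathbb{R}^\ell\setminus\{0\}\text{ with } v\otimes a\in W,\text{ and } v_j\ge-1\ \forall j\}.$$ $\kappa'(1)$ is the (left) derivative of $\kappa$ at $1$; it equals $$\inf\Big\{-\frac1m\sum_{j=1}^m(1+v_j)\log(1+v_j)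 : v\in V,\ \exists a\in\mathbb{R}^\ell\setminus\{0\}\text{ with }v\otimes a\in W,\ v_j\ge-1\ \forall j\Big\}$$ (with $0\log0=0$). *)

theory Defs
  imports "HOL-Probability.Probability"
begin

section \<open>Uniform filtrations and the boundary of the tree of atoms\<close>

definition atoms :: "'a measure \<Rightarrow> 'a set set" where
  "atoms A = {\<omega> \<in> sets A. \<omega> \<noteq> {} \<and> (\<forall>B \<in> sets A. B \<subseteq> \<omega> \<longrightarrow> B = {} \<or> B = \<omega>)}"

definition children :: "(nat \<Rightarrow> 'a measure) \<Rightarrow> nat \<Rightarrow> 'a set \<Rightarrow> 'a set set" where
  "children F n \<omega> = {\<omega>' \<in> atoms (F (Suc n)). \<omega>' \<subseteq> \<omega>}"

text \<open>Of each \<open>F n\<close> only the (finite) algebra \<open>sets (F n)\<close> is relevant; probabilities are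
  always taken in \<open>M\<close>.\<close>

locale uniform_filtration = prob_space M + filtration "space M" F
  for M :: "'a measure" and F :: "nat \<Rightarrow> 'a measure" and m :: nat +
  assumes subalg: "\<And>n. subalgebra M (F n)"
    and finite_alg: "\<And>n. finite (sets (F n))"
    and trivial_0: "sets (F 0) = {{}, space M}"
    and card_children: "\<And>n \<omega>. \<omega> \<in> atoms (F n) \<Longrightarrow> card (children F n \<omega>) = m"
    and equal_prob: "\<And>n \<omega> \<alpha> \<beta>. \<lbrakk>\<omega> \<in> atoms (F n); \<alpha> \<in> children F n \<omega>; \<beta> \<in> children F n \<omega>\<rbrakk>
                       \<Longrightarrow> prob \<alpha> = prob \<beta>"

definition paths :: "(nat \<Rightarrow> 'a measure) \<Rightarrow> (nat \<Rightarrow> 'a set) set" where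
  "paths F = {\<gamma>. \<forall>n. \<gamma> n \<in> atoms (F n) \<and> \<gamma> (Suc n) \<subseteq> \<gamma> n}"

definition path_dist :: "nat \<Rightarrow> (nat \<Rightarrow> 'a set) \<Rightarrow> (nat \<Rightarrow> 'a set) \<Rightarrow> real" where
  "path_dist m \<gamma>\<^sub>1 \<gamma>\<^sub>2 =
     (if \<gamma>\<^sub>1 = \<gamma>\<^sub>2 then 0 else (1 / real m) ^ Max {n. \<forall>j<n. \<gamma>\<^sub>1 j = \<gamma>\<^sub>2 j})"

definition cylinder :: "(nat \<Rightarrow> 'a measure) \<Rightarrow> nat \<Rightarrow> 'a set \<Rightarrow> (nat \<Rightarrow> 'a set) set" where
  "cylinder F n \<omega> = {\<gamma> \<in> paths F. \<gamma> n = \<omega>}"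

lemma agreement_set_finite:
  fixes x y :: "nat \<Rightarrow> 'b"
  assumes "x \<noteq> y"
  shows "finite {n. \<forall>j<n. x j = y j}"
proof -
  obtain k where "x k \<noteq> y k" using assms by blast
  then have "{n. \<forall>j<n. x j = y j} \<subseteq> {..k}" by (auto simp: not_less[symmetric])
  then show ?thesis by (rule finite_subset) simp
qed

lemma Metric_space_path_dist:
  assumes "m \<ge> 1"
  shows "Metric_space (paths F) (path_dist m)"
proof
  fix x y z :: "nat \<Rightarrow> 'a set"
  show "0 \<le> path_dist m x y" by (simp add: path_dist_def)
  show "path_dist m x y = path_dist m y x" by (simp add: path_dist_def eq_commute)
  show "path_dist m x y = 0 \<longleftrightarrow> x = y" using assms by (simp add: path_dist_def)
  show "path_dist m x z \<le> path_dist m x y + path_dist m y z"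
  proof (cases "x = y \<or> y = z \<or> x = z")
    case True
    then show ?thesis by (auto simp: path_dist_def)
  next
    case False
    let ?A = "\<lambda>u v :: nat \<Rightarrow> 'a set. {n. \<forall>j<n. u j = v j}"
    have fin: "finite (?A x y)" "finite (?A y z)" "finite (?A x z)"
      using False by (auto intro: agreement_set_finite)
    have ne: "?A x y \<noteq> {}" "?A y z \<noteq> {}" by (auto intro: exI[of _ 0])
    let ?k = "min (Max (?A x y)) (Max (?A y z))"
    have "Max (?A x y) \<in> ?A x y" "Max (?A y z) \<in> ?A y z"
      using fin ne Max_in by blast+
    then have "?k \<in> ?A x z" by auto
    then have "?k \<le> Max (?A x z)" using fin by (intro Max_ge)
    then have "(1 / real m) ^ Max (?A x z) \<le> (1 / real m) ^ ?k"
      using assms by (intro power_decreasing) auto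
    also have "\<dots> \<le> (1 / real m) ^ Max (?A x y) + (1 / real m) ^ Max (?A y z)"
      by (auto simp: min_def)
    finally show ?thesis using False by (simp add: path_dist_def)
  qed
qed

definition path_borel :: "(nat \<Rightarrow> 'a measure) \<Rightarrow> nat \<Rightarrow> (nat \<Rightarrow> 'a set) measure" where
  "path_borel F m =
     sigma (paths F) {U. openin (Metric_space.mtopology (paths F) (path_dist m)) U}"


section \<open>Hausdorff dimension\<close>

definition ediam :: "('b \<Rightarrow> 'b \<Rightarrow> real) \<Rightarrow> 'b set \<Rightarrow> ennreal" where
  "ediam d U = (SUP x\<in>U. SUP y\<in>U. ennreal (d x y))"

text \<open>The usual convention for the exponent \<open>s = 0\<close>: every nonempty set contributes \<open>1\<close>,
  whereas \<open>0 powr 0 = 0\<close>. The value is only used for sets of finite diameter.\<close>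

definition diam_pow :: "('b \<Rightarrow> 'b \<Rightarrow> real) \<Rightarrow> real \<Rightarrow> 'b set \<Rightarrow> ennreal" where
  "diam_pow d s U =
     (if U = {} then 0 else if s = 0 then 1 else ennreal (enn2real (ediam d U) powr s))"

definition hausdorff_measure :: "'b set \<Rightarrow> ('b \<Rightarrow> 'b \<Rightarrow> real) \<Rightarrow> real \<Rightarrow> 'b set \<Rightarrow> ennreal" where
  "hausdorff_measure S d s E =
     (SUP \<delta>\<in>{0<..}. INF U\<in>{U :: nat \<Rightarrow> 'b set. (\<forall>i. U i \<subseteq> S \<and> ediam d (U i) \<le> ennreal \<delta>)
                                              \<and> E \<subseteq> (\<Union>i. U i)}.
        (\<Sum>i. diam_pow d s (U i)))"

definition hausdorff_dim :: "'b set \<Rightarrow> ('b \<Rightarrow> 'b \<Rightarrow> real) \<Rightarrow> 'b set \<Rightarrow> ereal" where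
  "hausdorff_dim S d E = Inf {ereal s |s. 0 \<le> s \<and> hausdorff_measure S d s E = 0}"


section \<open>Vector measures\<close>

definition vector_measure :: "'b measure \<Rightarrow> ('b set \<Rightarrow> 'c::real_normed_vector) \<Rightarrow> bool" where
  "vector_measure B \<mu> \<longleftrightarrow>
     (\<forall>A :: nat \<Rightarrow> 'b set. range A \<subseteq> sets B \<longrightarrow> disjoint_family A \<longrightarrow>
        (\<lambda>i. \<mu> (A i)) sums \<mu> (\<Union>i. A i))"

definition bounded_variation_on :: "'b measure \<Rightarrow> ('b set \<Rightarrow> 'c::real_normed_vector) \<Rightarrow> bool" where
  "bounded_variation_on B \<mu> \<longleftrightarrow>
     (\<exists>C. \<forall>P. finite P \<longrightarrow> P \<subseteq> sets B \<longrightarrow> disjoint P \<longrightarrow> (\<Sum>A\<in>P. norm (\<mu> A)) \<le> C)"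

text \<open>For \<open>\<mu> = 0\<close> the set is empty and the dimension is \<open>\<infinity>\<close>.\<close>

definition lower_hausdorff_dim ::
  "(nat \<Rightarrow> 'a measure) \<Rightarrow> nat \<Rightarrow> ((nat \<Rightarrow> 'a set) set \<Rightarrow> 'c::real_normed_vector) \<Rightarrow> ereal" where
  "lower_hausdorff_dim F m \<mu> =
     Inf {\<alpha>. \<exists>E \<in> sets (path_borel F m). \<mu> E \<noteq> 0 \<and> hausdorff_dim (paths F) (path_dist m) E \<le> \<alpha>}"


section \<open>Martingales\<close>

definition vec_martingale ::
  "'a measure \<Rightarrow> (nat \<Rightarrow> 'a measure) \<Rightarrow> (nat \<Rightarrow> 'a \<Rightarrow> 'c::{banach,second_countable_topology}) \<Rightarrow> bool" where
  "vec_martingale M F X \<longleftrightarrow>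
     (\<forall>n. X n \<in> borel_measurable (F n)) \<and> (\<forall>n. integrable M (X n)) \<and>
     (\<forall>n. \<forall>A \<in> sets (F n). (LINT x:A|M. X (Suc n) x) = (LINT x:A|M. X n x))"

definition child_labelling :: "(nat \<Rightarrow> 'a measure) \<Rightarrow> ('a set \<Rightarrow> 'm::finite \<Rightarrow> 'a set) \<Rightarrow> bool" where
  "child_labelling F J \<longleftrightarrow> (\<forall>n. \<forall>\<omega> \<in> atoms (F n). bij_betw (J \<omega>) UNIV (children F n \<omega>))"

definition martingale_space ::
  "'a measure \<Rightarrow> (nat \<Rightarrow> 'a measure) \<Rightarrow> ('a set \<Rightarrow> 'm::finite \<Rightarrow> 'a set) \<Rightarrow> (((real^'l)^'m) set)
     \<Rightarrow> (nat \<Rightarrow> 'a \<Rightarrow> real^'l::finite) set" where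
  "martingale_space M F J W =
     {X. vec_martingale M F X \<and> bdd_above (range (\<lambda>n. LINT x|M. norm (X n x))) \<and>
         (\<forall>n. \<forall>\<omega> \<in> atoms (F n). \<exists>b \<in> W. \<forall>j. \<forall>x \<in> J \<omega> j. X (Suc n) x - X n x = b $ j)}"

definition generated_martingale ::
  "(nat \<Rightarrow> 'a measure) \<Rightarrow> nat \<Rightarrow> ((nat \<Rightarrow> 'a set) set \<Rightarrow> 'c::real_vector) \<Rightarrow> nat \<Rightarrow> 'a \<Rightarrow> 'c" where
  "generated_martingale F m \<mu> n x =
     (\<Sum>\<omega> \<in> atoms (F n). (real m ^ n * indicator \<omega> x) *\<^sub>R \<mu> (cylinder F n \<omega>))"

text \<open>The measures whose martingale lies in \<open>martingale_space M F J W\<close>. The values of \<open>\<mu>\<close>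
  outside the Borel sets are unconstrained and irrelevant.\<close>

definition measures_in ::
  "'a measure \<Rightarrow> (nat \<Rightarrow> 'a measure) \<Rightarrow> ('a set \<Rightarrow> 'm::finite \<Rightarrow> 'a set) \<Rightarrow> (((real^'l)^'m) set)
     \<Rightarrow> ((nat \<Rightarrow> 'a set) set \<Rightarrow> real^'l::finite) set" where
  "measures_in M F J W =
     {\<mu>. vector_measure (path_borel F CARD('m)) \<mu> \<and>
         bounded_variation_on (path_borel F CARD('m)) \<mu> \<and>
         generated_martingale F CARD('m) \<mu> \<in> martingale_space M F J W}"


section \<open>The function \<open>\<kappa>\<close>\<close>

text \<open>The space \<open>V\<close> is \<open>zero_sum\<close> at \<open>'c = real\<close>, and \<open>V\<^sup>\<ell>\<close> is \<open>zero_sum\<close> at \<open>'c = real^'l\<close>.\<close>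

definition zero_sum :: "('c::comm_monoid_add ^ 'm::finite) set" where
  "zero_sum = {b. (\<Sum>j\<in>UNIV. b $ j) = 0}"

definition tensor :: "real^'m \<Rightarrow> real^'l \<Rightarrow> (real^'l)^'m::finite" where
  "tensor v a = (\<chi> j. (v $ j) *\<^sub>R a)"

definition kappa_vec :: "real^'m::finite \<Rightarrow> real \<Rightarrow> real" where
  "kappa_vec v \<theta> =
     (if \<theta> = 0 then ln (Max (range (\<lambda>j. \<bar>1 + v $ j\<bar>)))
      else \<theta> * ln ((1 / real CARD('m)) * (\<Sum>j\<in>UNIV. \<bar>1 + v $ j\<bar> powr (1 / \<theta>))))"

definition kappa :: "((real^'l)^'m::finite) set \<Rightarrow> real \<Rightarrow> real" where
  "kappa W \<theta> =
     Sup {kappa_vec v \<theta> |v. v \<in> zero_sum \<and> (\<exists>a. a \<noteq> 0 \<and> tensor v a \<in> W) \<and> (\<forall>j. v $ j \<ge> -1)}"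

end

theory Submission
  imports Defs
begin

text \<open>The number \<open>h = - \<kappa>'(1)\<close> is the largest Kullback--Leibler divergence from the uniform distribution
  of a probability vector \<open>(1 + v) / m\<close>, where \<open>v\<close> ranges over the compact set of admissible
  directions: \<open>v \<ge> -1\<close> and \<open>v \<otimes> a \<in> W\<close> for some \<open>a \<noteq> 0\<close>. The claimed dimension
  \<open>1 - h / ln m\<close> is the smallest entropy, in base \<open>m\<close>, of such a vector. The derivative is computed in
  \<open>kappa_has_left_derivative\<close> by pinching \<open>\<kappa>(\<theta>)\<close> between \<open>(1 - \<theta>) h\<close> and \<open>(1 - \<theta>) h + O((1 - \<theta>)\<^sup>2)\<close>.

  For the lower bound let \<open>tv\<close> be the total variation of \<open>\<mu>\<close>. Along \<open>tv\<close>-almost every path the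
  vector measure is eventually polarised: on small cylinders \<open>\<mu>\<close> is close to \<open>tv\<close> times a fixed unit
  vector \<open>u\<close>. Indeed, the norms of
  \<open>\<mu>\<close> on the cylinders of a fine level almost add up to the mass of \<open>tv\<close> (\<open>variation_approx_level\<close>), so
  the measures \<open>tv - u \<bullet> \<mu>\<close> with \<open>u\<close> the direction of \<open>\<mu>\<close> on the respective cylinder have small total
  mass, and a maximal inequality (\<open>deficit_maximal\<close>) keeps them small at all finer levels on most
  paths. A polarised atom is split by \<open>tv\<close> with weights \<open>(1 + v) / m\<close> such that \<open>v \<otimes> u\<close> is nearly in \<open>W\<close>,
  and by compactness (\<open>moment_bound_near_rank_one\<close>) the weights obey nearly the same moment bounds as
  those of admissible directions. For an exponent \<open>p\<close> slightly above one the \<open>p\<close>-th moments of the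
  cylinder masses therefore decay geometrically, and Markov's inequality with the Borel--Cantelli
  lemma (\<open>moment_decay\<close>) shows that the level-\<open>n\<close> cylinder of almost every path has mass at most
  \<open>m\<^sup>-\<^sup>n\<^sup>s\<close> eventually, for each \<open>s < 1 - h / ln m\<close>. The mass distribution principle (\<open>frostman\<close>)
  turns this into the dimension bound.

  For sharpness let \<open>v\<close> be an admissible direction of maximal divergence. The Bernoulli measure
  that splits every atom with the weights \<open>(1 + v) / m\<close>, multiplied by the corresponding vector \<open>a\<close>,
  belongs to the space, and the same moment argument with exponents below one shows that it lives
  on sets of the right dimension (\<open>extremal_measure\<close>).\<close>

section \<open>The tree of atoms\<close>

locale labelled_tree = uniform_filtration M F m
  for M :: "'a measure" and F :: "nat \<Rightarrow> 'a measure" and m :: nat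
    and J :: "'a set \<Rightarrow> 'm::finite \<Rightarrow> 'a set" +
  assumes labelling: "child_labelling F J"
    and card_m [simp]: "CARD('m) = m"
    and card_ge_2: "m \<ge> 2"
begin

lemma finite_atoms [simp]: "finite (atoms (F n))"
  using finite_alg[of n] by (auto simp: atoms_def)

lemma atoms_sets: "\<omega> \<in> atoms (F n) \<Longrightarrow> \<omega> \<in> sets (F n)"
  by (simp add: atoms_def)

lemma atoms_nonempty: "\<omega> \<in> atoms (F n) \<Longrightarrow> \<omega> \<noteq> {}"
  by (simp add: atoms_def)

lemma atom_subset_or_disjoint:
  assumes "\<omega> \<in> atoms (F n)" "A \<in> sets (F n)" "x \<in> \<omega>" "x \<in> A"
  shows "\<omega> \<subseteq> A"
proof -
  have "\<omega> \<inter> A \<in> sets (F n)" using assms by (auto simp: atoms_def)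
  then have "\<omega> \<inter> A = {} \<or> \<omega> \<inter> A = \<omega>" using assms(1) by (auto simp: atoms_def)
  then show ?thesis using assms by auto
qed

lemma atoms_unique:
  assumes "\<omega> \<in> atoms (F n)" "\<omega>' \<in> atoms (F n)" "x \<in> \<omega>" "x \<in> \<omega>'"
  shows "\<omega> = \<omega>'"
  using atom_subset_or_disjoint[of \<omega> n \<omega>' x] atom_subset_or_disjoint[of \<omega>' n \<omega> x] assms
  by (auto simp: atoms_sets)

text \<open>In a finite algebra the intersection of all members containing a point is an atom.\<close>

lemma atom_containing:
  assumes "x \<in> space M"
  obtains \<omega> where "\<omega> \<in> atoms (F n)" "x \<in> \<omega>"
proof -
  define S where "S = {A \<in> sets (F n). x \<in> A}"
  have fin: "finite S" using finite_alg by (auto simp: S_def)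
  have ne: "S \<noteq> {}" using assms sets.top[of "F n"] by (auto simp: S_def space_F)
  have 1: "\<Inter>S \<in> sets (F n)" using sets.finite_INT[OF fin ne, of "\<lambda>A. A" "F n"] by (auto simp: S_def)
  have 2: "x \<in> \<Inter>S" by (auto simp: S_def)
  have 3: "B = {} \<or> B = \<Inter>S" if B: "B \<in> sets (F n)" "B \<subseteq> \<Inter>S" for B
  proof (cases "x \<in> B")
    case True
    then show ?thesis using B by (auto simp: S_def)
  next
    case False
    then have "\<Inter>S - B \<in> S" using B 1 2 by (auto simp: S_def)
    then show ?thesis using B by auto
  qed
  show ?thesis using that[of "\<Inter>S"] 1 2 3 by (auto simp: atoms_def)
qed

lemma parent_atom:
  assumes "\<alpha> \<in> atoms (F (Suc n))"
  obtains \<omega> where "\<omega> \<in> atoms (F n)" "\<alpha> \<subseteq> \<omega>"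
proof -
  obtain x where x: "x \<in> \<alpha>" using atoms_nonempty[OF assms] by auto
  have "x \<in> space M" using x atoms_sets[OF assms] sets.sets_into_space space_F by blast
  then obtain \<omega> where w: "\<omega> \<in> atoms (F n)" "x \<in> \<omega>" by (rule atom_containing)
  have "\<omega> \<in> sets (F (Suc n))" using sets_F_mono[of n "Suc n"] atoms_sets[OF w(1)] by auto
  then have "\<alpha> \<subseteq> \<omega>" using atom_subset_or_disjoint[OF assms _ x w(2)] by auto
  then show ?thesis using that w by auto
qed

lemma J_bij: "\<omega> \<in> atoms (F n) \<Longrightarrow> bij_betw (J \<omega>) UNIV (children F n \<omega>)"
  using labelling by (auto simp: child_labelling_def)

lemma J_inj: "\<omega> \<in> atoms (F n) \<Longrightarrow> J \<omega> i = J \<omega> j \<longleftrightarrow> i = j"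
  using J_bij[of \<omega> n] by (auto simp: bij_betw_def inj_on_def)

lemma J_atoms: "\<omega> \<in> atoms (F n) \<Longrightarrow> J \<omega> j \<in> atoms (F (Suc n))"
  and J_subset: "\<omega> \<in> atoms (F n) \<Longrightarrow> J \<omega> j \<subseteq> \<omega>"
  using J_bij[of \<omega> n] by (auto simp: bij_betw_def children_def)

lemma child_eq_J:
  assumes "\<omega> \<in> atoms (F n)" "\<alpha> \<in> atoms (F (Suc n))" "\<alpha> \<subseteq> \<omega>"
  obtains j where "\<alpha> = J \<omega> j"
proof -
  have "\<alpha> \<in> children F n \<omega>" using assms by (auto simp: children_def)
  then show ?thesis using J_bij[OF assms(1)] that by (auto simp: bij_betw_def)
qed

lemma parent_unique:
  assumes "\<omega> \<in> atoms (F n)" "\<omega>' \<in> atoms (F n)" "\<alpha> \<subseteq> \<omega>" "\<alpha> \<subseteq> \<omega>'" "\<alpha> \<in> atoms (F k)"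
  shows "\<omega> = \<omega>'"
  using atoms_nonempty[OF assms(5)] atoms_unique[OF assms(1,2)] assms(3,4) by blast

lemma sum_atoms_Suc:
  fixes g :: "'a set \<Rightarrow> 'b::comm_monoid_add"
  shows "sum g (atoms (F (Suc n))) = (\<Sum>\<omega>\<in>atoms (F n). \<Sum>j\<in>UNIV. g (J \<omega> j))"
proof -
  have "(\<Sum>\<omega>\<in>atoms (F n). \<Sum>j\<in>UNIV. g (J \<omega> j)) = (\<Sum>(\<omega>,j)\<in>atoms (F n) \<times> UNIV. g (J \<omega> j))"
    by (simp add: sum.cartesian_product)
  also have "\<dots> = sum g (atoms (F (Suc n)))"
    unfolding case_prod_unfold
  proof (rule sum.reindex_bij_betw)
    show "bij_betw (\<lambda>x. J (fst x) (snd x)) (atoms (F n) \<times> (UNIV :: 'm set)) (atoms (F (Suc n)))"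
      unfolding bij_betw_def
    proof
      show "inj_on (\<lambda>x. J (fst x) (snd x)) (atoms (F n) \<times> UNIV)"
      proof (rule inj_onI, clarsimp)
        fix \<omega> \<omega>' :: "'a set" and j j'
        assume a: "\<omega> \<in> atoms (F n)" "\<omega>' \<in> atoms (F n)" "J \<omega> j = J \<omega>' j'"
        have "\<omega> = \<omega>'"
          using parent_unique[OF a(1,2) J_subset[OF a(1), of j] _ J_atoms[OF a(1)]] J_subset[OF a(2), of j'] a(3)
          by auto
        then show "\<omega> = \<omega>' \<and> j = j'" using a(3) J_inj[OF a(1)] by simp
      qed
      show "(\<lambda>x. J (fst x) (snd x)) ` (atoms (F n) \<times> (UNIV :: 'm set)) = atoms (F (Suc n))"
      proof (auto simp: J_atoms)
        fix \<alpha> assume "\<alpha> \<in> atoms (F (Suc n))"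
        then obtain \<omega> j where "\<omega> \<in> atoms (F n)" "\<alpha> = J \<omega> j"
          using parent_atom child_eq_J by metis
        then show "\<alpha> \<in> (\<lambda>x. J (fst x) (snd x)) ` (atoms (F n) \<times> (UNIV :: 'm set))"
          by (intro image_eqI[of _ _ "(\<omega>, j)"]) auto
      qed
    qed
  qed
  finally show ?thesis by simp
qed

lemma atoms_0: "atoms (F 0) = {space M}"
  using trivial_0 not_empty by (auto simp: atoms_def)

lemma atom_Un_children:
  assumes "\<omega> \<in> atoms (F n)"
  shows "\<omega> = (\<Union>j. J \<omega> j)"
proof
  show "\<omega> \<subseteq> (\<Union>j. J \<omega> j)"
  proof
    fix x assume x: "x \<in> \<omega>"
    have "x \<in> space M" using x atoms_sets[OF assms] sets.sets_into_space space_F by blast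
    then obtain \<alpha> where a: "\<alpha> \<in> atoms (F (Suc n))" "x \<in> \<alpha>" by (rule atom_containing)
    obtain \<omega>' where w: "\<omega>' \<in> atoms (F n)" "\<alpha> \<subseteq> \<omega>'" using parent_atom[OF a(1)] .
    have "\<omega>' = \<omega>" using atoms_unique[OF w(1) assms] a w x by auto
    then have "\<alpha> \<subseteq> \<omega>" using w by simp
    then obtain j where "\<alpha> = J \<omega> j" by (rule child_eq_J[OF assms a(1)])
    then show "x \<in> (\<Union>j. J \<omega> j)" using a by auto
  qed
  show "(\<Union>j. J \<omega> j) \<subseteq> \<omega>" using J_subset[OF assms] by auto
qed

lemma atom_measurable [measurable]: "\<omega> \<in> atoms (F n) \<Longrightarrow> \<omega> \<in> sets M"
  using atoms_sets subalg[of n] by (auto simp: subalgebra_def)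

lemma prob_atom: "\<omega> \<in> atoms (F n) \<Longrightarrow> prob \<omega> = 1 / real m ^ n"
proof (induction n arbitrary: \<omega>)
  case 0
  then show ?case by (simp add: atoms_0 prob_space)
next
  case (Suc n)
  obtain \<omega>' where w: "\<omega>' \<in> atoms (F n)" "\<omega> \<subseteq> \<omega>'" using parent_atom[OF Suc.prems] .
  have "prob \<omega>' = prob (\<Union>j. J \<omega>' j)" using atom_Un_children[OF w(1)] by simp
  also have "\<dots> = (\<Sum>j\<in>UNIV. prob (J \<omega>' j))"
  proof (rule finite_measure_finite_Union)
    show "disjoint_family (J \<omega>')"
      unfolding disjoint_family_on_def
      using atoms_unique[OF J_atoms[OF w(1)] J_atoms[OF w(1)]] J_inj[OF w(1)] by blast
    show "range (J \<omega>') \<subseteq> events" using J_atoms[OF w(1)] by auto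
  qed simp
  also have "\<dots> = (\<Sum>j\<in>(UNIV :: 'm set). prob \<omega>)"
  proof (intro sum.cong refl equal_prob[OF w(1)])
    show "J \<omega>' j \<in> children F n \<omega>'" for j using w J_atoms J_subset by (auto simp: children_def)
    show "\<omega> \<in> children F n \<omega>'" using w Suc.prems by (auto simp: children_def)
  qed
  finally have "real m * prob \<omega> = 1 / real m ^ n" using Suc.IH[OF w(1)] by simp
  then have "prob \<omega> = 1 / real m ^ n / real m" using card_ge_2 by (auto simp: field_simps)
  then show ?case by (simp add: field_simps)
qed

subsection \<open>Cylinders\<close>

abbreviation T where "T \<equiv> paths F"
abbreviation cyl where "cyl \<equiv> cylinder F"
abbreviation B where "B \<equiv> path_borel F m"

lemma path_atom: "\<gamma> \<in> T \<Longrightarrow> \<gamma> n \<in> atoms (F n)"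
  and path_step: "\<gamma> \<in> T \<Longrightarrow> \<gamma> (Suc n) \<subseteq> \<gamma> n"
  by (auto simp: paths_def)

lemma path_agree_down:
  assumes "\<gamma> \<in> T" "\<gamma>' \<in> T" "\<gamma> n = \<gamma>' n" "k \<le> n"
  shows "\<gamma> k = \<gamma>' k"
  using assms(4,3)
proof (induction rule: inc_induct)
  case (step i)
  then have "\<gamma> (Suc i) = \<gamma>' (Suc i)" by simp
  then show ?case
    using parent_unique[OF path_atom[OF assms(1)] path_atom[OF assms(2)], where n = i]
      path_step[OF assms(1), of i] path_step[OF assms(2), of i] path_atom[OF assms(1), of "Suc i"]
    by auto
qed simp

lemma in_cyl [simp]: "\<gamma> \<in> cyl n \<omega> \<longleftrightarrow> \<gamma> \<in> T \<and> \<gamma> n = \<omega>"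
  by (auto simp: cylinder_def)

lemma cyl_children:
  assumes "\<omega> \<in> atoms (F n)"
  shows "cyl n \<omega> = (\<Union>j. cyl (Suc n) (J \<omega> j))"
proof (intro set_eqI iffI)
  fix \<gamma> assume g: "\<gamma> \<in> cyl n \<omega>"
  then have "\<gamma> (Suc n) \<subseteq> \<omega>" using path_step by auto
  then obtain j where "\<gamma> (Suc n) = J \<omega> j"
    using child_eq_J[OF assms path_atom] g by (metis in_cyl)
  then show "\<gamma> \<in> (\<Union>j. cyl (Suc n) (J \<omega> j))" using g by auto
next
  fix \<gamma> assume "\<gamma> \<in> (\<Union>j. cyl (Suc n) (J \<omega> j))"
  then obtain j where g: "\<gamma> \<in> T" "\<gamma> (Suc n) = J \<omega> j" by auto
  have "\<gamma> n = \<omega>"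
    using parent_unique[OF path_atom[OF g(1)] assms path_step[OF g(1)] _ path_atom[OF g(1)]]
      J_subset[OF assms] g(2) by metis
  then show "\<gamma> \<in> cyl n \<omega>" using g by simp
qed

lemma path_child:
  assumes "\<gamma> \<in> T" obtains j where "\<gamma> (Suc n) = J (\<gamma> n) j"
  using child_eq_J[OF path_atom[OF assms] path_atom[OF assms] path_step[OF assms]] by metis

lemma parent_of_path:
  assumes "\<gamma> \<in> T" "\<omega> \<in> atoms (F n)" "\<gamma> (Suc n) = J \<omega> j"
  shows "\<gamma> n = \<omega>"
proof -
  have "\<gamma> \<in> cyl n \<omega>" unfolding cyl_children[OF assms(2)] using assms by auto
  then show ?thesis by simp
qed

subsection \<open>Metric and Borel sets\<close>

lemma path_metric: "Metric_space T (path_dist m)"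
  by (rule Metric_space_path_dist) (use card_ge_2 in simp)

lemma path_dist_le:
  assumes "\<gamma> \<in> T" "\<gamma>' \<in> T" "\<gamma> n = \<gamma>' n"
  shows "path_dist m \<gamma> \<gamma>' \<le> (1 / real m) ^ Suc n"
proof (cases "\<gamma> = \<gamma>'")
  case False
  have "Suc n \<le> Max {n. \<forall>j<n. \<gamma> j = \<gamma>' j}"
    using agreement_set_finite[OF False] path_agree_down[OF assms] by (intro Max_ge) auto
  then show ?thesis using False card_ge_2
    unfolding path_dist_def by (simp only: if_False, intro power_decreasing) auto
qed (simp add: path_dist_def)

lemma path_dist_ge:
  assumes "\<gamma> n \<noteq> \<gamma>' n"
  shows "(1 / real m) ^ n \<le> path_dist m \<gamma> \<gamma>'"
proof -
  have ne: "\<gamma> \<noteq> \<gamma>'" using assms by auto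
  have "Max {n. \<forall>j<n. \<gamma> j = \<gamma>' j} \<le> n"
  proof (rule Max.boundedI)
    show "k \<le> n" if "k \<in> {n. \<forall>j<n. \<gamma> j = \<gamma>' j}" for k
      using that assms by (cases "n < k") auto
    show "finite {n. \<forall>j<n. \<gamma> j = \<gamma>' j}" by (rule agreement_set_finite[OF ne])
    have "0 \<in> {n. \<forall>j<n. \<gamma> j = \<gamma>' j}" by simp
    then show "{n. \<forall>j<n. \<gamma> j = \<gamma>' j} \<noteq> {}" by blast
  qed
  then show ?thesis using ne card_ge_2
    unfolding path_dist_def by (simp only: if_False, intro power_decreasing) auto
qed

lemma powers_small:
  assumes "e > 0" obtains n where "n \<ge> N" "(1 / real m) ^ n < e"
proof -
  have "1 / real m < 1" using card_ge_2 by simp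
  then obtain n where n: "(1 / real m) ^ n < e"
    using real_arch_pow_inv[OF assms] by blast
  have "(1 / real m) ^ max n N \<le> (1 / real m) ^ n"
    using card_ge_2 by (intro power_decreasing) auto
  then show ?thesis using that[of "max n N"] n by auto
qed

interpretation path: Metric_space T "path_dist m" by (rule path_metric)

lemma openin_cyl: "openin path.mtopology (cyl n \<omega>)"
  unfolding path.openin_mtopology
proof (intro conjI ballI allI impI)
  fix \<gamma> assume g: "\<gamma> \<in> cyl n \<omega>"
  have "path.mball \<gamma> ((1 / real m) ^ n) \<subseteq> cyl n \<omega>"
  proof
    fix \<beta> assume b: "\<beta> \<in> path.mball \<gamma> ((1 / real m) ^ n)"
    then have "\<gamma> n = \<beta> n" using path_dist_ge[of \<gamma> n \<beta>] unfolding path.in_mball by linarith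
    then show "\<beta> \<in> cyl n \<omega>" using b g by auto
  qed
  moreover have "(1 / real m) ^ n > 0" using card_ge_2 by simp
  ultimately show "\<exists>r>0. path.mball \<gamma> r \<subseteq> cyl n \<omega>" by blast
qed (auto simp: cylinder_def)

lemma open_eq_Union_cyl:
  assumes "openin path.mtopology U"
  shows "U = (\<Union>{cyl n \<omega> |n \<omega>. \<omega> \<in> atoms (F n) \<and> cyl n \<omega> \<subseteq> U})"
proof
  show "U \<subseteq> \<Union>{cyl n \<omega> |n \<omega>. \<omega> \<in> atoms (F n) \<and> cyl n \<omega> \<subseteq> U}"
  proof
    fix \<gamma> assume g: "\<gamma> \<in> U"
    then have gT: "\<gamma> \<in> T" using assms path.openin_mtopology by blast
    obtain r where r: "r > 0" "path.mball \<gamma> r \<subseteq> U" using assms g path.openin_mtopology by blast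
    obtain n where n: "n \<ge> 1" "(1 / real m) ^ n < r" by (rule powers_small[OF r(1)])
    have "cyl (n - 1) (\<gamma> (n - 1)) \<subseteq> path.mball \<gamma> r"
    proof
      fix \<beta> assume b: "\<beta> \<in> cyl (n - 1) (\<gamma> (n - 1))"
      then have "path_dist m \<gamma> \<beta> \<le> (1 / real m) ^ Suc (n - 1)"
        using path_dist_le[OF gT, of \<beta> "n - 1"] by simp
      then show "\<beta> \<in> path.mball \<gamma> r" using n b gT by simp
    qed
    then have "cyl (n - 1) (\<gamma> (n - 1)) \<subseteq> U" using r by blast
    moreover have "\<gamma> \<in> cyl (n - 1) (\<gamma> (n - 1))" using gT by simp
    ultimately show "\<gamma> \<in> \<Union>{cyl n \<omega> |n \<omega>. \<omega> \<in> atoms (F n) \<and> cyl n \<omega> \<subseteq> U}"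
      using path_atom[OF gT] by blast
  qed
qed auto

lemma space_B [simp]: "space B = T"
  unfolding path_borel_def using path.openin_mtopology by (intro space_measure_of) auto

lemma sets_B_open: "sets B = sigma_sets T {U. openin path.mtopology U}"
  unfolding path_borel_def using path.openin_mtopology by (intro sets_measure_of) auto

lemma sets_B: "sets B = sigma_sets T {cyl n \<omega> |n \<omega>. \<omega> \<in> atoms (F n)}" (is "_ = sigma_sets T ?C")
proof
  have "U \<in> sigma_sets T ?C" if U: "openin path.mtopology U" for U
  proof -
    let ?D = "{cyl n \<omega> |n \<omega>. \<omega> \<in> atoms (F n) \<and> cyl n \<omega> \<subseteq> U}"
    interpret S: sigma_algebra T "sigma_sets T ?C"
      by (rule sigma_algebra_sigma_sets) (auto simp: cylinder_def)
    have "?C = (\<Union>n. cyl n ` atoms (F n))" by auto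
    then have "countable ?C" by (simp add: countable_finite)
    then have "countable ?D" by (rule countable_subset[rotated]) auto
    moreover have "?D \<subseteq> sigma_sets T ?C" by auto
    ultimately have "\<Union>?D \<in> sigma_sets T ?C" by (rule S.countable_Union)
    then show ?thesis using open_eq_Union_cyl[OF U] by simp
  qed
  then show "sets B \<subseteq> sigma_sets T ?C" unfolding sets_B_open by (intro sigma_sets_mono) auto
  show "sigma_sets T ?C \<subseteq> sets B" unfolding sets_B_open
    by (intro sigma_sets_mono) (auto simp: openin_cyl)
qed

lemma cyl_sets [measurable]: "cyl n \<omega> \<in> sets B"
  unfolding sets_B_open using openin_cyl by auto

lemma level_set_eq: "{\<gamma> \<in> T. \<gamma> n \<in> A} = (\<Union>\<omega>\<in>atoms (F n) \<inter> A. cyl n \<omega>)"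
  using path_atom by auto

text \<open>A set meeting two different level-\<open>n\<close> cylinders has diameter at least \<open>m\<^sup>-\<^sup>n\<close>; taking the
  finest cylinder that contains the given set therefore costs only the factor \<open>m\<close> in diameter.
  The tolerance \<open>e\<close> takes care of singletons, which lie in arbitrarily small cylinders.\<close>

lemma cyl_around_small_set:
  assumes U: "U \<subseteq> T" "U \<noteq> {}"
    and diam: "ediam (path_dist m) U \<le> ennreal ((1 / real m) ^ Suc N)"
    and s: "s > 0" and e: "e > 0"
  obtains n \<omega> where "n \<ge> N" "\<omega> \<in> atoms (F n)" "U \<subseteq> cyl n \<omega>"
    "((1 / real m) ^ n) powr s
       \<le> real m powr s * enn2real (ediam (path_dist m) U) powr s + e"
proof (cases "\<exists>k. \<exists>\<gamma>\<in>U. \<exists>\<gamma>'\<in>U. \<gamma> k \<noteq> \<gamma>' k")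
  case True
  let ?m = "real m" and ?d = "path_dist m"
  define k where "k = (LEAST k. \<exists>\<gamma>\<in>U. \<exists>\<gamma>'\<in>U. \<gamma> k \<noteq> \<gamma>' k)"
  obtain \<gamma> \<gamma>' where g: "\<gamma> \<in> U" "\<gamma>' \<in> U" "\<gamma> k \<noteq> \<gamma>' k"
    using LeastI_ex[OF True] unfolding k_def by blast
  have gT: "\<gamma> \<in> T" "\<gamma>' \<in> T" using g U by auto
  have "k \<noteq> 0" using g(3) path_atom[OF gT(1), of 0] path_atom[OF gT(2), of 0] by (auto simp: atoms_0 intro: ccontr)
  then obtain n where n: "k = Suc n" using not0_implies_Suc by blast
  have agree: "\<beta> n = \<gamma> n" if "\<beta> \<in> U" for \<beta>
    using not_less_Least[of n "\<lambda>k. \<exists>\<gamma>\<in>U. \<exists>\<gamma>'\<in>U. \<gamma> k \<noteq> \<gamma>' k"] that g(1) n unfolding k_def by auto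
  have "ennreal ((1/?m) ^ k) \<le> ennreal (?d \<gamma> \<gamma>')" using path_dist_ge[of \<gamma> k \<gamma>', OF g(3)] by (rule ennreal_leI)
  also have "\<dots> \<le> ediam ?d U" unfolding ediam_def by (intro SUP_upper2[OF g(1)] SUP_upper2[OF g(2)] order_refl)
  finally have lo: "ennreal ((1/?m) ^ k) \<le> ediam ?d U" .
  have "ennreal ((1/?m) ^ k) \<le> ennreal ((1/?m) ^ Suc N)" using lo diam by (rule order_trans)
  then have "(1/?m) ^ k \<le> (1/?m) ^ Suc N" by (subst (asm) ennreal_le_iff) auto
  then have "Suc N \<le> k" using card_ge_2 power_strict_decreasing[of k "Suc N" "1/?m"]
    by (cases "k < Suc N") (simp_all del: power_Suc)
  then have nN: "n \<ge> N" using n by simp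
  have fin: "ediam ?d U < top" using diam by (rule le_less_trans) simp
  have "(1/?m) ^ k \<le> enn2real (ediam ?d U)"
    using enn2real_mono[OF lo fin] by simp
  then have "(1/?m) ^ n \<le> ?m * enn2real (ediam ?d U)"
    using n card_ge_2 by (simp add: field_simps)
  then have "((1/?m) ^ n) powr s \<le> (?m * enn2real (ediam ?d U)) powr s"
    using s by (intro powr_mono2) auto
  also have "\<dots> = ?m powr s * enn2real (ediam ?d U) powr s" by (simp add: powr_mult)
  finally have "((1/?m) ^ n) powr s \<le> ?m powr s * enn2real (ediam ?d U) powr s + e" using e by simp
  moreover have "U \<subseteq> cyl n (\<gamma> n)" using agree U by auto
  ultimately show ?thesis using that[OF nN path_atom[OF gT(1)]] by blast
next
  case False
  let ?m = "real m"
  obtain \<gamma> where g: "\<gamma> \<in> U" using U by auto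
  have gT: "\<gamma> \<in> T" using g U by auto
  have "e powr (1/s) > 0" using e by simp
  then obtain n where n: "n \<ge> N" "(1 / ?m) ^ n < e powr (1/s)" by (rule powers_small)
  have "((1/?m)^n) powr s \<le> (e powr (1/s)) powr s" using n s by (intro powr_mono2) auto
  also have "\<dots> = e" using s e by (simp add: powr_powr)
  finally have "((1/?m)^n) powr s \<le> ?m powr s * enn2real (ediam (path_dist m) U) powr s + e"
    by (simp add: add_increasing)
  moreover have "U \<subseteq> cyl n (\<gamma> n)" using False U g by auto
  ultimately show ?thesis using that[OF n(1) path_atom[OF gT]] by blast
qed

end

section \<open>Total variation of a vector measure\<close>

lemma vector_measure_empty:
  assumes "vector_measure B \<mu>"
  shows "\<mu> {} = 0"
proof -
  have "(\<lambda>i::nat. \<mu> {}) sums \<mu> (\<Union>i::nat. {})"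
    using assms[unfolded vector_measure_def, rule_format, of "\<lambda>_. {}"] by (auto simp: disjoint_family_on_def)
  then have "(\<lambda>i::nat. \<mu> {}) \<longlonglongrightarrow> 0" by (intro summable_LIMSEQ_zero sums_summable)
  then show ?thesis by (simp add: LIMSEQ_const_iff)
qed

lemma vector_measure_Un:
  assumes "vector_measure B \<mu>" "X \<in> sets B" "Y \<in> sets B" "X \<inter> Y = {}"
  shows "\<mu> (X \<union> Y) = \<mu> X + \<mu> Y"
proof -
  have "(\<lambda>i. \<mu> (binaryset X Y i)) sums \<mu> (\<Union>i. binaryset X Y i)"
    using assms(2-4) by (intro assms(1)[unfolded vector_measure_def, rule_format])
       (auto simp: range_binaryset_eq disjoint_family_on_def binaryset_def)
  moreover have "(\<lambda>i. \<mu> (binaryset X Y i)) sums (\<mu> X + \<mu> Y)"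
    by (rule binaryset_sums) (rule vector_measure_empty[OF assms(1)])
  ultimately show ?thesis unfolding UN_binaryset_eq by (rule sums_unique2)
qed

lemma vector_measure_Diff:
  assumes "vector_measure B \<mu>" "X \<in> sets B" "Y \<in> sets B" "Y \<subseteq> X"
  shows "\<mu> (X - Y) = \<mu> X - \<mu> Y"
  using vector_measure_Un[OF assms(1), of "X - Y" Y] assms
  by (simp add: Un_absorb2 Diff_disjoint inf_commute)

lemma vector_measure_finite_UN:
  assumes "vector_measure B \<mu>" "finite I" "\<And>i. i \<in> I \<Longrightarrow> X i \<in> sets B" "disjoint_family_on X I"
  shows "\<mu> (\<Union>i\<in>I. X i) = (\<Sum>i\<in>I. \<mu> (X i))"
  using assms(2-4)
proof (induction I rule: finite_induct)
  case empty
  then show ?case by (simp add: vector_measure_empty[OF assms(1)])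
next
  case (insert i I)
  have "\<mu> (X i \<union> (\<Union>i\<in>I. X i)) = \<mu> (X i) + \<mu> (\<Union>i\<in>I. X i)"
    using insert by (intro vector_measure_Un[OF assms(1)]) (auto simp: disjoint_family_on_def)
  moreover have "disjoint_family_on X I" using insert.prems by (auto simp: disjoint_family_on_def)
  ultimately show ?case using insert by simp
qed

definition variation_families :: "'b measure \<Rightarrow> 'b set \<Rightarrow> 'b set set set" where
  "variation_families B A = {P. finite P \<and> P \<subseteq> sets B \<and> disjoint P \<and> \<Union>P \<subseteq> A}"

definition variation :: "'b measure \<Rightarrow> ('b set \<Rightarrow> 'c::real_normed_vector) \<Rightarrow> 'b set \<Rightarrow> ennreal" where
  "variation B \<mu> A = (SUP P\<in>variation_families B A. ennreal (\<Sum>X\<in>P. norm (\<mu> X)))"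

lemma empty_family: "{} \<in> variation_families B A"
  by (auto simp: variation_families_def)

lemma variation_superadditive:
  assumes "A \<inter> A' = {}" "\<mu> {} = 0"
  shows "variation B \<mu> A + variation B \<mu> A' \<le> variation B \<mu> (A \<union> A')"
proof -
  let ?f = "\<lambda>P. ennreal (\<Sum>X\<in>P. norm (\<mu> X))"
  have "?f P + ?f Q \<le> variation B \<mu> (A \<union> A')"
    if P: "P \<in> variation_families B A" and Q: "Q \<in> variation_families B A'" for P Q
  proof -
    have dis: "X = {}" if "X \<in> P" "X \<in> Q" for X
      using P Q that assms(1) unfolding variation_families_def by blast
    have "?f P + ?f Q = ennreal ((\<Sum>X\<in>P. norm (\<mu> X)) + (\<Sum>X\<in>Q. norm (\<mu> X)))"
      by (simp add: sum_nonneg)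
    also have "(\<Sum>X\<in>P. norm (\<mu> X)) + (\<Sum>X\<in>Q. norm (\<mu> X)) = (\<Sum>X\<in>P \<union> Q. norm (\<mu> X))"
      using P Q dis assms(2) by (subst sum.union_inter_neutral) (auto simp: variation_families_def)
    also have "ennreal \<dots> \<le> variation B \<mu> (A \<union> A')"
      unfolding variation_def
    proof (rule SUP_upper)
      have PQ: "X \<inter> Y = {}" if "X \<in> P" "Y \<in> Q" for X Y
        using P Q that assms(1) unfolding variation_families_def by blast
      have "disjoint P" "disjoint Q" using P Q by (auto simp: variation_families_def)
      then have "disjoint (P \<union> Q)"
        unfolding disjoint_def using PQ by (metis Int_commute Un_iff)
      then show "P \<union> Q \<in> variation_families B (A \<union> A')"
        using P Q by (auto simp: variation_families_def)
    qed
    finally show ?thesis .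
  qed
  then have "variation B \<mu> A + ?f Q \<le> variation B \<mu> (A \<union> A')"
    if "Q \<in> variation_families B A'" for Q
    unfolding variation_def[of B \<mu> A] using empty_family[of B A] that
    by (subst ennreal_SUP_add_left[symmetric]) (auto intro!: SUP_least)
  then show ?thesis
    unfolding variation_def[of B \<mu> A'] using empty_family[of B A']
    by (subst ennreal_SUP_add_right) (auto intro!: SUP_least)
qed

lemma variation_empty: "\<mu> {} = 0 \<Longrightarrow> variation B \<mu> {} = 0"
proof -
  assume "\<mu> {} = 0"
  then have "(\<Sum>X\<in>P. norm (\<mu> X)) = 0" if "P \<in> variation_families B {}" for P
    using that by (intro sum.neutral) (auto simp: variation_families_def)
  then show ?thesis by (auto simp: variation_def intro!: antisym SUP_least)
qed

lemma variation_mono: "A \<subseteq> A' \<Longrightarrow> variation B \<mu> A \<le> variation B \<mu> A'"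
  unfolding variation_def by (rule SUP_subset_mono) (auto simp: variation_families_def)

text \<open>A family inside
  \<open>\<Union>i. A i\<close> is refined by intersecting its members with the \<open>A i\<close>, and families inside
  finitely many of the \<open>A i\<close> are put together.\<close>

lemma variation_countably_additive:
  fixes \<mu> :: "'b set \<Rightarrow> 'c::banach"
  assumes vm: "vector_measure B \<mu>" and A: "range A \<subseteq> sets B" "disjoint_family (A :: nat \<Rightarrow> _)"
  shows "(\<Sum>i. variation B \<mu> (A i)) = variation B \<mu> (\<Union>i. A i)"
proof (rule antisym)
  have fin: "(\<Sum>i<n. variation B \<mu> (A i)) \<le> variation B \<mu> (\<Union>i<n. A i)" for n
  proof (induction n)
    case (Suc n)
    have "A i \<inter> A n = {}" if "i < n" for i using A(2) that by (auto simp: disjoint_family_on_def)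
    then have "(\<Union>i<n. A i) \<inter> A n = {}" by blast
    from variation_superadditive[OF this, of \<mu> B] vector_measure_empty[OF vm]
    have "variation B \<mu> (\<Union>i<n. A i) + variation B \<mu> (A n) \<le> variation B \<mu> (\<Union>i<Suc n. A i)"
      by (simp add: lessThan_Suc Un_commute)
    then show ?case using Suc by (simp add: add_right_mono order_trans[OF add_right_mono])
  qed (simp)
  show "(\<Sum>i. variation B \<mu> (A i)) \<le> variation B \<mu> (\<Union>i. A i)"
  proof (rule suminf_le_const[OF summableI])
    show "(\<Sum>i<n. variation B \<mu> (A i)) \<le> variation B \<mu> (\<Union>i. A i)" for n
      by (rule order_trans[OF fin variation_mono]) auto
  qed
next
  show "variation B \<mu> (\<Union>i. A i) \<le> (\<Sum>i. variation B \<mu> (A i))"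
    unfolding variation_def[of B \<mu> "\<Union>i. A i"]
  proof (rule SUP_least)
    fix P assume P: "P \<in> variation_families B (\<Union>i. A i)"
    have refine: "ennreal (norm (\<mu> X)) \<le> (\<Sum>i. ennreal (norm (\<mu> (X \<inter> A i))))" if X: "X \<in> P" for X
    proof (cases "summable (\<lambda>i. norm (\<mu> (X \<inter> A i)))")
      case True
      have "(\<lambda>i. \<mu> (X \<inter> A i)) sums \<mu> (\<Union>i. X \<inter> A i)"
      proof (intro vm[unfolded vector_measure_def, rule_format])
        have "X \<in> sets B" using X P by (auto simp: variation_families_def)
        then show "range (\<lambda>i. X \<inter> A i) \<subseteq> sets B" using A(1) by auto
        show "disjoint_family (\<lambda>i. X \<inter> A i)"
          using A(2) unfolding disjoint_family_on_def by blast
      qed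
      also have "(\<Union>i. X \<inter> A i) = X" using X P by (auto simp: variation_families_def)
      finally have "norm (\<mu> X) \<le> (\<Sum>i. norm (\<mu> (X \<inter> A i)))"
        using summable_norm[OF True] by (simp add: sums_iff)
      then have "ennreal (norm (\<mu> X)) \<le> ennreal (\<Sum>i. norm (\<mu> (X \<inter> A i)))" by (rule ennreal_leI)
      also have "\<dots> = (\<Sum>i. ennreal (norm (\<mu> (X \<inter> A i))))"
        using True by (intro suminf_ennreal2[symmetric]) auto
      finally show ?thesis .
    next
      case False
      then have "(\<Sum>i. ennreal (norm (\<mu> (X \<inter> A i)))) = top"
        by (metis norm_ge_zero summable_suminf_not_top)
      then show ?thesis by simp
    qed
    have piece: "(\<Sum>X\<in>P. ennreal (norm (\<mu> (X \<inter> A i)))) \<le> variation B \<mu> (A i)" for i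
    proof -
      let ?g = "\<lambda>X. X \<inter> A i"
      have "(\<Sum>X\<in>P. ennreal (norm (\<mu> (X \<inter> A i)))) = ennreal (\<Sum>X\<in>P. norm (\<mu> (?g X)))"
        by simp
      also have "(\<Sum>X\<in>P. norm (\<mu> (?g X))) = (\<Sum>Y\<in>?g ` P. norm (\<mu> Y))"
      proof (subst sum.reindex_nontrivial)
        fix X Y assume "X \<in> P" "Y \<in> P" "X \<noteq> Y" "X \<inter> A i = Y \<inter> A i"
        then have "X \<inter> A i = X \<inter> A i \<inter> (Y \<inter> A i)" "X \<inter> Y = {}"
          using P unfolding variation_families_def disjoint_def by simp_all
        then have "X \<inter> A i = {}" by blast
        then show "norm (\<mu> (X \<inter> A i)) = 0" by (simp add: vector_measure_empty[OF vm])
      qed (use P in \<open>auto simp: variation_families_def\<close>)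
      also have "ennreal \<dots> \<le> variation B \<mu> (A i)"
        unfolding variation_def
      proof (rule SUP_upper)
        have "disjoint (?g ` P)" using P unfolding variation_families_def disjoint_def by blast
        then show "?g ` P \<in> variation_families B (A i)"
          using P A(1) by (auto simp: variation_families_def)
      qed
      finally show ?thesis .
    qed
    have "ennreal (\<Sum>X\<in>P. norm (\<mu> X)) = (\<Sum>X\<in>P. ennreal (norm (\<mu> X)))" by simp
    also have "\<dots> \<le> (\<Sum>X\<in>P. \<Sum>i. ennreal (norm (\<mu> (X \<inter> A i))))" by (intro sum_mono refine)
    also have "\<dots> = (\<Sum>i. \<Sum>X\<in>P. ennreal (norm (\<mu> (X \<inter> A i))))" by (rule suminf_sum[symmetric]) simp
    also have "\<dots> \<le> (\<Sum>i. variation B \<mu> (A i))" by (intro suminf_le piece) auto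
    finally show "ennreal (\<Sum>X\<in>P. norm (\<mu> X)) \<le> (\<Sum>i. variation B \<mu> (A i))" .
  qed
qed

definition variation_measure :: "'b measure \<Rightarrow> ('b set \<Rightarrow> 'c::real_normed_vector) \<Rightarrow> 'b measure" where
  "variation_measure B \<mu> = measure_of (space B) (sets B) (variation B \<mu>)"

lemma space_variation_measure [simp]: "space (variation_measure B \<mu>) = space B"
  and sets_variation_measure [simp, measurable_cong]: "sets (variation_measure B \<mu>) = sets B"
  by (simp_all add: variation_measure_def sets.space_closed space_measure_of_conv)

lemma emeasure_variation_measure:
  fixes \<mu> :: "'b set \<Rightarrow> 'c::banach"
  assumes "vector_measure B \<mu>" "A \<in> sets B"
  shows "emeasure (variation_measure B \<mu>) A = variation B \<mu> A"
proof (rule emeasure_measure_of[OF variation_measure_def])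
  show "positive (sets (variation_measure B \<mu>)) (variation B \<mu>)"
    using variation_empty[of \<mu> B, OF vector_measure_empty[OF assms(1)]] by (simp add: positive_def)
  show "countably_additive (sets (variation_measure B \<mu>)) (variation B \<mu>)"
    using variation_countably_additive[OF assms(1)] by (simp add: countably_additive_def)
qed (use assms sets.space_closed in auto)

lemma finite_variation_measure:
  fixes \<mu> :: "'b set \<Rightarrow> 'c::banach"
  assumes "vector_measure B \<mu>" "bounded_variation_on B \<mu>"
  shows "finite_measure (variation_measure B \<mu>)"
proof
  obtain C where C: "\<And>P. finite P \<Longrightarrow> P \<subseteq> sets B \<Longrightarrow> disjoint P \<Longrightarrow> (\<Sum>A\<in>P. norm (\<mu> A)) \<le> C"
    using assms(2) by (auto simp: bounded_variation_on_def)
  have "variation B \<mu> (space B) \<le> ennreal C"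
    unfolding variation_def by (intro SUP_least ennreal_leI C) (auto simp: variation_families_def)
  then show "emeasure (variation_measure B \<mu>) (space (variation_measure B \<mu>)) \<noteq> \<infinity>"
    using emeasure_variation_measure[OF assms(1), of "space B"] by (auto simp: top_unique)
qed

lemma norm_le_variation_measure:
  fixes \<mu> :: "'b set \<Rightarrow> 'c::banach"
  assumes "vector_measure B \<mu>" "bounded_variation_on B \<mu>" "A \<in> sets B"
  shows "norm (\<mu> A) \<le> measure (variation_measure B \<mu>) A"
proof -
  interpret finite_measure "variation_measure B \<mu>" by (rule finite_variation_measure[OF assms(1,2)])
  have "{A} \<in> variation_families B A" using assms by (auto simp: variation_families_def)
  from SUP_upper[OF this, of "\<lambda>P. ennreal (\<Sum>X\<in>P. norm (\<mu> X))"]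
  have "ennreal (norm (\<mu> A)) \<le> variation B \<mu> A" by (simp add: variation_def)
  also have "\<dots> = ennreal (measure (variation_measure B \<mu>) A)"
    using emeasure_variation_measure[OF assms(1,3)] by (simp add: emeasure_eq_measure)
  finally show ?thesis by simp
qed

lemma variation_measure_approx:
  fixes \<mu> :: "'b set \<Rightarrow> 'c::banach"
  assumes "vector_measure B \<mu>" "bounded_variation_on B \<mu>" "e > 0"
  obtains P where "finite P" "P \<subseteq> sets B" "disjoint P"
    "measure (variation_measure B \<mu>) (space B) - e < (\<Sum>X\<in>P. norm (\<mu> X))"
proof (cases "measure (variation_measure B \<mu>) (space B) < e")
  case True
  then show ?thesis using that[of "{}"] by simp
next
  case False
  interpret finite_measure "variation_measure B \<mu>" by (rule finite_variation_measure[OF assms(1,2)])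
  let ?v = "measure (variation_measure B \<mu>) (space B)"
  have "ennreal (?v - e) < ennreal ?v" using False assms(3) by (subst ennreal_less_iff) auto
  also have "\<dots> = variation B \<mu> (space B)"
    using emeasure_variation_measure[OF assms(1), of "space B"] by (simp add: emeasure_eq_measure)
  finally obtain P where "P \<in> variation_families B (space B)" "ennreal (?v - e) < ennreal (\<Sum>X\<in>P. norm (\<mu> X))"
    unfolding variation_def less_SUP_iff by auto
  then show ?thesis
    using that[of P] False by (auto simp: variation_families_def ennreal_less_iff)
qed

section \<open>Masses of cylinders along a path\<close>

context labelled_tree
begin

abbreviation dst where "dst \<equiv> path_dist m"

lemma hausdorff_cover:
  assumes "hausdorff_measure T dst s E = 0" "\<delta> > 0" "\<eta> > 0"
  obtains U :: "nat \<Rightarrow> _" where "\<And>i. U i \<subseteq> T" "\<And>i. ediam dst (U i) \<le> ennreal \<delta>" "E \<subseteq> (\<Union>i. U i)"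
    "(\<Sum>i. diam_pow dst s (U i)) < ennreal \<eta>"
proof -
  let ?C = "{U :: nat \<Rightarrow> _. (\<forall>i. U i \<subseteq> T \<and> ediam dst (U i) \<le> ennreal \<delta>) \<and> E \<subseteq> (\<Union>i. U i)}"
  have "(INF U\<in>?C. (\<Sum>i. diam_pow dst s (U i))) \<le> hausdorff_measure T dst s E"
    unfolding hausdorff_measure_def using assms(2) by (intro SUP_upper) auto
  also have "\<dots> < ennreal \<eta>" using assms by simp
  finally obtain U where "U \<in> ?C" "(\<Sum>i. diam_pow dst s (U i)) < ennreal \<eta>"
    unfolding INF_less_iff by blast
  then show ?thesis using that by blast
qed

lemma hausdorff_measure_0_empty:
  assumes "hausdorff_measure T dst 0 E = 0"
  shows "E = {}"
proof -
  obtain U :: "nat \<Rightarrow> _" where U: "E \<subseteq> (\<Union>i. U i)" "(\<Sum>i. diam_pow dst 0 (U i)) < ennreal 1"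
    by (rule hausdorff_cover[OF assms zero_less_one zero_less_one])
  have "U i = {}" for i
  proof (rule ccontr)
    assume "U i \<noteq> {}"
    then have "1 = diam_pow dst 0 (U i)" by (simp add: diam_pow_def)
    also have "\<dots> \<le> (\<Sum>i. diam_pow dst 0 (U i))"
      using sum_le_suminf[of "\<lambda>i. diam_pow dst 0 (U i)" "{i}"] by simp
    finally show False using U(2) by simp
  qed
  then have "(\<Union>i. U i) = {}" by simp
  then show ?thesis using U(1) by simp
qed

lemma sets_level: "{\<gamma>\<in>T. \<gamma> n \<in> A} \<in> sets B"
  unfolding level_set_eq by (intro sets.finite_UN) auto

lemma sets_all_levels: "{\<gamma>\<in>T. \<forall>n\<ge>N. P n (\<gamma> n)} \<in> sets B"
proof -
  have "{\<gamma>\<in>T. \<forall>n\<ge>N. P n (\<gamma> n)} = (\<Inter>n\<in>{N..}. {\<gamma>\<in>T. \<gamma> n \<in> {\<omega>. P n \<omega>}})" by (auto intro: order_refl)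
  also have "\<dots> \<in> sets B" by (rule sets.countable_INT'[OF countableI_type]) (use sets_level[of _ "{\<omega>. P _ \<omega>}"] in auto)
  finally show ?thesis .
qed

text \<open>The mass distribution principle: each member of a cover that meets \<open>E\<close> sits in a cylinder of
  comparable diameter, and that cylinder is light because it contains a path of \<open>E\<close>. The mass of
  \<open>E\<close> is therefore at most a constant times the Hausdorff sum of the cover.\<close>

lemma frostman_uniform:
  assumes "finite_measure \<nu>" and sets: "sets \<nu> = sets B" and s: "s > 0"
    and E: "E \<in> sets B" "hausdorff_measure T dst s E = 0"
    and light: "\<And>\<gamma> n. \<gamma> \<in> E \<Longrightarrow> n \<ge> N \<Longrightarrow> measure \<nu> (cyl n (\<gamma> n)) \<le> ((1 / real m) ^ n) powr s"
  shows "measure \<nu> E = 0"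
proof -
  interpret finite_measure \<nu> by (rule assms(1))
  let ?M = "real m powr s"
  have "measure \<nu> E \<le> \<epsilon>" if e: "\<epsilon> > 0" for \<epsilon>
  proof -
    \<comment> \<open>Half of \<open>\<epsilon>\<close> pays for the enlarged Hausdorff sum \<open>?M * \<eta>\<close>, the other half is distributed
      geometrically over the tolerances of the enclosing cylinders.\<close>
    define \<eta> where "\<eta> = \<epsilon> / (2 * (?M + 1))"
    have Mpos: "?M > 0" using card_ge_2 by simp
    have eta: "\<eta> > 0" "?M * \<eta> \<le> \<epsilon> / 2" using e Mpos unfolding \<eta>_def by (auto simp: field_simps add_pos_pos)
    have del: "(1 / real m) ^ Suc N > 0" using card_ge_2 by simp
    obtain U :: "nat \<Rightarrow> _" where U: "\<And>i. U i \<subseteq> T" "\<And>i. ediam dst (U i) \<le> ennreal ((1 / real m) ^ Suc N)"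
      "E \<subseteq> (\<Union>i. U i)" "(\<Sum>i. diam_pow dst s (U i)) < ennreal \<eta>"
      using hausdorff_cover[OF E(2) del eta(1)] by blast
    have "\<exists>C\<in>sets B. U i \<inter> E \<subseteq> C \<and> emeasure \<nu> C \<le> ennreal ?M * diam_pow dst s (U i) + ennreal (\<epsilon>/2 * (1/2)^Suc i)" for i
    proof (cases "U i \<inter> E = {}")
      case False
      then obtain \<gamma> where g: "\<gamma> \<in> U i" "\<gamma> \<in> E" by auto
      then have ne: "U i \<noteq> {}" by auto
      have e': "\<epsilon>/2 * (1/2)^Suc i > 0" using e by simp
      obtain n \<omega> where n: "n \<ge> N" "\<omega> \<in> atoms (F n)" "U i \<subseteq> cyl n \<omega>"
        "((1 / real m) ^ n) powr s \<le> ?M * enn2real (ediam dst (U i)) powr s + \<epsilon>/2 * (1/2)^Suc i"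
        by (rule cyl_around_small_set[OF U(1) ne U(2) s e'])
      have w: "\<omega> = \<gamma> n" using n(3) g by auto
      have "emeasure \<nu> (cyl n \<omega>) \<le> ennreal (((1 / real m) ^ n) powr s)"
        unfolding emeasure_eq_measure w using light[OF g(2) n(1)] by (intro ennreal_leI)
      also have "\<dots> \<le> ennreal (?M * enn2real (ediam dst (U i)) powr s + \<epsilon>/2 * (1/2)^Suc i)"
        by (rule ennreal_leI[OF n(4)])
      also have "\<dots> = ennreal ?M * diam_pow dst s (U i) + ennreal (\<epsilon>/2 * (1/2)^Suc i)"
        using e ne s by (subst ennreal_plus) (auto simp: diam_pow_def ennreal_mult)
      finally show ?thesis using n(3) by (intro bexI[of _ "cyl n \<omega>"]) auto
    qed (auto intro!: bexI[of _ "{}"])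
    then obtain C where C: "\<And>i. C i \<in> sets B" "\<And>i. U i \<inter> E \<subseteq> C i"
       "\<And>i. emeasure \<nu> (C i) \<le> ennreal ?M * diam_pow dst s (U i) + ennreal (\<epsilon>/2 * (1/2)^Suc i)" by metis
    have sm: "(\<lambda>i. \<epsilon>/2 * (1/2)^Suc i) sums (\<epsilon>/2)"
      using sums_mult[OF power_half_series, of "\<epsilon>/2"] by simp
    have "E \<subseteq> (\<Union>i. C i)" using U(3) C(2) by blast
    then have "emeasure \<nu> E \<le> emeasure \<nu> (\<Union>i. C i)"
      using C(1) by (intro emeasure_mono) (auto simp: sets)
    also have "\<dots> \<le> (\<Sum>i. emeasure \<nu> (C i))"
      using C(1) by (intro emeasure_subadditive_countably) (auto simp: sets)
    also have "\<dots> \<le> (\<Sum>i. ennreal ?M * diam_pow dst s (U i) + ennreal (\<epsilon>/2 * (1/2)^Suc i))"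
      by (intro suminf_le C) auto
    also have "\<dots> = (\<Sum>i. ennreal ?M * diam_pow dst s (U i)) + (\<Sum>i. ennreal (\<epsilon>/2 * (1/2)^Suc i))"
      by (intro suminf_add[symmetric]) auto
    also have "(\<Sum>i. ennreal ?M * diam_pow dst s (U i)) = ennreal ?M * (\<Sum>i. diam_pow dst s (U i))"
      by simp
    also have "(\<Sum>i. ennreal (\<epsilon>/2 * (1/2)^Suc i)) = ennreal (\<epsilon>/2)"
      using sm e by (subst suminf_ennreal2) (auto simp: sums_iff)
    also have "ennreal ?M * (\<Sum>i. diam_pow dst s (U i)) + ennreal (\<epsilon>/2) \<le> ennreal ?M * ennreal \<eta> + ennreal (\<epsilon>/2)"
      using U(4) by (intro add_right_mono mult_left_mono) auto
    also have "\<dots> = ennreal (?M * \<eta> + \<epsilon>/2)" using e eta by (simp add: ennreal_mult)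
    also have "\<dots> \<le> ennreal \<epsilon>" using eta by (intro ennreal_leI) simp
    finally show ?thesis using e by (simp add: emeasure_eq_measure)
  qed
  then have "measure \<nu> E \<le> 0" by (rule field_le_epsilon) simp
  then show ?thesis by (rule antisym) simp
qed

text \<open>Cutting \<open>E\<close> according to the generation from which the cylinders are light reduces the almost
  everywhere hypothesis to the uniform one.\<close>

lemma frostman:
  assumes "finite_measure \<nu>" and sets: "sets \<nu> = sets B" and s: "s > 0"
    and E: "E \<in> sets B" "hausdorff_measure T dst s E = 0"
    and light: "AE \<gamma> in \<nu>. \<forall>\<^sub>F n in sequentially. measure \<nu> (cyl n (\<gamma> n)) \<le> ((1 / real m) ^ n) powr s"
  shows "measure \<nu> E = 0"
proof -
  interpret finite_measure \<nu> by (rule assms(1))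
  define L where "L N = {\<gamma>\<in>T. \<forall>n\<ge>N. measure \<nu> (cyl n (\<gamma> n)) \<le> ((1 / real m) ^ n) powr s}" for N
  have L: "L N \<in> sets B" for N
    unfolding L_def by (rule sets_all_levels)
  have 0: "measure \<nu> (E \<inter> L N) = 0" for N
  proof (rule frostman_uniform[OF assms(1) sets s, where N = N])
    have "hausdorff_measure T dst s (E \<inter> L N) \<le> hausdorff_measure T dst s E"
      unfolding hausdorff_measure_def by (intro SUP_mono' INF_superset_mono) auto
    then show "hausdorff_measure T dst s (E \<inter> L N) = 0" using E by simp
    show "E \<inter> L N \<in> sets B" using E L by simp
    show "measure \<nu> (cyl n (\<gamma> n)) \<le> ((1 / real m) ^ n) powr s" if "\<gamma> \<in> E \<inter> L N" "n \<ge> N" for \<gamma> n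
      using that unfolding L_def by blast
  qed
  have "AE \<gamma> in \<nu>. \<exists>N. \<gamma> \<in> L N"
    using light AE_space[of \<nu>]
  proof eventually_elim
    case (elim \<gamma>)
    then show ?case by (auto simp: L_def eventually_sequentially sets_eq_imp_space_eq[OF sets])
  qed
  moreover have "AE \<gamma> in \<nu>. \<forall>N. \<gamma> \<notin> E \<inter> L N"
    unfolding AE_all_countable
  proof
    fix N
    have "E \<inter> L N \<in> null_sets \<nu>"
      using 0[of N] E L[of N] by (intro null_setsI) (auto simp: emeasure_eq_measure sets)
    then show "AE \<gamma> in \<nu>. \<gamma> \<notin> E \<inter> L N" by (rule AE_not_in)
  qed
  ultimately have "AE \<gamma> in \<nu>. \<gamma> \<notin> E" by eventually_elim auto
  then have "E \<in> null_sets \<nu>" using E by (subst (asm) AE_iff_null_sets[symmetric]) (auto simp: sets)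
  then show ?thesis by (simp add: null_sets_def measure_def)
qed

lemma ediam_cyl: "ediam dst (cyl n \<omega>) \<le> ennreal ((1 / real m) ^ n)"
  unfolding ediam_def
proof (intro SUP_least ennreal_leI)
  fix \<gamma> \<gamma>' assume "\<gamma> \<in> cyl n \<omega>" "\<gamma>' \<in> cyl n \<omega>"
  then have "dst \<gamma> \<gamma>' \<le> (1 / real m) ^ Suc n" by (intro path_dist_le) auto
  also have "\<dots> \<le> (1 / real m) ^ n" using card_ge_2 by (intro power_decreasing) auto
  finally show "dst \<gamma> \<gamma>' \<le> (1 / real m) ^ n" .
qed

lemma measure_level_sum:
  assumes "finite_measure \<nu>" and sets: "sets \<nu> = sets B" and I: "I \<subseteq> atoms (F n)"
  shows "measure \<nu> {\<gamma>\<in>T. \<gamma> n \<in> I} = (\<Sum>\<omega>\<in>I. measure \<nu> (cyl n \<omega>))"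
proof -
  interpret finite_measure \<nu> by (rule assms(1))
  have "{\<gamma>\<in>T. \<gamma> n \<in> I} = (\<Union>\<omega>\<in>I. cyl n \<omega>)" by auto
  moreover have "measure \<nu> (\<Union>\<omega>\<in>I. cyl n \<omega>) = (\<Sum>\<omega>\<in>I. measure \<nu> (cyl n \<omega>))"
  proof (rule finite_measure_finite_Union)
    show "finite I" using I by (rule finite_subset) simp
    show "cyl n ` I \<subseteq> sets \<nu>" by (auto simp: sets)
    show "disjoint_family_on (cyl n) I" unfolding disjoint_family_on_def cylinder_def by blast
  qed
  ultimately show ?thesis by simp
qed

text \<open>In the opposite direction, at most \<open>\<nu>(T) m\<^sup>n\<^sup>t\<close> cylinders of level \<open>n\<close> can have mass
  \<open>m\<^sup>-\<^sup>n\<^sup>t\<close> or more, and covering by these makes the \<open>t'\<close>-dimensional sums tend to zero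
  when \<open>t' > t\<close>.\<close>

lemma hausdorff_dim_heavy:
  assumes "finite_measure \<nu>" and sets: "sets \<nu> = sets B"
    and t: "0 < t" "t < t'"
    and heavy: "\<And>\<gamma> n. \<gamma> \<in> E \<Longrightarrow> n \<ge> N \<Longrightarrow> ((1 / real m) ^ n) powr t \<le> measure \<nu> (cyl n (\<gamma> n))"
    and E: "E \<subseteq> T"
  shows "hausdorff_dim T dst E \<le> ereal t'"
proof -
  interpret finite_measure \<nu> by (rule assms(1))
  let ?r = "1 / real m"
  define K where "K = measure \<nu> T"
  have r: "0 < ?r" "?r < 1" using card_ge_2 by auto
  define q where "q = ?r powr (t' - t)"
  have q: "0 < q" "q < 1" using r t powr_less_mono2[of "t' - t" ?r 1] by (simp_all add: q_def)
  have cover: "(INF U\<in>{U :: nat \<Rightarrow> _. (\<forall>i. U i \<subseteq> T \<and> ediam dst (U i) \<le> ennreal \<delta>) \<and> E \<subseteq> (\<Union>i. U i)}.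
        (\<Sum>i. diam_pow dst t' (U i))) \<le> ennreal (K * q ^ n)" (is "Inf (?f ` ?C) \<le> _")
    if n: "n \<ge> N" "?r ^ n < \<delta>" for n \<delta>
  proof -
    define I where "I = {\<omega>\<in>atoms (F n). (?r ^ n) powr t \<le> measure \<nu> (cyl n \<omega>)}"
    have finI: "finite I" by (simp add: I_def)
    have card: "real (card I) * (?r ^ n) powr t \<le> K"
    proof -
      have "real (card I) * (?r ^ n) powr t = (\<Sum>\<omega>\<in>I. (?r ^ n) powr t)" by simp
      also have "\<dots> \<le> (\<Sum>\<omega>\<in>I. measure \<nu> (cyl n \<omega>))" by (intro sum_mono) (auto simp: I_def)
      also have "\<dots> = measure \<nu> {\<gamma>\<in>T. \<gamma> n \<in> I}"
        by (intro measure_level_sum[symmetric] assms) (auto simp: I_def)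
      also have "\<dots> \<le> K"
        unfolding K_def by (intro finite_measure_mono) (auto simp: sets space_B[symmetric] simp del: space_B)
      finally show ?thesis .
    qed
    obtain e where e: "bij_betw e {..<card I} I" using ex_bij_betw_nat_finite[OF finI] by (auto simp: atLeast0LessThan)
    define U where "U i = (if i < card I then cyl n (e i) else {})" for i
    have dU: "ediam dst (U i) \<le> ennreal (?r ^ n)" for i
      using ediam_cyl[of n "e i"] by (auto simp: U_def ediam_def[of _ "{}"] bot_ennreal)
    have "U \<in> ?C"
    proof (intro CollectI conjI allI)
      show "U i \<subseteq> T" for i by (auto simp: U_def)
      show "ediam dst (U i) \<le> ennreal \<delta>" for i
        using dU by (rule order_trans) (use n in \<open>auto intro!: ennreal_leI\<close>)
      show "E \<subseteq> (\<Union>i. U i)"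
      proof
        fix \<gamma> assume g: "\<gamma> \<in> E"
        then have gT: "\<gamma> \<in> T" using E by auto
        have "\<gamma> n \<in> I" using heavy[OF g n(1)] path_atom[OF gT] by (simp add: I_def)
        then obtain i where "i < card I" "e i = \<gamma> n" using e unfolding bij_betw_def by (metis imageE lessThan_iff)
        then show "\<gamma> \<in> (\<Union>i. U i)" using gT by (auto simp: U_def intro!: exI[of _ i])
      qed
    qed
    then have "Inf (?f ` ?C) \<le> ?f U" by (rule INF_lower)
    also have "\<dots> = (\<Sum>i<card I. diam_pow dst t' (U i))"
      by (intro suminf_finite) (auto simp: U_def diam_pow_def)
    also have "\<dots> \<le> (\<Sum>i<card I. ennreal ((?r ^ n) powr t'))"
    proof (intro sum_mono)
      fix i
      have "enn2real (ediam dst (U i)) \<le> ?r ^ n"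
        using enn2real_mono[OF dU[of i]] by simp
      then have "enn2real (ediam dst (U i)) powr t' \<le> (?r ^ n) powr t'"
        using t by (intro powr_mono2) auto
      then show "diam_pow dst t' (U i) \<le> ennreal ((?r ^ n) powr t')"
        using t by (auto simp: diam_pow_def intro!: ennreal_leI)
    qed
    also have "\<dots> = ennreal (real (card I) * (?r ^ n) powr t')"
      by (simp add: ennreal_mult ennreal_of_nat_eq_real_of_nat)
    also have "\<dots> \<le> ennreal (K * q ^ n)"
    proof (rule ennreal_leI)
      have "(?r ^ n) powr t' = (?r ^ n) powr t * (?r ^ n) powr (t' - t)"
        by (simp add: powr_add[symmetric])
      also have "(?r ^ n) powr (t' - t) = q ^ n"
        unfolding q_def using r by (simp add: powr_powr powr_realpow[symmetric] mult.commute del: power_divide powr_realpow)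
      finally show "real (card I) * (?r ^ n) powr t' \<le> K * q ^ n"
        using mult_right_mono[OF card, of "q ^ n"] q by (simp add: mult.assoc)
    qed
    finally show ?thesis .
  qed
  have "hausdorff_measure T dst t' E \<le> 0"
    unfolding hausdorff_measure_def
  proof (rule SUP_least)
    fix \<delta> :: real assume "\<delta> \<in> {0<..}"
    then have d: "\<delta> > 0" by simp
    obtain n0 where n0: "n0 \<ge> N" "?r ^ n0 < \<delta>" using powers_small[OF d] .
    have ev: "n \<ge> N \<and> ?r ^ n < \<delta>" if "n \<ge> n0" for n
      by (rule conjI, use n0 that in simp, rule le_less_trans[OF power_decreasing[OF that] n0(2)], use r in auto)
    have "(\<lambda>n. ennreal (K * q ^ n)) \<longlonglongrightarrow> ennreal (K * 0)"
      using q by (intro tendsto_ennrealI tendsto_intros LIMSEQ_realpow_zero) auto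
    then show "(INF U\<in>{U :: nat \<Rightarrow> _. (\<forall>i. U i \<subseteq> T \<and> ediam dst (U i) \<le> ennreal \<delta>) \<and> E \<subseteq> (\<Union>i. U i)}.
        (\<Sum>i. diam_pow dst t' (U i))) \<le> 0"
      using cover ev by (intro tendsto_lowerbound[where F = sequentially])
         (auto simp: eventually_sequentially intro!: exI[of _ n0])
  qed
  then have "hausdorff_measure T dst t' E = 0" by simp
  then show ?thesis unfolding hausdorff_dim_def using t by (intro Inf_lower) auto
qed

text \<open>The sum of \<open>\<nu>\<^sup>p\<close> over the level-\<open>n\<close> cylinders with good ancestry decays like \<open>r\<^sup>n\<close>, so by Markov's
  inequality those with \<open>\<nu>\<^sup>p\<^sup>-\<^sup>1 > c\<^sup>n\<close> carry mass at most a multiple of \<open>(r / c)\<^sup>n\<close>, and the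
  Borel--Cantelli lemma applies. Exponents \<open>p > 1\<close> detect heavy cylinders and \<open>p < 1\<close> light ones.\<close>

lemma moment_decay:
  assumes "finite_measure \<nu>" and sets: "sets \<nu> = sets B"
    and r: "0 \<le> r" "r < c"
    and step: "\<And>n \<omega>. n \<ge> N \<Longrightarrow> \<omega> \<in> atoms (F n) \<Longrightarrow> good n \<omega> \<Longrightarrow>
       (\<Sum>j\<in>UNIV. measure \<nu> (cyl (Suc n) (J \<omega> j)) powr p) \<le> r * measure \<nu> (cyl n \<omega>) powr p"
  shows "AE \<gamma> in \<nu>. (\<forall>n\<ge>N. good n (\<gamma> n)) \<longrightarrow>
     (\<forall>\<^sub>F n in sequentially. measure \<nu> (cyl n (\<gamma> n)) powr (p - 1) \<le> c ^ n)"
proof -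
  interpret finite_measure \<nu> by (rule assms(1))
  let ?\<nu> = "\<lambda>n \<omega>. measure \<nu> (cyl n \<omega>)"
  \<comment> \<open>the good atoms all of whose ancestors from level \<open>N\<close> on are good; their moments form a sequence
    that contracts by \<open>r\<close>\<close>
  define A where "A n = {\<omega>\<in>atoms (F n). \<exists>\<gamma>\<in>T. \<gamma> n = \<omega> \<and> (\<forall>k\<in>{N..n}. good k (\<gamma> k))}" for n
  define S where "S n = (\<Sum>\<omega>\<in>A n. ?\<nu> n \<omega> powr p)" for n
  have finA: "finite (A n)" for n by (simp add: A_def)
  have c: "c > 0" using r by simp
  have S_Suc: "S (Suc n) \<le> r * S n" if n: "n \<ge> N" for n
  proof -
    have sub: "A (Suc n) \<subseteq> (\<lambda>(\<omega>, j). J \<omega> j) ` (A n \<times> UNIV)"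
    proof
      fix \<alpha> assume "\<alpha> \<in> A (Suc n)"
      then obtain \<gamma> where g: "\<gamma> \<in> T" "\<gamma> (Suc n) = \<alpha>" "\<forall>k\<in>{N..Suc n}. good k (\<gamma> k)" by (auto simp: A_def)
      obtain j where "\<gamma> (Suc n) = J (\<gamma> n) j" using path_child[OF g(1)] .
      moreover have "\<gamma> n \<in> A n" using g path_atom by (auto simp: A_def)
      ultimately show "\<alpha> \<in> (\<lambda>(\<omega>, j). J \<omega> j) ` (A n \<times> UNIV)" using g(2) by (intro image_eqI[of _ _ "(\<gamma> n, j)"]) auto
    qed
    have "S (Suc n) \<le> (\<Sum>\<alpha>\<in>(\<lambda>(\<omega>, j). J \<omega> j) ` (A n \<times> UNIV). ?\<nu> (Suc n) \<alpha> powr p)"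
      unfolding S_def using sub finA by (intro sum_mono2) auto
    also have "\<dots> \<le> (\<Sum>x\<in>A n \<times> UNIV. ?\<nu> (Suc n) (case x of (\<omega>, j) \<Rightarrow> J \<omega> j) powr p)"
      using finA by (intro sum_image_le[where g = "\<lambda>\<alpha>. ?\<nu> (Suc n) \<alpha> powr p", unfolded o_def]) auto
    also have "\<dots> = (\<Sum>\<omega>\<in>A n. \<Sum>j\<in>UNIV. ?\<nu> (Suc n) (J \<omega> j) powr p)"
      by (simp add: sum.cartesian_product case_prod_unfold)
    also have "\<dots> \<le> (\<Sum>\<omega>\<in>A n. r * ?\<nu> n \<omega> powr p)"
    proof (rule sum_mono)
      fix \<omega> assume "\<omega> \<in> A n"
      then have "\<omega> \<in> atoms (F n)" "good n \<omega>" using n by (auto simp: A_def)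
      then show "(\<Sum>j\<in>UNIV. ?\<nu> (Suc n) (J \<omega> j) powr p) \<le> r * ?\<nu> n \<omega> powr p" by (rule step[OF n])
    qed
    finally show ?thesis by (simp add: S_def sum_distrib_left)
  qed
  have S_bound: "S (N + k) \<le> r ^ k * S N" for k
  proof (induction k)
    case (Suc k)
    have "S (N + Suc k) \<le> r * S (N + k)" using S_Suc[of "N + k"] by simp
    also have "\<dots> \<le> r * (r ^ k * S N)" using Suc r by (intro mult_left_mono)
    finally show ?case by simp
  qed simp
  define X where "X k = {\<gamma>\<in>T. \<gamma> (N + k) \<in> {\<omega>\<in>A (N + k). c ^ (N + k) < ?\<nu> (N + k) \<omega> powr (p - 1)}}" for k
  have X: "X k \<in> sets \<nu>" for k unfolding X_def sets by (rule sets_level)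
  have mX: "measure \<nu> (X k) \<le> S N / c ^ N * (r / c) ^ k" for k
  proof -
    let ?n = "N + k"
    have "measure \<nu> (X k) = (\<Sum>\<omega> | \<omega> \<in> A ?n \<and> c ^ ?n < ?\<nu> ?n \<omega> powr (p - 1). ?\<nu> ?n \<omega>)"
      unfolding X_def by (subst measure_level_sum[OF assms(1) sets]) (auto simp: A_def)
    also have "\<dots> \<le> (\<Sum>\<omega> | \<omega> \<in> A ?n \<and> c ^ ?n < ?\<nu> ?n \<omega> powr (p - 1). ?\<nu> ?n \<omega> powr p / c ^ ?n)"
    proof (rule sum_mono, clarify)
      fix \<omega> assume w: "c ^ ?n < ?\<nu> ?n \<omega> powr (p - 1)"
      show "?\<nu> ?n \<omega> \<le> ?\<nu> ?n \<omega> powr p / c ^ ?n"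
      proof (cases "?\<nu> ?n \<omega> = 0")
        case False
        then have pos: "?\<nu> ?n \<omega> > 0" using measure_nonneg[of \<nu> "cyl ?n \<omega>"] by linarith
        have "?\<nu> ?n \<omega> * c ^ ?n \<le> ?\<nu> ?n \<omega> * ?\<nu> ?n \<omega> powr (p - 1)"
          using w pos by (intro mult_left_mono) auto
        also have "\<dots> = ?\<nu> ?n \<omega> powr p" using pos by (simp add: powr_mult_base)
        finally show ?thesis using c by (simp add: field_simps)
      qed (use c in simp)
    qed
    also have "\<dots> \<le> (\<Sum>\<omega>\<in>A ?n. ?\<nu> ?n \<omega> powr p / c ^ ?n)"
      using finA c by (intro sum_mono2) auto
    also have "\<dots> = S ?n / c ^ ?n" by (simp add: S_def sum_divide_distrib)
    also have "\<dots> \<le> (r ^ k * S N) / c ^ ?n" using S_bound[of k] c by (intro divide_right_mono) auto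
    also have "\<dots> = S N / c ^ N * (r / c) ^ k" by (simp add: power_add power_divide)
    finally show ?thesis .
  qed
  have "AE \<gamma> in \<nu>. \<forall>\<^sub>F k in sequentially. \<gamma> \<in> space \<nu> - X k"
  proof (rule borel_cantelli_AE1[OF X])
    have "summable (\<lambda>k. S N / c ^ N * (r / c) ^ k)"
      using r c by (intro summable_mult summable_geometric) auto
    then show "summable (\<lambda>k. measure \<nu> (X k))"
      by (rule summable_comparison_test'[where N = 0]) (use mX in auto)
  qed (simp add: emeasure_eq_measure)
  then show ?thesis
  proof eventually_elim
    case (elim \<gamma>)
    show ?case
    proof
      assume good: "\<forall>n\<ge>N. good n (\<gamma> n)"
      have "\<forall>\<^sub>F k in sequentially. ?\<nu> (k + N) (\<gamma> (k + N)) powr (p - 1) \<le> c ^ (k + N)"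
        using elim
      proof eventually_elim
        case (elim k)
        then have gT: "\<gamma> \<in> T" by (auto simp: sets_eq_imp_space_eq[OF sets])
        then have "\<gamma> (N + k) \<in> A (N + k)" using good path_atom by (auto simp: A_def)
        then show ?case using elim gT by (auto simp: X_def add.commute)
      qed
      then show "\<forall>\<^sub>F n in sequentially. ?\<nu> n (\<gamma> n) powr (p - 1) \<le> c ^ n"
        by (rule eventually_sequentially_seg[THEN iffD1])
    qed
  qed
qed

end

section \<open>Rank-one directions and the function kappa\<close>

definition admissible :: "((real^'l)^'m::finite) set \<Rightarrow> (real^'m) set" where
  "admissible W = {v \<in> zero_sum. (\<exists>a. a \<noteq> 0 \<and> tensor v a \<in> W) \<and> (\<forall>j. v $ j \<ge> -1)}"

text \<open>The Kullback--Leibler divergence of the probability vector \<open>(1 + v) / m\<close> from the uniform one.\<close>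

definition divergence :: "real^'m::finite \<Rightarrow> real" where
  "divergence v = (1 / real CARD('m)) * (\<Sum>j\<in>UNIV. (1 + v $ j) * ln (1 + v $ j))"

lemma zero_sum_sum:
  fixes v :: "real^'m::finite"
  assumes "v \<in> zero_sum"
  shows "(\<Sum>j\<in>UNIV. 1 + v $ j) = real CARD('m)"
  using assms by (simp add: zero_sum_def sum.distrib)

lemma zero_sum_le:
  fixes v :: "real^'m::finite"
  assumes "v \<in> zero_sum" "\<And>j. v $ j \<ge> -1"
  shows "1 + v $ j \<le> real CARD('m)"
proof -
  have "0 \<le> 1 + v $ i" for i using assms(2)[of i] by simp
  then have "1 + v $ j \<le> (\<Sum>j\<in>UNIV. 1 + v $ j)" by (intro member_le_sum) auto
  then show ?thesis using zero_sum_sum[OF assms(1)] by simp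
qed

lemma closed_zero_sum: "closed (zero_sum :: (real^'m::finite) set)"
  unfolding zero_sum_def by (intro closed_Collect_eq continuous_intros)

lemma compact_probability_directions:
  "compact {v :: real^'m::finite. v \<in> zero_sum \<and> (\<forall>j. v $ j \<ge> -1)}"
proof -
  have "closed {v :: real^'m. v \<in> zero_sum \<and> (\<forall>j. v $ j \<ge> -1)}"
    using closed_zero_sum[where 'm = 'm]
    by (auto intro!: closed_Collect_conj closed_Collect_all closed_Collect_le continuous_intros)
  moreover have "bounded {v :: real^'m. v \<in> zero_sum \<and> (\<forall>j. v $ j \<ge> -1)}"
  proof (rule bounded_subset[OF bounded_cbox])
    show "{v :: real^'m. v \<in> zero_sum \<and> (\<forall>j. v $ j \<ge> -1)} \<subseteq> cbox (- 1) (\<chi> j. real CARD('m))"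
    proof
      fix v :: "real^'m" assume v: "v \<in> {v. v \<in> zero_sum \<and> (\<forall>j. v $ j \<ge> -1)}"
      then have "1 + v $ j \<le> real CARD('m)" for j by (intro zero_sum_le) auto
      then have "v $ j \<le> real CARD('m)" for j by (smt (verit))
      then show "v \<in> cbox (- 1) (\<chi> j. real CARD('m))"
        using v by (auto simp: mem_box_cart)
    qed
  qed
  ultimately show ?thesis by (simp add: compact_eq_bounded_closed)
qed

lemma continuous_on_tensor [continuous_intros]:
  assumes "continuous_on S f" "continuous_on S g"
  shows "continuous_on S (\<lambda>x. tensor (f x) (g x))"
  unfolding tensor_def by (intro continuous_intros assms)

lemma tensor_scale: "tensor v (c *\<^sub>R a) = c *\<^sub>R tensor v a"
  by (simp add: tensor_def vec_eq_iff)

text \<open>The vector \<open>a\<close> in \<open>v \<otimes> a \<in> W\<close> may be normalised, so the admissible directions are the projection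
  of a compact set of pairs.\<close>

lemma compact_admissible:
  fixes W :: "((real^'l::finite)^'m::finite) set"
  assumes "subspace W"
  shows "compact (admissible W)"
proof -
  let ?P = "{v :: real^'m. v \<in> zero_sum \<and> (\<forall>j. v $ j \<ge> -1)} \<times> sphere (0 :: real^'l) 1"
  let ?S = "?P \<inter> (\<lambda>(v, u). tensor v u) -` W"
  have "admissible W = fst ` ?S"
  proof (intro set_eqI iffI)
    fix v assume "v \<in> admissible W"
    then obtain a where a: "a \<noteq> 0" "tensor v a \<in> W" "v \<in> zero_sum" "\<forall>j. v $ j \<ge> -1"
      by (auto simp: admissible_def)
    have "tensor v ((1 / norm a) *\<^sub>R a) \<in> W"
      unfolding tensor_scale using a assms by (auto intro: subspace_scale)
    then have "(v, (1 / norm a) *\<^sub>R a) \<in> ?S" using a by auto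
    then show "v \<in> fst ` ?S" by force
  next
    fix v assume "v \<in> fst ` ?S"
    then obtain u where "(v, u) \<in> ?S" by auto
    then show "v \<in> admissible W" by (auto simp: admissible_def intro!: exI[of _ u])
  qed
  moreover have "compact ?S"
  proof (rule closedin_compact)
    show "compact ?P" by (intro compact_Times compact_probability_directions compact_sphere)
    show "closedin (top_of_set ?P) ?S"
      unfolding case_prod_unfold
      by (intro continuous_closedin_preimage continuous_intros closed_subspace assms)
  qed
  ultimately show ?thesis by (auto intro!: compact_continuous_image continuous_intros)
qed

lemma zero_in_admissible:
  fixes W :: "((real^'l::finite)^'m::finite) set"
  assumes "subspace W"
  shows "0 \<in> admissible W"
proof -
  have "tensor (0 :: real^'m) (1 :: real^'l) = 0" by (simp add: tensor_def vec_eq_iff)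
  then show ?thesis using subspace_0[OF assms]
    by (auto simp: admissible_def zero_sum_def intro!: exI[of _ "1 :: real^'l"])
qed

lemma continuous_on_x_ln_x: "continuous_on {0..} (\<lambda>x::real. x * ln x)"
proof -
  have "continuous (at x within {0..}) (\<lambda>x::real. x * ln x)" if "x \<ge> 0" for x
  proof (cases "x = 0")
    case True
    have "((\<lambda>x::real. x * ln x) \<longlongrightarrow> 0) (at_right 0)" by real_asymp
    then have "((\<lambda>x::real. x * ln x) \<longlongrightarrow> 0) (at 0 within {0..})"
      by (simp add: at_within_Ici_at_right)
    then show ?thesis using True by (simp add: continuous_within)
  next
    case False
    then show ?thesis using that by (intro continuous_intros) auto
  qed
  then show ?thesis by (simp add: continuous_on_eq_continuous_within)
qed

lemma divergence_attained:
  fixes W :: "((real^'l::finite)^'m::finite) set"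
  assumes "subspace W"
  obtains v where "v \<in> admissible W" "\<forall>w\<in>admissible W. divergence w \<le> divergence v"
proof -
  have "continuous_on (admissible W) (\<lambda>v. (1 + v $ j) * ln (1 + v $ j))" for j
    by (rule continuous_on_compose2[OF continuous_on_x_ln_x])
       (auto simp: admissible_def intro!: continuous_intros, smt (verit))
  then have "continuous_on (admissible W) divergence"
    unfolding divergence_def by (intro continuous_on_mult_left continuous_on_sum)
  moreover have "admissible W \<noteq> {}" using zero_in_admissible[OF assms] by auto
  ultimately show ?thesis
    using continuous_attains_sup[OF compact_admissible[OF assms]] that by blast
qed

lemma exp_minus_linear_le: "exp t - 1 - t \<le> t\<^sup>2 * max 1 (exp t)" for t :: real
proof -
  have "1 - t \<le> exp (- t)" using exp_ge_add_one_self[of "-t"] by simp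
  then have "(1 - t) * exp t \<le> exp (- t) * exp t" by (intro mult_right_mono) auto
  then have 1: "exp t - 1 \<le> t * exp t" by (simp add: exp_minus algebra_simps)
  then have "exp t - 1 - t \<le> t * (exp t - 1)" by (simp add: algebra_simps)
  also have "\<dots> \<le> t\<^sup>2 * max 1 (exp t)"
  proof (cases "t \<ge> 0")
    case True
    have "t * (exp t - 1) \<le> t * (t * exp t)" using 1 True by (intro mult_left_mono) auto
    also have "\<dots> \<le> t\<^sup>2 * max 1 (exp t)"
      unfolding power2_eq_square mult.assoc[symmetric] by (intro mult_left_mono) auto
    finally show ?thesis .
  next
    case False
    have "t * (exp t - 1) \<le> t * t"
      using False exp_ge_add_one_self[of t] by (intro mult_left_mono_neg) linarith+
    also have "\<dots> \<le> t\<^sup>2 * max 1 (exp t)" unfolding power2_eq_square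
      using mult_left_mono[of 1 "max 1 (exp t)" "t * t"] by simp
    finally show ?thesis .
  qed
  finally show ?thesis .
qed

lemma x_ln_squared_le: "x * (ln x)\<^sup>2 \<le> 4" if "0 < x" "x \<le> 1" for x :: real
proof -
  define y where "y = sqrt x"
  have y: "0 < y" "y \<le> 1" "x = y\<^sup>2" using that by (auto simp: y_def)
  have "ln (1 / y) \<le> 1 / y - 1" using y by (intro ln_le_minus_one) auto
  then have "- ln y \<le> 1 / y - 1" using y by (simp add: ln_div)
  then have "y * (- ln y) \<le> y * (1 / y - 1)" using y by (intro mult_left_mono) auto
  also have "\<dots> \<le> 1" using y by (simp add: algebra_simps)
  finally have "y * (- ln y) \<le> 1" .
  moreover have "0 \<le> y * (- ln y)" using y by (intro mult_nonneg_nonneg) auto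
  ultimately have "(y * (- ln y))\<^sup>2 \<le> 1" by (intro power_le_one) auto
  moreover have "x * (ln x)\<^sup>2 = 4 * (y * (- ln y))\<^sup>2"
    using y by (simp add: ln_realpow power_mult_distrib)
  ultimately show ?thesis by simp
qed

text \<open>Expand \<open>x\<^sup>q = exp (q ln x)\<close> to first order. The remainder is of order \<open>x (q ln x)\<^sup>2\<close>, and the
  factor \<open>x\<close> keeps it bounded near zero, which makes the expansion uniform on \<open>[0, b]\<close>.\<close>

lemma powr_first_order:
  fixes x b q :: real
  assumes x: "0 \<le> x" "x \<le> b" and b: "1 \<le> b" and q: "0 \<le> q" "q \<le> 1"
  shows "x powr (1 + q) \<le> x + q * (x * ln x) + (b ^ 4 + 4) * q\<^sup>2"
proof (cases "x = 0")
  case False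
  then have x0: "x > 0" using x by simp
  let ?t = "q * ln x"
  have "x * (exp ?t - 1 - ?t) \<le> x * (?t\<^sup>2 * max 1 (exp ?t))"
    using x exp_minus_linear_le by (intro mult_left_mono)
  also have "\<dots> \<le> (b ^ 4 + 4) * q\<^sup>2"
  proof (cases "x \<le> 1")
    case True
    then have "?t \<le> 0" using x0 q by (simp add: mult_nonneg_nonpos)
    then have "max 1 (exp ?t) = 1" by (simp add: max_def)
    then have "x * (?t\<^sup>2 * max 1 (exp ?t)) = (x * (ln x)\<^sup>2) * q\<^sup>2"
      by (simp add: power_mult_distrib)
    also have "\<dots> \<le> (b ^ 4 + 4) * q\<^sup>2"
      using x_ln_squared_le[OF x0 True] b by (intro mult_right_mono) (auto intro: add_increasing)
    finally show ?thesis .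
  next
    case False
    have ln: "0 \<le> ln x" "ln x \<le> b"
      using False x ln_le_minus_one[OF x0] by auto
    have "exp ?t \<le> exp (ln x)" using ln q by (simp add: mult_left_le_one_le)
    then have "max 1 (exp ?t) \<le> b" using x x0 b by simp
    moreover have "?t\<^sup>2 \<le> b\<^sup>2 * q\<^sup>2"
      using mult_right_mono[OF power_mono[OF ln(2,1), of 2], of "q\<^sup>2"]
      by (simp add: power_mult_distrib mult.commute)
    ultimately have "x * (?t\<^sup>2 * max 1 (exp ?t)) \<le> b * ((b\<^sup>2 * q\<^sup>2) * b)"
      using x b by (intro mult_mono) auto
    also have "\<dots> = b ^ 4 * q\<^sup>2" by (simp add: power2_eq_square power4_eq_xxxx)
    also have "\<dots> \<le> (b ^ 4 + 4) * q\<^sup>2" by (intro mult_right_mono) auto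
    finally show ?thesis .
  qed
  finally have "x * exp ?t \<le> x + q * (x * ln x) + (b ^ 4 + 4) * q\<^sup>2" by (simp add: algebra_simps)
  moreover have "x powr (1 + q) = x * exp ?t"
    using x0 by (simp add: powr_def distrib_right exp_add)
  ultimately show ?thesis by simp
qed (use b in \<open>auto intro!: mult_nonneg_nonneg\<close>)

abbreviation power_mean :: "real^'m::finite \<Rightarrow> real \<Rightarrow> real" where
  "power_mean v q \<equiv> (1 / real CARD('m)) * (\<Sum>j\<in>UNIV. (1 + v $ j) powr (1 + q))"

lemma power_mean_le:
  fixes v :: "real^'m::finite"
  assumes v: "v \<in> zero_sum" "\<And>j. v $ j \<ge> -1" and q: "0 \<le> q" "q \<le> 1"
  shows "power_mean v q \<le> 1 + q * divergence v + (real CARD('m) ^ 4 + 4) * q\<^sup>2"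
proof -
  let ?m = "real CARD('m)"
  have m: "?m \<ge> 1" by simp
  have x0: "0 \<le> 1 + v $ j" for j using v(2)[of j] by simp
  have "(\<Sum>j\<in>UNIV. (1 + v $ j) powr (1 + q))
    \<le> (\<Sum>j\<in>UNIV. (1 + v $ j) + q * ((1 + v $ j) * ln (1 + v $ j)) + (?m ^ 4 + 4) * q\<^sup>2)"
    using zero_sum_le[OF v] x0 q m by (intro sum_mono powr_first_order) auto
  also have "\<dots> = ?m + q * (\<Sum>j\<in>UNIV. (1 + v $ j) * ln (1 + v $ j)) + ?m * ((?m ^ 4 + 4) * q\<^sup>2)"
    using zero_sum_sum[OF v(1)] by (simp add: sum.distrib sum_distrib_left)
  finally have "(\<Sum>j\<in>UNIV. (1 + v $ j) powr (1 + q)) \<le> \<dots>" .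
  then have "power_mean v q \<le> (1 / ?m) * \<dots>" by (intro mult_left_mono) auto
  also have "\<dots> = 1 + q * divergence v + (?m ^ 4 + 4) * q\<^sup>2"
    unfolding divergence_def by (simp add: field_simps)
  finally show ?thesis .
qed

text \<open>After division by \<open>exp (q H)\<close>, with \<open>H\<close> the divergence, every summand lies above the tangent of
  the exponential at zero, and the tangents average to one because \<open>(1 + v) / m\<close> is a probability
  vector.\<close>

lemma power_mean_ge:
  fixes v :: "real^'m::finite"
  assumes v: "v \<in> zero_sum" "\<And>j. v $ j \<ge> -1"
  shows "exp (q * divergence v) \<le> power_mean v q"
proof -
  let ?m = "real CARD('m)" and ?H = "divergence v"
  have x0: "0 \<le> 1 + v $ j" for j using v(2)[of j] by simp
  have summand: "(1 + v $ j) * (1 - q * ?H) + q * ((1 + v $ j) * ln (1 + v $ j))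
     \<le> (1 + v $ j) powr (1 + q) * exp (- (q * ?H))" for j
  proof (cases "1 + v $ j = 0")
    case False
    let ?x = "1 + v $ j"
    have x: "?x > 0" using x0[of j] False by simp
    have "?x * (1 + (q * ln ?x - q * ?H)) \<le> ?x * exp (q * ln ?x - q * ?H)"
      using x by (intro mult_left_mono exp_ge_add_one_self) auto
    also have "\<dots> = ?x powr (1 + q) * exp (- (q * ?H))"
      using x by (simp add: powr_def distrib_right exp_add exp_diff exp_minus divide_inverse)
    finally show ?thesis by (simp add: algebra_simps)
  qed simp
  have "?m = (\<Sum>j\<in>UNIV. (1 + v $ j) * (1 - q * ?H) + q * ((1 + v $ j) * ln (1 + v $ j)))"
  proof -
    have "(\<Sum>j\<in>UNIV. (1 + v $ j) * (1 - q * ?H) + q * ((1 + v $ j) * ln (1 + v $ j)))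
       = (\<Sum>j\<in>UNIV. 1 + v $ j) * (1 - q * ?H) + q * (\<Sum>j\<in>UNIV. (1 + v $ j) * ln (1 + v $ j))"
      by (subst sum.distrib) (simp only: sum_distrib_left sum_distrib_right)
    also have "\<dots> = ?m * (1 - q * ?H) + q * (?m * ?H)"
      unfolding zero_sum_sum[OF v(1)] by (simp add: divergence_def)
    finally show ?thesis by (simp add: algebra_simps)
  qed
  also have "\<dots> \<le> (\<Sum>j\<in>UNIV. (1 + v $ j) powr (1 + q) * exp (- (q * ?H)))" by (intro sum_mono summand)
  also have "\<dots> = ?m * power_mean v q * exp (- (q * ?H))" by (simp add: sum_distrib_right)
  finally have "1 \<le> power_mean v q * exp (- (q * ?H))" by simp
  then have "1 * exp (q * ?H) \<le> power_mean v q * exp (- (q * ?H)) * exp (q * ?H)"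
    by (intro mult_right_mono) auto
  then show ?thesis by (simp add: mult.assoc exp_add[symmetric])
qed

lemma kappa_eq: "kappa W \<theta> = (SUP v\<in>admissible W. kappa_vec v \<theta>)"
proof -
  have "{kappa_vec v \<theta> |v. v \<in> zero_sum \<and> (\<exists>a. a \<noteq> 0 \<and> tensor v a \<in> W) \<and> (\<forall>j. v $ j \<ge> -1)}
     = (\<lambda>v. kappa_vec v \<theta>) ` admissible W" by (auto simp: admissible_def)
  then show ?thesis by (simp add: kappa_def)
qed

lemma kappa_vec_eq:
  fixes v :: "real^'m::finite"
  assumes "\<And>j. v $ j \<ge> -1" "\<theta> > 0"
  shows "kappa_vec v \<theta> = \<theta> * ln (power_mean v (1 / \<theta> - 1))"
proof -
  have "\<bar>1 + v $ j\<bar> = 1 + v $ j" for j using assms(1)[of j] by simp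
  then show ?thesis using assms(2) by (simp add: kappa_vec_def)
qed

text \<open>The bounds \<open>power_mean_le\<close> and \<open>power_mean_ge\<close> pinch \<open>kappa\<close> between
  \<open>(1 - \<theta>) h\<close> and \<open>(1 - \<theta>) h + O((1 - \<theta>)\<^sup>2)\<close>, where \<open>h\<close> is the largest divergence.\<close>

lemma kappa_has_left_derivative:
  fixes W :: "((real^'l::finite)^'m::finite) set"
  assumes W: "subspace W" and v: "v \<in> admissible W"
    and max: "\<And>w. w \<in> admissible W \<Longrightarrow> divergence w \<le> divergence v"
  shows "(kappa W has_real_derivative - divergence v) (at_left 1)"
proof -
  let ?m = "real CARD('m)"
  define C where "C = ?m ^ 4 + 4"
  define h where "h = divergence v"
  have adm: "w \<in> zero_sum" "w $ j \<ge> -1" if "w \<in> admissible W" for w j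
    using that by (auto simp: admissible_def)
  have upper: "kappa_vec w \<theta> \<le> (1 - \<theta>) * h + 2 * C * (1 - \<theta>)\<^sup>2"
    and lower: "(1 - \<theta>) * divergence w \<le> kappa_vec w \<theta>"
    if w: "w \<in> admissible W" and t: "1/2 < \<theta>" "\<theta> < 1" for w \<theta>
  proof -
    define q where "q = 1 / \<theta> - 1"
    have q: "0 \<le> q" "q \<le> 1" "\<theta> * q = 1 - \<theta>" using t by (auto simp: q_def field_simps)
    have C: "C \<ge> 0" by (simp add: C_def)
    have ge: "exp (q * divergence w) \<le> power_mean w q" using power_mean_ge[of w q] adm[OF w] by auto
    then have pos: "0 < power_mean w q" using exp_gt_zero less_le_trans by blast
    have k: "kappa_vec w \<theta> = \<theta> * ln (power_mean w q)"
      using kappa_vec_eq[of w \<theta>] adm[OF w] t by (simp add: q_def)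
    have "q * divergence w \<le> ln (power_mean w q)" using ge pos by (simp add: ln_ge_iff)
    then have "\<theta> * (q * divergence w) \<le> kappa_vec w \<theta>"
      unfolding k using t by (intro mult_left_mono) auto
    then show "(1 - \<theta>) * divergence w \<le> kappa_vec w \<theta>" using q by (simp add: mult.assoc[symmetric])
    have "ln (power_mean w q) \<le> power_mean w q - 1" using pos by (rule ln_le_minus_one)
    also have "\<dots> \<le> q * divergence w + C * q\<^sup>2"
      using power_mean_le[of w q] adm[OF w] q by (auto simp: C_def)
    also have "\<dots> \<le> q * h + C * q\<^sup>2"
      using max[OF w] q by (auto simp: h_def intro!: mult_left_mono)
    finally have "kappa_vec w \<theta> \<le> \<theta> * (q * h + C * q\<^sup>2)"
      unfolding k using t by (intro mult_left_mono) auto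
    also have "\<dots> = (1 - \<theta>) * h + C * ((1 - \<theta>) * q)"
      unfolding q(3)[symmetric] by (simp add: algebra_simps power2_eq_square)
    also have "\<dots> \<le> (1 - \<theta>) * h + C * ((1 - \<theta>) * (2 * (1 - \<theta>)))"
    proof -
      have "1 * q \<le> (2 * \<theta>) * q" using t q by (intro mult_right_mono) auto
      then have "q \<le> 2 * (\<theta> * q)" by (simp only: mult.assoc mult_1)
      then have "q \<le> 2 * (1 - \<theta>)" using q by simp
      then show ?thesis using C t by (intro add_left_mono mult_left_mono) auto
    qed
    also have "\<dots> = (1 - \<theta>) * h + 2 * C * (1 - \<theta>)\<^sup>2" by (simp add: power2_eq_square mult_ac)
    finally show "kappa_vec w \<theta> \<le> (1 - \<theta>) * h + 2 * C * (1 - \<theta>)\<^sup>2" .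
  qed
  have ne: "admissible W \<noteq> {}" using v by auto
  have kb: "(1 - \<theta>) * h \<le> kappa W \<theta>" "kappa W \<theta> \<le> (1 - \<theta>) * h + 2 * C * (1 - \<theta>)\<^sup>2"
    if t: "1/2 < \<theta>" "\<theta> < 1" for \<theta>
  proof -
    show "kappa W \<theta> \<le> (1 - \<theta>) * h + 2 * C * (1 - \<theta>)\<^sup>2"
      unfolding kappa_eq using upper[OF _ t] ne by (intro cSUP_least) auto
    have "(1 - \<theta>) * h \<le> kappa_vec v \<theta>" unfolding h_def by (rule lower[OF v t])
    also have "\<dots> \<le> kappa W \<theta>"
      unfolding kappa_eq using upper[OF _ t] v by (intro cSUP_upper) (auto intro!: bdd_aboveI2)
    finally show "(1 - \<theta>) * h \<le> kappa W \<theta>" .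
  qed
  have "kappa_vec w 1 = 0" if "w \<in> admissible W" for w
  proof -
    have "\<bar>1 + w $ j\<bar> powr 1 = 1 + w $ j" for j using adm(2)[OF that, of j] by simp
    then show ?thesis using zero_sum_sum[OF adm(1)[OF that]] by (simp add: kappa_vec_def)
  qed
  then have k1: "kappa W 1 = 0" unfolding kappa_eq using ne by simp
  have ev: "eventually (\<lambda>\<theta>. 1/2 < \<theta> \<and> \<theta> < 1) (at_left (1::real))"
    unfolding eventually_at_left[OF zero_less_one] by (intro exI[of _ "1/2"]) auto
  have "((\<lambda>\<theta>. (kappa W \<theta> - kappa W 1) / (\<theta> - 1)) \<longlongrightarrow> - h) (at_left 1)"
  proof (rule tendsto_sandwich)
    have "((\<lambda>\<theta>. - h - 2 * C * (1 - \<theta>)) \<longlongrightarrow> - h - 2 * C * (1 - 1)) (at_left 1)"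
      by (intro tendsto_intros)
    then show "((\<lambda>\<theta>. - h - 2 * C * (1 - \<theta>)) \<longlongrightarrow> - h) (at_left 1)" by simp
    show "\<forall>\<^sub>F \<theta> in at_left 1. - h - 2 * C * (1 - \<theta>) \<le> (kappa W \<theta> - kappa W 1) / (\<theta> - 1)"
      using ev
    proof eventually_elim
      case (elim \<theta>)
      have "(- h - 2 * C * (1 - \<theta>)) * (\<theta> - 1) = (1 - \<theta>) * h + 2 * C * (1 - \<theta>)\<^sup>2"
        by (simp add: algebra_simps power2_eq_square)
      then show ?case using kb(2)[of \<theta>] elim by (simp add: neg_le_divide_eq k1)
    qed
    show "\<forall>\<^sub>F \<theta> in at_left 1. (kappa W \<theta> - kappa W 1) / (\<theta> - 1) \<le> - h"
      using ev
    proof eventually_elim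
      case (elim \<theta>)
      then show ?case using kb(1)[of \<theta>] by (simp add: neg_divide_le_eq k1 algebra_simps)
    qed
  qed simp
  then show ?thesis by (simp add: has_field_derivative_iff h_def)
qed

subsection \<open>Contraction of moments\<close>

lemma power_mean_probability:
  fixes v :: "real^'m::finite"
  assumes "\<And>j. v $ j \<ge> -1"
  shows "(\<Sum>j\<in>UNIV. ((1 + v $ j) / real CARD('m)) powr (1 + q)) = real CARD('m) powr (- q) * power_mean v q"
proof -
  have "((1 + v $ j) / real CARD('m)) powr (1 + q)
     = real CARD('m) powr (- q) * (1 / real CARD('m)) * (1 + v $ j) powr (1 + q)" for j
    using assms[of j] by (subst powr_divide) (auto simp: powr_add powr_minus field_simps)
  then show ?thesis by (simp add: sum_distrib_left mult.assoc)
qed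

text \<open>The sum of the \<open>p\<close>-th powers of the weights \<open>(1 + v) / m\<close> is \<open>exp (q (h - ln m) + O(q\<^sup>2))\<close> at
  worst, where \<open>q = p - 1\<close>. The hypothesis on \<open>s\<close> says \<open>h - ln m < - s ln m\<close>, so a small \<open>q\<close>
  leaves room for the quadratic term.\<close>

lemma moment_contraction:
  fixes W :: "((real^'l::finite)^'m::finite) set"
  assumes max: "\<And>w. w \<in> admissible W \<Longrightarrow> divergence w \<le> h"
    and m: "CARD('m) \<ge> 2" and s: "s < 1 - h / ln (real CARD('m))"
  obtains p r where "p > 1" "r \<ge> 0" "r < real CARD('m) powr (- s * (p - 1))"
    "\<And>v. v \<in> admissible W \<Longrightarrow> (\<Sum>j\<in>UNIV. ((1 + v $ j) / real CARD('m)) powr p) < r"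
proof -
  let ?m = "real CARD('m)"
  define C where "C = ?m ^ 4 + 4"
  define g where "g = ln ?m - h - s * ln ?m"
  have L: "ln ?m > 0" using m by simp
  have C: "C > 0" by (simp add: C_def add_nonneg_pos)
  have "s * ln ?m < (1 - h / ln ?m) * ln ?m" using s L by (rule mult_strict_right_mono)
  also have "\<dots> = ln ?m - h" using L by (simp add: algebra_simps)
  finally have g: "g > 0" by (simp add: g_def)
  define q where "q = min 1 (g / (4 * C))"
  have q: "0 < q" "q \<le> 1" "C * q < g / 2"
  proof -
    show "0 < q" "q \<le> 1" using g C by (auto simp: q_def)
    have "C * q \<le> C * (g / (4 * C))" using C by (intro mult_left_mono) (auto simp: q_def)
    also have "\<dots> < g / 2" using C g by simp
    finally show "C * q < g / 2" .
  qed
  define r where "r = exp (q * (- ln ?m + h + g / 2))"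
  have "r < exp (q * (- (s * ln ?m)))"
  proof -
    have "- ln ?m + h + g / 2 = - (s * ln ?m) - g / 2" by (simp add: g_def field_simps)
    then have "- ln ?m + h + g / 2 < - (s * ln ?m)" using g by linarith
    then show ?thesis unfolding r_def exp_less_cancel_iff using q(1) by (rule mult_strict_left_mono)
  qed
  also have "\<dots> = ?m powr (- s * (1 + q - 1))" by (simp add: powr_def mult_ac)
  finally have r: "r < ?m powr (- s * (1 + q - 1))" .
  show ?thesis
  proof (rule that[OF _ _ r])
    fix v assume v: "v \<in> admissible W"
    then have v': "v \<in> zero_sum" "\<And>j. v $ j \<ge> -1" by (auto simp: admissible_def)
    have "power_mean v q \<le> 1 + q * divergence v + C * q\<^sup>2"
      using power_mean_le[OF v'] q by (simp add: C_def)
    also have "\<dots> \<le> 1 + (q * h + C * q\<^sup>2)" using max[OF v] q by simp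
    also have "\<dots> \<le> exp (q * h + C * q\<^sup>2)" by (rule exp_ge_add_one_self)
    finally have "?m powr (- q) * power_mean v q \<le> ?m powr (- q) * exp (q * h + C * q\<^sup>2)"
      by (intro mult_left_mono) auto
    also have "\<dots> = exp (q * (- ln ?m + h + C * q))"
      by (simp add: powr_def exp_add[symmetric] algebra_simps power2_eq_square)
    also have "\<dots> < r" unfolding r_def using q by simp
    finally show "(\<Sum>j\<in>UNIV. ((1 + v $ j) / ?m) powr (1 + q)) < r"
      using power_mean_probability[of v q] v'(2) by simp
  qed (use q in \<open>auto simp: r_def\<close>)
qed

text \<open>A strict moment bound on the admissible directions persists for vectors \<open>v\<close> such that
  \<open>v \<otimes> u\<close> is merely close to \<open>W\<close> for a unit vector \<open>u\<close>: otherwise compactness would produce an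
  admissible direction violating the bound.\<close>

lemma moment_bound_near_rank_one:
  fixes W :: "((real^'l::finite)^'m::finite) set"
  assumes W: "subspace W" and p: "p > 0"
    and bound: "\<And>v. v \<in> admissible W \<Longrightarrow> (\<Sum>j\<in>UNIV. ((1 + v $ j) / real CARD('m)) powr p) < r"
  obtains \<eta> where "\<eta> > 0" "\<And>v u w. \<lbrakk>v \<in> zero_sum; \<And>j. v $ j \<ge> -1; norm u = 1; w \<in> W;
     norm (tensor v u - w) < \<eta>\<rbrakk> \<Longrightarrow> (\<Sum>j\<in>UNIV. ((1 + v $ j) / real CARD('m)) powr p) < r"
proof -
  let ?g = "\<lambda>v :: real^'m. \<Sum>j\<in>UNIV. ((1 + v $ j) / real CARD('m)) powr p"
  let ?P = "{v :: real^'m. v \<in> zero_sum \<and> (\<forall>j. v $ j \<ge> -1)}"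
  let ?X = "(?P \<inter> ?g -` {r..}) \<times> sphere (0 :: real^'l) 1"
  have "continuous_on ?P ?g"
  proof (intro continuous_on_sum continuous_on_powr')
    show "\<forall>v\<in>?P. 0 \<le> (1 + v $ j) / real CARD('m) \<and> ((1 + v $ j) / real CARD('m) = 0 \<longrightarrow> 0 < p)" for j
    proof
      fix v assume "v \<in> ?P"
      then have "- 1 \<le> v $ j" by blast
      then have "0 \<le> 1 + v $ j" by simp
      then show "0 \<le> (1 + v $ j) / real CARD('m) \<and> ((1 + v $ j) / real CARD('m) = 0 \<longrightarrow> 0 < p)"
        using p by simp
    qed
  qed (auto intro!: continuous_intros)
  then have "closedin (top_of_set ?P) (?P \<inter> ?g -` {r..})"
    by (intro continuous_closedin_preimage) auto
  then have "compact (?P \<inter> ?g -` {r..})"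
    using compact_probability_directions by (rule closedin_compact[rotated])
  then have X: "compact ?X" by (intro compact_Times compact_sphere)
  show ?thesis
  proof (cases "?X = {}")
    case True
    then have "?P \<inter> ?g -` {r..} = {}" by (simp only: Times_empty sphere_eq_empty) simp
    then have "?g v < r" if "v \<in> ?P" for v using that by fastforce
    then show ?thesis using that[of 1] by auto
  next
    case False
    have "continuous_on ?X (\<lambda>x. infdist (tensor (fst x) (snd x)) W)" by (intro continuous_intros)
    from continuous_attains_inf[OF X False this]
    obtain x where x: "x \<in> ?X" and
      min: "\<And>y. y \<in> ?X \<Longrightarrow> infdist (tensor (fst x) (snd x)) W \<le> infdist (tensor (fst y) (snd y)) W"
      by blast
    let ?\<eta> = "infdist (tensor (fst x) (snd x)) W"
    have Wne: "W \<noteq> {}" using subspace_0[OF W] by auto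
    have "tensor (fst x) (snd x) \<notin> W"
    proof
      assume "tensor (fst x) (snd x) \<in> W"
      then have "fst x \<in> admissible W" using x by (auto simp: admissible_def intro!: exI[of _ "snd x"])
      then show False using bound[of "fst x"] x by auto
    qed
    then have "?\<eta> > 0"
      using in_closed_iff_infdist_zero[OF closed_subspace[OF W] Wne] infdist_nonneg
      by (metis less_eq_real_def)
    moreover have "?g v < r"
      if "v \<in> zero_sum" "\<And>j. v $ j \<ge> -1" "norm u = 1" "w \<in> W" "norm (tensor v u - w) < ?\<eta>" for v u w
    proof (rule ccontr)
      assume "\<not> ?g v < r"
      then have "(v, u) \<in> ?X" using that by auto
      then have "?\<eta> \<le> infdist (tensor v u) W" using min by fastforce
      also have "\<dots> \<le> dist (tensor v u) w" by (rule infdist_le[OF that(4)])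
      finally show False using that(5) by (simp add: dist_norm)
    qed
    ultimately show ?thesis by (rule that)
  qed
qed

section \<open>Approximation of the total variation by levels of the tree\<close>

context labelled_tree
begin

text \<open>Finite unions of level-\<open>n\<close> cylinders, phrased so that the Boolean operations are immediate.\<close>

definition determined :: "nat \<Rightarrow> (nat \<Rightarrow> 'a set) set \<Rightarrow> bool" where
  "determined n X \<longleftrightarrow> X \<subseteq> T \<and> (\<forall>\<gamma>\<in>T. \<forall>\<gamma>'\<in>T. \<gamma> n = \<gamma>' n \<longrightarrow> \<gamma> \<in> X \<longrightarrow> \<gamma>' \<in> X)"

lemma determined_mono: "determined n X \<Longrightarrow> n \<le> k \<Longrightarrow> determined k X"
  unfolding determined_def using path_agree_down by metis

lemma determined_Un: "determined n X \<Longrightarrow> determined n Y \<Longrightarrow> determined n (X \<union> Y)"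
  unfolding determined_def by blast

lemma determined_Diff: "determined n X \<Longrightarrow> determined n Y \<Longrightarrow> determined n (X - Y)"
  unfolding determined_def by (metis Diff_iff subset_iff)

lemma determined_UN: "(\<And>i. i \<in> I \<Longrightarrow> determined n (X i)) \<Longrightarrow> determined n (\<Union>i\<in>I. X i)"
  unfolding determined_def by blast

lemma determined_T: "determined n T"
  by (simp add: determined_def)

lemma determined_cyl: "determined n (cyl n \<omega>)"
  by (simp add: determined_def cylinder_def)

lemma determined_eq:
  assumes "determined n X"
  shows "X = (\<Union>\<omega>\<in>(\<lambda>\<gamma>. \<gamma> n) ` X. cyl n \<omega>)" and "(\<lambda>\<gamma>. \<gamma> n) ` X \<subseteq> atoms (F n)"
proof -
  show "X = (\<Union>\<omega>\<in>(\<lambda>\<gamma>. \<gamma> n) ` X. cyl n \<omega>)"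
  proof (intro set_eqI iffI)
    fix \<gamma> assume "\<gamma> \<in> X"
    then show "\<gamma> \<in> (\<Union>\<omega>\<in>(\<lambda>\<gamma>. \<gamma> n) ` X. cyl n \<omega>)" using assms by (auto simp: determined_def)
  next
    fix \<gamma> assume "\<gamma> \<in> (\<Union>\<omega>\<in>(\<lambda>\<gamma>. \<gamma> n) ` X. cyl n \<omega>)"
    then obtain \<beta> where "\<beta> \<in> X" "\<gamma> \<in> T" "\<gamma> n = \<beta> n" by auto
    then show "\<gamma> \<in> X" using assms unfolding determined_def by (metis subset_iff)
  qed
  show "(\<lambda>\<gamma>. \<gamma> n) ` X \<subseteq> atoms (F n)" using assms path_atom unfolding determined_def by blast
qed

lemma determined_sets: "determined n X \<Longrightarrow> X \<in> sets B"
  by (subst determined_eq(1), assumption, rule sets.finite_UN)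
     (auto intro: finite_subset[OF determined_eq(2)])

lemma determined_vector_measure:
  assumes "vector_measure B \<mu>" "determined n X"
  shows "\<mu> X = (\<Sum>\<omega>\<in>(\<lambda>\<gamma>. \<gamma> n) ` X. \<mu> (cyl n \<omega>))"
proof -
  have "\<mu> (\<Union>\<omega>\<in>(\<lambda>\<gamma>. \<gamma> n) ` X. cyl n \<omega>) = (\<Sum>\<omega>\<in>(\<lambda>\<gamma>. \<gamma> n) ` X. \<mu> (cyl n \<omega>))"
  proof (rule vector_measure_finite_UN[OF assms(1)])
    show "finite ((\<lambda>\<gamma>. \<gamma> n) ` X)" using determined_eq(2)[OF assms(2)] by (rule finite_subset) simp
    show "disjoint_family_on (cyl n) ((\<lambda>\<gamma>. \<gamma> n) ` X)"
      unfolding disjoint_family_on_def cylinder_def by blast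
  qed (rule cyl_sets)
  then show ?thesis using determined_eq(1)[OF assms(2)] by simp
qed

lemma vector_measure_children:
  assumes "vector_measure B \<mu>" "\<omega> \<in> atoms (F n)"
  shows "\<mu> (cyl n \<omega>) = (\<Sum>j\<in>UNIV. \<mu> (cyl (Suc n) (J \<omega> j)))"
proof -
  have "\<mu> (\<Union>j. cyl (Suc n) (J \<omega> j)) = (\<Sum>j\<in>UNIV. \<mu> (cyl (Suc n) (J \<omega> j)))"
  proof (rule vector_measure_finite_UN[OF assms(1)])
    show "disjoint_family (\<lambda>j. cyl (Suc n) (J \<omega> j))"
      using J_inj[OF assms(2)] by (auto simp: disjoint_family_on_def cylinder_def)
  qed auto
  then show ?thesis using cyl_children[OF assms(2)] by simp
qed

lemma vector_measure_of_measure: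
  assumes "finite_measure \<nu>" "sets \<nu> = sets B"
  shows "vector_measure B (measure \<nu>)"
proof -
  interpret finite_measure \<nu> by (rule assms(1))
  show ?thesis using finite_measure_UNION assms(2) by (auto simp: vector_measure_def)
qed

text \<open>The sets that can be approximated in measure by finite unions of cylinders form a
  \<open>\<sigma>\<close>-algebra containing all cylinders.\<close>

lemma approx_by_determined:
  assumes "finite_measure \<nu>" and sets: "sets \<nu> = sets B" and A: "A \<in> sets B"
  shows "\<forall>e>0. \<exists>n X. determined n X \<and> measure \<nu> (sym_diff A X) < e"
proof -
  interpret finite_measure \<nu> by (rule assms(1))
  let ?P = "\<lambda>A. \<forall>e>0. \<exists>n X. determined n X \<and> measure \<nu> (sym_diff A X) < e"
  have triv: "?P X" if "determined n X" for n X
    using that by (intro allI impI exI[of _ n] exI[of _ X]) simp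
  have Un: "?P (A \<union> A')" if "?P A" "?P A'" "A \<in> sets B" "A' \<in> sets B" for A A'
  proof (intro allI impI)
    fix e :: real assume e: "e > 0"
    obtain n X where X: "determined n X" "measure \<nu> (sym_diff A X) < e/2" using \<open>?P A\<close> e half_gt_zero by blast
    obtain n' X' where X': "determined n' X'" "measure \<nu> (sym_diff A' X') < e/2" using \<open>?P A'\<close> e half_gt_zero by blast
    have "measure \<nu> (sym_diff (A \<union> A') (X \<union> X')) \<le> measure \<nu> (sym_diff A X \<union> sym_diff A' X')"
      using that X X' determined_sets sets by (intro finite_measure_mono) auto
    also have "\<dots> \<le> measure \<nu> (sym_diff A X) + measure \<nu> (sym_diff A' X')"
      using that X X' determined_sets sets by (intro measure_Un_le) auto
    finally have "measure \<nu> (sym_diff (A \<union> A') (X \<union> X')) < e" using X X' by linarith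
    moreover have "determined (max n n') (X \<union> X')"
      using X X' by (intro determined_Un) (auto intro: determined_mono)
    ultimately show "\<exists>n X. determined n X \<and> measure \<nu> (sym_diff (A \<union> A') X) < e" by blast
  qed
  have "A \<in> sigma_sets T {cyl n \<omega> |n \<omega>. \<omega> \<in> atoms (F n)}" using A sets_B by simp
  then have "A \<in> sets B \<and> ?P A"
  proof (induction rule: sigma_sets.induct)
    case (Basic a)
    then obtain n \<omega> where "a = cyl n \<omega>" by auto
    then show ?case using triv[OF determined_cyl[of n \<omega>]] by simp
  next
    case Empty
    show ?case using triv[of 0 "{}"] by (simp add: determined_def)
  next
    case (Compl a)
    have "?P (T - a)"
    proof (intro allI impI)
      fix e :: real assume "e > 0"
      then have "\<exists>n X. determined n X \<and> measure \<nu> (sym_diff a X) < e" using Compl.IH by simp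
      then obtain n X where X: "determined n X" "measure \<nu> (sym_diff a X) < e" by blast
      have "a \<subseteq> T" "X \<subseteq> T"
        using Compl.IH sets.sets_into_space[of a B] X(1) by (simp_all add: determined_def)
      then have "sym_diff (T - a) (T - X) = sym_diff a X" by blast
      then show "\<exists>n X. determined n X \<and> measure \<nu> (sym_diff (T - a) X) < e"
        using X determined_Diff[OF determined_T X(1)] by (intro exI[of _ n] exI[of _ "T - X"]) auto
    qed
    then show ?case using Compl sets.compl_sets[of a B] by simp
  next
    case (Union a)
    have a: "a i \<in> sets B" for i using Union by auto
    have fin: "?P (\<Union>i<n. a i) \<and> (\<Union>i<n. a i) \<in> sets B" for n
    proof (induction n)
      case 0
      show ?case using triv[of 0 "{}"] by (simp add: determined_def)
    next
      case (Suc n)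
      have "?P ((\<Union>i<n. a i) \<union> a n)" using Un[of "\<Union>i<n. a i" "a n"] Suc Union a by blast
      then show ?case using a by (simp add: lessThan_Suc Un_commute)
    qed
    have "?P (\<Union>i. a i)"
    proof (intro allI impI)
      fix e :: real assume e: "e > 0"
      have "(\<lambda>n. measure \<nu> (\<Union>i<n. a i)) \<longlonglongrightarrow> measure \<nu> (\<Union>n. \<Union>i<n. a i)"
      proof (rule finite_Lim_measure_incseq)
        show "incseq (\<lambda>n. \<Union>i<n. a i)" unfolding incseq_def by (intro allI impI UN_mono) auto
      qed (use a sets in auto)
      also have "(\<Union>n. \<Union>i<n. a i) = (\<Union>i. a i)" by auto
      finally have "\<forall>\<^sub>F n in sequentially. measure \<nu> (\<Union>i. a i) - e/2 < measure \<nu> (\<Union>i<n. a i)"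
        using e by (intro order_tendstoD(1)) auto
      then obtain n where n: "measure \<nu> (\<Union>i. a i) - e/2 < measure \<nu> (\<Union>i<n. a i)"
        by (auto simp: eventually_sequentially)
      obtain k X where X: "determined k X" "measure \<nu> (sym_diff (\<Union>i<n. a i) X) < e/2"
        using fin[of n] e half_gt_zero by blast
      let ?A = "\<Union>i. a i" and ?An = "\<Union>i<n. a i"
      have "measure \<nu> (sym_diff ?A X) \<le> measure \<nu> ((?A - ?An) \<union> sym_diff ?An X)"
        using a X determined_sets sets by (intro finite_measure_mono) auto
      also have "\<dots> \<le> measure \<nu> (?A - ?An) + measure \<nu> (sym_diff ?An X)"
        using a X determined_sets sets by (intro measure_Un_le) auto
      also have "measure \<nu> (?A - ?An) = measure \<nu> ?A - measure \<nu> ?An"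
        using a sets by (intro finite_measure_Diff) auto
      finally have "measure \<nu> (sym_diff ?A X) < e" using n X by linarith
      then show "\<exists>n X. determined n X \<and> measure \<nu> (sym_diff ?A X) < e" using X by blast
    qed
    then show ?case using a by auto
  qed
  then show ?thesis by blast
qed

end

locale tree_vector_measure = labelled_tree M F m J
  for M :: "'a measure" and F m and J :: "'a set \<Rightarrow> 'm::finite \<Rightarrow> 'a set" +
  fixes \<mu> :: "(nat \<Rightarrow> 'a set) set \<Rightarrow> 'c::euclidean_space"
  assumes vm: "vector_measure (path_borel F m) \<mu>"
    and bv: "bounded_variation_on (path_borel F m) \<mu>"
begin

abbreviation tv where "tv \<equiv> variation_measure B \<mu>"

sublocale var: finite_measure tv
  by (rule finite_variation_measure[OF vm bv])

lemma norm_le: "A \<in> sets B \<Longrightarrow> norm (\<mu> A) \<le> measure tv A"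
  by (rule norm_le_variation_measure[OF vm bv])

lemma vm_var: "vector_measure B (measure tv)"
  by (rule vector_measure_of_measure[OF var.finite_measure_axioms]) simp

lemma norm_diff_le:
  assumes "X \<in> sets B" "Y \<in> sets B"
  shows "norm (\<mu> X) \<le> norm (\<mu> Y) + measure tv (sym_diff X Y)"
proof -
  have "X = (X \<inter> Y) \<union> (X - Y)" "Y = (X \<inter> Y) \<union> (Y - X)" by auto
  then have 1: "\<mu> X = \<mu> (X \<inter> Y) + \<mu> (X - Y)" "\<mu> Y = \<mu> (X \<inter> Y) + \<mu> (Y - X)"
    using vector_measure_Un[OF vm, of "X \<inter> Y" "X - Y"] vector_measure_Un[OF vm, of "X \<inter> Y" "Y - X"] assms
    by (metis Int_Diff_disjoint sets.Diff sets.Int, metis Int_Diff_disjoint Int_commute sets.Diff sets.Int)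
  have "norm (\<mu> X) \<le> norm (\<mu> Y) + (norm (\<mu> (X - Y)) + norm (\<mu> (Y - X)))"
    using norm_triangle_ineq[of "\<mu> Y" "\<mu> (X - Y)"] norm_triangle_ineq4[of "\<mu> Y + \<mu> (X - Y)" "\<mu> (Y - X)"]
    unfolding 1(2) by (subst 1(1)) (simp add: algebra_simps)
  also have "norm (\<mu> (X - Y)) + norm (\<mu> (Y - X)) \<le> measure tv (X - Y) + measure tv (Y - X)"
    using assms by (intro add_mono norm_le) auto
  also have "\<dots> = measure tv (sym_diff X Y)"
    using assms by (intro var.finite_measure_Union[symmetric]) auto
  finally show ?thesis by simp
qed

text \<open>A finite disjoint family that almost exhausts the total variation is replaced by unions of
  cylinders of one common level. Removing the overlaps of these unions costs no more than the
  approximation errors already made, since the original sets were disjoint.\<close>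

lemma variation_approx_level:
  assumes e: "e > 0"
  obtains n where "measure tv T - e < (\<Sum>\<omega>\<in>atoms (F n). norm (\<mu> (cyl n \<omega>)))"
proof -
  obtain P where P: "finite P" "P \<subseteq> sets B" "disjoint P" "measure tv (space B) - e/2 < (\<Sum>X\<in>P. norm (\<mu> X))"
    using variation_measure_approx[OF vm bv, of "e/2"] e by auto
  define k where "k = card P"
  obtain Y where Y: "bij_betw Y {..<k} P"
    using ex_bij_betw_nat_finite[OF P(1)] by (auto simp: atLeast0LessThan k_def)
  have YB: "Y i \<in> sets B" if "i < k" for i using Y P(2) that by (auto simp: bij_betw_def)
  have Yd: "Y i \<inter> Y j = {}" if "i < k" "j < k" "i \<noteq> j" for i j
    using Y P(3) that unfolding bij_betw_def disjoint_def inj_on_def by (metis imageI lessThan_iff)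
  \<comment> \<open>Each of the \<open>k\<close> sets suffers up to \<open>k\<close> approximation errors, one for every removed overlap.\<close>
  define e' where "e' = e / (2 * (real k + 1) ^ 2)"
  have e': "e' > 0" using e by (simp add: e'_def)
  have "\<exists>n X. determined n X \<and> measure tv (sym_diff (Y i) X) < e'" if "i < k" for i
    using approx_by_determined[OF var.finite_measure_axioms _ YB[OF that]] e' by auto
  then obtain n X where X: "\<And>i. i < k \<Longrightarrow> determined (n i) (X i)"
     "\<And>i. i < k \<Longrightarrow> measure tv (sym_diff (Y i) (X i)) < e'" by metis
  define N where "N = Max (insert 0 (n ` {..<k}))"
  have XN: "determined N (X i)" if "i < k" for i
    using X(1)[OF that] by (rule determined_mono) (use that in \<open>auto simp: N_def\<close>)
  define Z where "Z i = X i - (\<Union>j<i. X j)" for i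
  have ZN: "determined N (Z i)" if "i < k" for i
    unfolding Z_def using XN that by (intro determined_Diff determined_UN) auto
  have Zd: "Z i \<inter> Z j = {}" if "i \<noteq> j" for i j
    using that by (cases "i < j") (auto simp: Z_def not_less)
  have YZ: "norm (\<mu> (Y i)) \<le> norm (\<mu> (Z i)) + (real k + 1) * e'" if i: "i < k" for i
  proof -
    have XB: "X j \<in> sets B" if "j < k" for j using determined_sets[OF XN[OF that]] .
    have ZB: "Z i \<in> sets B" using determined_sets[OF ZN[OF i]] .
    have sub: "sym_diff (Y i) (Z i) \<subseteq> (\<Union>j<k. sym_diff (Y j) (X j))"
    proof
      fix x assume x: "x \<in> sym_diff (Y i) (Z i)"
      show "x \<in> (\<Union>j<k. sym_diff (Y j) (X j))"
      proof (cases "x \<in> sym_diff (Y i) (X i)")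
        case False
        then have "x \<in> Y i" "x \<in> X i" "x \<notin> Z i" using x by (auto simp: Z_def)
        then obtain j where j: "j < i" "x \<in> X j" by (auto simp: Z_def)
        have "x \<notin> Y j" using Yd[of i j] j i \<open>x \<in> Y i\<close> by auto
        then show ?thesis using j i by (intro UN_I[of j]) auto
      qed (use i in blast)
    qed
    have "norm (\<mu> (Y i)) \<le> norm (\<mu> (Z i)) + measure tv (sym_diff (Y i) (Z i))"
      by (rule norm_diff_le[OF YB[OF i] ZB])
    also have "measure tv (sym_diff (Y i) (Z i)) \<le> measure tv (\<Union>j<k. sym_diff (Y j) (X j))"
      using sub YB XB by (intro var.finite_measure_mono) auto
    also have "\<dots> \<le> (\<Sum>j<k. measure tv (sym_diff (Y j) (X j)))"
      using YB XB by (intro var.finite_measure_subadditive_finite) auto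
    also have "\<dots> \<le> (\<Sum>j<k. e')" using X(2) by (intro sum_mono) (simp add: less_imp_le)
    also have "\<dots> \<le> (real k + 1) * e'" using e' by simp
    finally show ?thesis by simp
  qed
  have "(\<Sum>X\<in>P. norm (\<mu> X)) = (\<Sum>i<k. norm (\<mu> (Y i)))"
    using sum.reindex_bij_betw[OF Y, of "\<lambda>X. norm (\<mu> X)"] by simp
  also have "\<dots> \<le> (\<Sum>i<k. norm (\<mu> (Z i)) + (real k + 1) * e')" by (intro sum_mono YZ) simp
  also have "\<dots> = (\<Sum>i<k. norm (\<mu> (Z i))) + real k * ((real k + 1) * e')" by (simp add: sum.distrib)
  also have "real k * ((real k + 1) * e') \<le> (real k + 1) * ((real k + 1) * e')"
    using e' by (intro mult_right_mono) auto
  also have "\<dots> = e / 2"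
  proof -
    have "c * (c * (e / (2 * c ^ 2))) = e / 2" if "c > 0" for c :: real
      using that by (simp add: power2_eq_square)
    then show ?thesis unfolding e'_def by simp
  qed
  finally have 1: "(\<Sum>X\<in>P. norm (\<mu> X)) \<le> (\<Sum>i<k. norm (\<mu> (Z i))) + e / 2" by simp
  let ?A = "\<lambda>i. (\<lambda>\<gamma>. \<gamma> N) ` Z i"
  have finA: "finite (?A i)" if "i < k" for i
    using determined_eq(2)[OF ZN[OF that]] by (rule finite_subset) simp
  have "(\<Sum>i<k. norm (\<mu> (Z i))) \<le> (\<Sum>i<k. \<Sum>\<omega>\<in>?A i. norm (\<mu> (cyl N \<omega>)))"
    using determined_vector_measure[OF vm ZN] by (intro sum_mono) (simp add: norm_sum)
  also have "\<dots> = (\<Sum>\<omega>\<in>(\<Union>i<k. ?A i). norm (\<mu> (cyl N \<omega>)))"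
  proof (rule sum.UNION_disjoint[symmetric])
    show "\<forall>i\<in>{..<k}. \<forall>j\<in>{..<k}. i \<noteq> j \<longrightarrow> ?A i \<inter> ?A j = {}"
    proof (intro ballI impI)
      fix i j assume ij: "i \<in> {..<k}" "j \<in> {..<k}" "i \<noteq> j"
      have "\<gamma> \<in> Z j" if "\<gamma> \<in> Z i" "\<beta> \<in> Z j" "\<gamma> N = \<beta> N" for \<gamma> \<beta>
        using that ZN[of i] ZN[of j] ij unfolding determined_def by (metis lessThan_iff subset_iff)
      then show "?A i \<inter> ?A j = {}" using Zd[OF ij(3)] by blast
    qed
  qed (use finA in auto)
  also have "\<dots> \<le> (\<Sum>\<omega>\<in>atoms (F N). norm (\<mu> (cyl N \<omega>)))"
    using determined_eq(2)[OF ZN] by (intro sum_mono2) auto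
  finally have "measure tv T - e < (\<Sum>\<omega>\<in>atoms (F N). norm (\<mu> (cyl N \<omega>)))"
    using 1 P(4) by simp
  then show ?thesis by (rule that)
qed

section \<open>Polarisation of the measure along almost every path\<close>

text \<open>For a unit vector \<open>u\<close> this is a nonnegative measure. It is small compared with the total
  variation exactly where \<open>\<mu>\<close> is close to \<open>u\<close> times the total variation.\<close>

definition deficit :: "'c \<Rightarrow> (nat \<Rightarrow> 'a set) set \<Rightarrow> real" where
  "deficit u A = measure tv A - u \<bullet> \<mu> A"

lemma deficit_nonneg: "norm u = 1 \<Longrightarrow> A \<in> sets B \<Longrightarrow> 0 \<le> deficit u A"
  using norm_cauchy_schwarz[of u "\<mu> A"] norm_le[of A] by (simp add: deficit_def)

lemma vm_deficit: "vector_measure B (deficit u)"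
  unfolding vector_measure_def deficit_def
proof (intro allI impI)
  fix A :: "nat \<Rightarrow> _" assume A: "range A \<subseteq> sets B" "disjoint_family A"
  show "(\<lambda>i. measure tv (A i) - u \<bullet> \<mu> (A i)) sums (measure tv (\<Union>i. A i) - u \<bullet> \<mu> (\<Union>i. A i))"
    by (intro sums_diff bounded_linear.sums[OF bounded_linear_inner_right]
        vm[unfolded vector_measure_def, rule_format, OF A] vm_var[unfolded vector_measure_def, rule_format, OF A])
qed

text \<open>A weak type maximal inequality. Stop a path at the first level where the deficit exceeds the
  proportion \<open>\<delta>\<close> of the total variation. The stopping cylinders are disjoint, hence \<open>\<delta>\<close> times their
  total mass is at most the deficit of the whole cylinder.\<close>

lemma deficit_maximal:
  assumes u: "norm u = 1" and \<delta>: "\<delta> > 0"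
  shows "\<delta> * measure tv {\<gamma>\<in>cyl N \<omega>. \<exists>n\<ge>N. \<delta> * measure tv (cyl n (\<gamma> n)) < deficit u (cyl n (\<gamma> n))}
     \<le> deficit u (cyl N \<omega>)" (is "\<delta> * measure tv ?bad \<le> _")
proof -
  let ?ex = "\<lambda>n \<alpha>. \<delta> * measure tv (cyl n \<alpha>) < deficit u (cyl n \<alpha>)"
  \<comment> \<open>the paths that have not been stopped before level \<open>N + k\<close>\<close>
  define G where "G k = {\<gamma>\<in>cyl N \<omega>. \<forall>n. N \<le> n \<and> n < N + k \<longrightarrow> \<not> ?ex n (\<gamma> n)}" for k
  have G_det: "determined (N + k) (G k)" for k
    unfolding determined_def
  proof (intro conjI ballI impI)
    fix \<gamma> \<gamma>' assume g: "\<gamma> \<in> T" "\<gamma>' \<in> T" "\<gamma> (N + k) = \<gamma>' (N + k)" "\<gamma> \<in> G k"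
    have "\<gamma> n = \<gamma>' n" if "n \<le> N + k" for n using path_agree_down[OF g(1-3) that] .
    then show "\<gamma>' \<in> G k" using g(2,4) by (auto simp: G_def)
  qed (auto simp: G_def)
  have GB: "G k \<in> sets B" for k by (rule determined_sets[OF G_det])
  have C: "cyl N \<omega> \<in> sets B" by simp
  have inv: "deficit u (G k) + \<delta> * measure tv (cyl N \<omega> - G k) \<le> deficit u (cyl N \<omega>)" for k
  proof (induction k)
    case 0
    have "G 0 = cyl N \<omega>" by (auto simp: G_def)
    then show ?case by simp
  next
    case (Suc k)
    define R where "R = G k - G (Suc k)"
    have sub: "G (Suc k) \<subseteq> G k" "G k \<subseteq> cyl N \<omega>" by (auto simp: G_def)
    have R_eq: "R = {\<gamma>\<in>G k. ?ex (N + k) (\<gamma> (N + k))}"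
      unfolding R_def G_def by (auto simp: less_Suc_eq)
    have R_det: "determined (N + k) R"
      unfolding determined_def
    proof (intro conjI ballI impI)
      show "R \<subseteq> T" using G_det[of k] by (auto simp: determined_def R_def)
      fix \<gamma> \<gamma>' assume g: "\<gamma> \<in> T" "\<gamma>' \<in> T" "\<gamma> (N + k) = \<gamma>' (N + k)" "\<gamma> \<in> R"
      then have "\<gamma>' \<in> G k" using G_det[of k] unfolding determined_def R_def by blast
      then show "\<gamma>' \<in> R" using g(3,4) by (simp add: R_eq)
    qed
    have "\<delta> * measure tv R = (\<Sum>\<alpha>\<in>(\<lambda>\<gamma>. \<gamma> (N + k)) ` R. \<delta> * measure tv (cyl (N + k) \<alpha>))"
      unfolding determined_vector_measure[OF vm_var R_det] by (rule sum_distrib_left)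
    also have "\<dots> \<le> (\<Sum>\<alpha>\<in>(\<lambda>\<gamma>. \<gamma> (N + k)) ` R. deficit u (cyl (N + k) \<alpha>))"
      by (intro sum_mono) (auto simp: R_eq)
    also have "\<dots> = deficit u R" by (rule determined_vector_measure[OF vm_deficit R_det, symmetric])
    also have "deficit u R = deficit u (G k) - deficit u (G (Suc k))"
      unfolding R_def using sub GB by (intro vector_measure_Diff[OF vm_deficit]) auto
    finally have 1: "deficit u (G (Suc k)) + \<delta> * measure tv R \<le> deficit u (G k)" by simp
    have "cyl N \<omega> - G (Suc k) = (cyl N \<omega> - G k) \<union> R" using sub by (auto simp: R_def)
    moreover have "measure tv ((cyl N \<omega> - G k) \<union> R) = measure tv (cyl N \<omega> - G k) + measure tv R"
      using GB C by (intro var.finite_measure_Union) (auto simp: R_def)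
    ultimately show ?case using 1 Suc by (simp add: distrib_left)
  qed
  have bad: "?bad = (\<Union>k. cyl N \<omega> - G k)"
  proof (intro set_eqI iffI)
    fix \<gamma> assume "\<gamma> \<in> ?bad"
    then obtain n where "\<gamma> \<in> cyl N \<omega>" "n \<ge> N" "?ex n (\<gamma> n)" by auto
    then have "\<gamma> \<in> cyl N \<omega> - G (Suc (n - N))" by (auto simp: G_def)
    then show "\<gamma> \<in> (\<Union>k. cyl N \<omega> - G k)" by blast
  qed (auto simp: G_def)
  have "(\<lambda>k. \<delta> * measure tv (cyl N \<omega> - G k)) \<longlonglongrightarrow> \<delta> * measure tv ?bad"
    unfolding bad
  proof (intro tendsto_mult_left var.finite_Lim_measure_incseq)
    show "incseq (\<lambda>k. cyl N \<omega> - G k)" by (auto simp: incseq_def G_def)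
  qed (use GB C in auto)
  moreover have "\<delta> * measure tv (cyl N \<omega> - G k) \<le> deficit u (cyl N \<omega>)" for k
    using inv[of k] deficit_nonneg[OF u GB[of k]] by linarith
  ultimately show ?thesis by (intro LIMSEQ_le_const2) auto
qed

end

section \<open>The lower bound\<close>

text \<open>Expand the square: \<open>|l u - x|\<^sup>2 = l\<^sup>2 - 2 l u \<bullet> x + |x|\<^sup>2\<close> is at most \<open>2 l (l - u \<bullet> x)\<close>. In the
  application \<open>l\<close> is the total variation of a cylinder and \<open>x\<close> its vector mass.\<close>

lemma norm_diff_of_deficit:
  fixes u x :: "'c::real_inner"
  assumes "norm u = 1" "norm x \<le> l" "l - u \<bullet> x \<le> e" "l \<le> L" "0 \<le> e"
  shows "norm (l *\<^sub>R u - x) \<le> sqrt (2 * L * e)"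
proof -
  have l: "0 \<le> l" using assms(2) norm_ge_zero order_trans by blast
  have "(norm (l *\<^sub>R u - x))\<^sup>2 = l\<^sup>2 * (norm u)\<^sup>2 - 2 * l * (u \<bullet> x) + (norm x)\<^sup>2"
    unfolding power2_norm_eq_inner by (simp add: inner_diff_left inner_diff_right inner_commute power2_eq_square algebra_simps)
  also have "\<dots> \<le> 2 * l * (l - u \<bullet> x)"
    using power_mono[OF assms(2) norm_ge_zero, of 2] assms(1) by (simp add: power2_eq_square algebra_simps)
  also have "\<dots> \<le> 2 * l * e" using l assms(3) by (intro mult_left_mono) auto
  also have "\<dots> \<le> 2 * L * e" using assms(4,5) by (intro mult_right_mono) auto
  finally show ?thesis by (rule real_le_rsqrt)
qed

lemma norm_vec_le_sum: "norm (x :: 'c::real_normed_vector ^ 'm::finite) \<le> (\<Sum>j\<in>UNIV. norm (x $ j))"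
  unfolding norm_vec_def by (rule L2_set_le_sum) simp

text \<open>Here \<open>L\<close> and \<open>x\<close> are the total variation and the vector mass of an atom, \<open>l j\<close> and \<open>y j\<close> those of
  its children. Writing \<open>l j = L (1 + v j) / m\<close>, the alignment errors relative to \<open>L\<close> bound the distance
  of \<open>v \<otimes> u\<close> to a multiple of the martingale increment \<open>b\<close>, so for small \<open>\<delta>\<close> the compactness bound applies.\<close>

lemma near_aligned_splitting:
  fixes W :: "((real^'l::finite)^'m::finite) set" and y :: "'m \<Rightarrow> real^'l"
  assumes W: "subspace W" and p: "p > 0" and r: "r \<ge> 0"
    and bound: "\<And>v. v \<in> admissible W \<Longrightarrow> (\<Sum>j\<in>UNIV. ((1 + v $ j) / real CARD('m)) powr p) < r"
  obtains \<delta> where "\<delta> > 0" "\<And>u x y l L b c. \<lbrakk>norm u = 1; (\<Sum>j\<in>UNIV. l j) = L; \<And>j. norm (y j) \<le> l j; norm x \<le> L;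
      \<And>j. l j - u \<bullet> y j \<le> L - u \<bullet> x; L - u \<bullet> x \<le> \<delta> * L; c > 0; b \<in> W;
      \<And>j. b $ j = c *\<^sub>R (real CARD('m) *\<^sub>R y j - x)\<rbrakk>
     \<Longrightarrow> (\<Sum>j\<in>UNIV. l j powr p) \<le> r * L powr p"
proof -
  let ?m = "real CARD('m)"
  obtain \<eta> where \<eta>: "\<eta> > 0" "\<And>v u w. \<lbrakk>v \<in> zero_sum; \<And>j. v $ j \<ge> -1; norm u = 1; w \<in> W;
     norm (tensor v u - w) < \<eta>\<rbrakk> \<Longrightarrow> (\<Sum>j\<in>UNIV. ((1 + v $ j) / ?m) powr p) < r"
    using moment_bound_near_rank_one[OF W p bound] by blast
  \<comment> \<open>If all mass vectors are aligned up to a relative error \<open>t\<close>, each of the \<open>m\<close> components of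
    \<open>v \<otimes> u\<close> is off by at most \<open>(m + 1) t\<close>.\<close>
  define t where "t = \<eta> / (2 * ?m * (?m + 1))"
  have t: "t > 0" "?m * ((?m + 1) * t) < \<eta>"
  proof -
    have m: "?m > 0" by simp
    show "t > 0" using \<eta>(1) m by (simp add: t_def)
    have "c * ((c + 1) * (\<eta> / (2 * c * (c + 1)))) = \<eta> / 2" if "c > 0" for c :: real
      using that by simp
    then have "?m * ((?m + 1) * t) = \<eta> / 2" unfolding t_def using m by blast
    then show "?m * ((?m + 1) * t) < \<eta>" using \<eta>(1) by simp
  qed
  \<comment> \<open>With this \<open>\<delta>\<close> the error \<open>sqrt (2 L (\<delta> L))\<close> in the alignment of each mass vector is \<open>t L\<close>.\<close>
  define \<delta> where "\<delta> = t\<^sup>2 / 2"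
  have \<delta>: "\<delta> > 0" using t by (simp add: \<delta>_def)
  show ?thesis
  proof (rule that[OF \<delta>])
    fix u x :: "real^'l" and y :: "'m \<Rightarrow> real^'l" and l L b c
    assume u: "norm u = 1" and L: "(\<Sum>j\<in>UNIV. l j) = L" and y: "\<And>j. norm (y j) \<le> l j" and x: "norm x \<le> L"
      and d: "\<And>j. l j - u \<bullet> y j \<le> L - u \<bullet> x" and good: "L - u \<bullet> x \<le> \<delta> * L"
      and c: "c > 0" and b: "b \<in> W" "\<And>j. b $ j = c *\<^sub>R (?m *\<^sub>R y j - x)"
    have l0: "0 \<le> l j" for j using y[of j] norm_ge_zero order_trans by blast
    have lL: "l j \<le> L" for j unfolding L[symmetric] using l0 by (intro member_le_sum) auto
    have L0: "0 \<le> L" using x norm_ge_zero order_trans by blast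
    show "(\<Sum>j\<in>UNIV. l j powr p) \<le> r * L powr p"
    proof (cases "L = 0")
      case True
      then have "l j = 0" for j using l0[of j] lL[of j] by simp
      then show ?thesis using True by simp
    next
      case False
      then have Lpos: "L > 0" using L0 by simp
      have sq: "sqrt (2 * L * (\<delta> * L)) = t * L"
        using t Lpos by (intro real_sqrt_unique) (auto simp: \<delta>_def power2_eq_square)
      have nx: "norm (L *\<^sub>R u - x) \<le> t * L"
        using norm_diff_of_deficit[OF u x good order_refl] \<delta> Lpos by (simp add: sq)
      have ny: "norm (l j *\<^sub>R u - y j) \<le> t * L" for j
        using norm_diff_of_deficit[OF u y order_trans[OF d good] lL] \<delta> Lpos by (simp add: sq)
      define v :: "real^'m" where "v = (\<chi> j. ?m * l j / L - 1)"
      have v: "(1 + v $ j) / ?m = l j / L" "v $ j \<ge> -1" for j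
        using Lpos l0[of j] by (auto simp: v_def)
      have "(\<Sum>j\<in>UNIV. v $ j) = ?m * (\<Sum>j\<in>UNIV. l j) / L - ?m"
        by (simp add: v_def sum_subtractf sum_divide_distrib sum_distrib_left)
      then have v0: "v \<in> zero_sum" using Lpos by (simp add: zero_sum_def L)
      define w where "w = (1 / (c * L)) *\<^sub>R b"
      have w: "w \<in> W" using b W by (auto simp: w_def intro: subspace_scale)
      have "norm ((tensor v u - w) $ j) \<le> (?m + 1) * t" for j
      proof -
        have "w $ j = (1 / L) *\<^sub>R (?m *\<^sub>R y j - x)" using c by (simp add: w_def b)
        moreover have "tensor v u $ j = (1 / L) *\<^sub>R (?m *\<^sub>R l j *\<^sub>R u - L *\<^sub>R u)"
          using Lpos by (simp add: tensor_def v_def scaleR_diff_left scaleR_diff_right)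
        ultimately have "(tensor v u - w) $ j = (1 / L) *\<^sub>R (?m *\<^sub>R (l j *\<^sub>R u - y j) - (L *\<^sub>R u - x))"
          by (simp add: scaleR_diff_right)
        then have "norm ((tensor v u - w) $ j) = (1 / L) * norm (?m *\<^sub>R (l j *\<^sub>R u - y j) - (L *\<^sub>R u - x))"
          using Lpos by simp
        also have "\<dots> \<le> (1 / L) * (?m * norm (l j *\<^sub>R u - y j) + norm (L *\<^sub>R u - x))"
          using Lpos norm_triangle_ineq4[of "?m *\<^sub>R (l j *\<^sub>R u - y j)" "L *\<^sub>R u - x"]
          by (intro mult_left_mono) auto
        also have "\<dots> \<le> (1 / L) * (?m * (t * L) + t * L)"
          using Lpos nx ny[of j] by (intro mult_left_mono add_mono) auto
        also have "\<dots> = (?m + 1) * t" using Lpos by (simp add: field_simps)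
        finally show ?thesis .
      qed
      then have "(\<Sum>j\<in>UNIV. norm ((tensor v u - w) $ j)) \<le> (\<Sum>j\<in>(UNIV :: 'm set). (?m + 1) * t)"
        by (intro sum_mono)
      then have "norm (tensor v u - w) \<le> ?m * ((?m + 1) * t)"
        using norm_vec_le_sum[of "tensor v u - w"] by simp
      then have "norm (tensor v u - w) < \<eta>" using t(2) by simp
      then have "(\<Sum>j\<in>UNIV. (l j / L) powr p) < r"
        using \<eta>(2)[OF v0 v(2) u w] by (simp add: v(1))
      moreover have "(\<Sum>j\<in>UNIV. l j powr p) = L powr p * (\<Sum>j\<in>UNIV. (l j / L) powr p)"
        using Lpos l0 by (simp add: sum_distrib_left powr_divide)
      moreover have "L powr p * (\<Sum>j\<in>UNIV. (l j / L) powr p) \<le> L powr p * r"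
        using calculation(1) by (intro mult_left_mono) auto
      ultimately show ?thesis by (simp add: mult.commute)
    qed
  qed
qed

context labelled_tree
begin

lemma generated_martingale_eq:
  assumes "\<omega> \<in> atoms (F n)" "x \<in> \<omega>"
  shows "generated_martingale F m \<mu> n x = (real m ^ n) *\<^sub>R \<mu> (cyl n \<omega>)"
proof -
  have "generated_martingale F m \<mu> n x
      = (\<Sum>\<alpha>\<in>atoms (F n). if \<alpha> = \<omega> then (real m ^ n) *\<^sub>R \<mu> (cyl n \<omega>) else 0)"
    unfolding generated_martingale_def
  proof (rule sum.cong)
    fix \<alpha> assume a: "\<alpha> \<in> atoms (F n)"
    have "x \<notin> \<alpha>" if "\<alpha> \<noteq> \<omega>" using atoms_unique[OF a assms(1) _ assms(2)] that by blast
    then show "(real m ^ n * indicator \<alpha> x) *\<^sub>R \<mu> (cyl n \<alpha>) = (if \<alpha> = \<omega> then (real m ^ n) *\<^sub>R \<mu> (cyl n \<omega>) else 0)"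
      using assms(2) by (cases "\<alpha> = \<omega>") simp_all
  qed simp
  then show ?thesis using assms(1) by simp
qed

lemma measures_in_splitting:
  fixes W :: "((real^'l::finite)^'m) set"
  assumes "\<mu> \<in> measures_in M F J W" "\<omega> \<in> atoms (F n)"
  obtains b where "b \<in> W" "\<And>j. b $ j = (real m ^ n) *\<^sub>R (real m *\<^sub>R \<mu> (cyl (Suc n) (J \<omega> j)) - \<mu> (cyl n \<omega>))"
proof -
  have "\<exists>b\<in>W. \<forall>j. \<forall>x\<in>J \<omega> j. generated_martingale F m \<mu> (Suc n) x - generated_martingale F m \<mu> n x = b $ j"
    using assms by (simp add: measures_in_def martingale_space_def)
  then obtain b where b: "b \<in> W" "\<And>j x. x \<in> J \<omega> j \<Longrightarrow>
      generated_martingale F m \<mu> (Suc n) x - generated_martingale F m \<mu> n x = b $ j"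
    by blast
  have "b $ j = (real m ^ n) *\<^sub>R (real m *\<^sub>R \<mu> (cyl (Suc n) (J \<omega> j)) - \<mu> (cyl n \<omega>))" for j
  proof -
    obtain x where x: "x \<in> J \<omega> j" using atoms_nonempty[OF J_atoms[OF assms(2)]] by blast
    have "generated_martingale F m \<mu> (Suc n) x = (real m ^ Suc n) *\<^sub>R \<mu> (cyl (Suc n) (J \<omega> j))"
      by (rule generated_martingale_eq[OF J_atoms[OF assms(2)] x])
    moreover have "generated_martingale F m \<mu> n x = (real m ^ n) *\<^sub>R \<mu> (cyl n \<omega>)"
      using x J_subset[OF assms(2)] by (intro generated_martingale_eq[OF assms(2)]) auto
    ultimately show ?thesis using b(2)[OF x] by (simp add: scaleR_diff_right mult.commute)
  qed
  then show ?thesis using that b(1) by blast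
qed

text \<open>Choose a level \<open>N\<close> at which the sum of the norms of \<open>\<mu>\<close> almost exhausts the total variation. Inside each
  level-\<open>N\<close> cylinder let \<open>u\<close> be the direction of \<open>\<mu>\<close> on it; the deficits then have a small sum, and
  by the maximal inequality most paths only meet splittings aligned with \<open>u\<close> from level \<open>N\<close> on.
  There the moments of the total variation contract, so the cylinders become light. The exceptional
  set does not depend on \<open>N\<close>, hence it is null.\<close>

lemma variation_light:
  fixes W :: "((real^'l::finite)^'m) set"
  assumes mu: "\<mu> \<in> measures_in M F J W" and W: "subspace W"
    and max: "\<And>w. w \<in> admissible W \<Longrightarrow> divergence w \<le> h" and s: "s < 1 - h / ln (real m)"
  shows "AE \<gamma> in variation_measure B \<mu>. \<forall>\<^sub>F n in sequentially.
     measure (variation_measure B \<mu>) (cyl n (\<gamma> n)) \<le> ((1 / real m) ^ n) powr s"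
proof -
  have vm: "vector_measure B \<mu>" and bv: "bounded_variation_on B \<mu>"
    using mu by (simp_all add: measures_in_def)
  interpret tree_vector_measure M F m J \<mu>
    by unfold_locales (rule vm bv)+
  have "CARD('m) \<ge> 2" "s < 1 - h / ln (real CARD('m))" using card_ge_2 s by auto
  from moment_contraction[OF max this]
  obtain p r where p: "p > 1" and r: "r \<ge> 0" "r < real m powr (- s * (p - 1))"
    and bound: "\<And>v. v \<in> admissible W \<Longrightarrow> (\<Sum>j\<in>UNIV. ((1 + v $ j) / real CARD('m)) powr p) < r"
    by (auto simp only: card_m)
  have p0: "p > 0" using p by simp
  obtain \<delta> where \<delta>: "\<delta> > 0" and contract: "\<And>u x y l L b c. \<lbrakk>norm (u :: real^'l) = 1; (\<Sum>j\<in>UNIV. l j) = L;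
      \<And>j :: 'm. norm (y j) \<le> l j; norm x \<le> L;
      \<And>j. l j - u \<bullet> y j \<le> L - u \<bullet> x; L - u \<bullet> x \<le> \<delta> * L; c > 0; b \<in> W;
      \<And>j. b $ j = c *\<^sub>R (real CARD('m) *\<^sub>R y j - x)\<rbrakk>
     \<Longrightarrow> (\<Sum>j\<in>UNIV. l j powr p) \<le> r * L powr p"
    using near_aligned_splitting[OF W p0 r(1) bound] by blast
  let ?light = "\<lambda>\<gamma> n. measure tv (cyl n (\<gamma> n)) \<le> ((1 / real m) ^ n) powr s"
  have light_if_good: "AE \<gamma> in tv. (\<forall>n\<ge>N. deficit u (cyl n (\<gamma> n)) \<le> \<delta> * measure tv (cyl n (\<gamma> n)))
      \<longrightarrow> (\<forall>\<^sub>F n in sequentially. ?light \<gamma> n)" if u: "norm u = 1" for u :: "real^'l" and N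
  proof -
    have step: "(\<Sum>j\<in>UNIV. measure tv (cyl (Suc n) (J \<omega> j)) powr p) \<le> r * measure tv (cyl n \<omega>) powr p"
      if w: "\<omega> \<in> atoms (F n)" and good: "deficit u (cyl n \<omega>) \<le> \<delta> * measure tv (cyl n \<omega>)" for n \<omega>
    proof -
      obtain b where b: "b \<in> W" "\<And>j. b $ j = (real m ^ n) *\<^sub>R (real m *\<^sub>R \<mu> (cyl (Suc n) (J \<omega> j)) - \<mu> (cyl n \<omega>))"
        using measures_in_splitting[OF mu w] by blast
      have dle: "deficit u (cyl (Suc n) (J \<omega> j)) \<le> deficit u (cyl n \<omega>)" for j
        unfolding vector_measure_children[OF vm_deficit w]
        by (intro member_le_sum deficit_nonneg u) auto
      show ?thesis
      proof (rule contract[OF u])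
        show "(\<Sum>j\<in>UNIV. measure tv (cyl (Suc n) (J \<omega> j))) = measure tv (cyl n \<omega>)"
          by (rule vector_measure_children[OF vm_var w, symmetric])
        show "norm (\<mu> (cyl (Suc n) (J \<omega> j))) \<le> measure tv (cyl (Suc n) (J \<omega> j))" for j
          by (intro norm_le) simp
        show "norm (\<mu> (cyl n \<omega>)) \<le> measure tv (cyl n \<omega>)" by (intro norm_le) simp
        show "measure tv (cyl (Suc n) (J \<omega> j)) - u \<bullet> \<mu> (cyl (Suc n) (J \<omega> j))
           \<le> measure tv (cyl n \<omega>) - u \<bullet> \<mu> (cyl n \<omega>)" for j
          using dle[of j] by (simp add: deficit_def)
        show "measure tv (cyl n \<omega>) - u \<bullet> \<mu> (cyl n \<omega>) \<le> \<delta> * measure tv (cyl n \<omega>)"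
          using good by (simp add: deficit_def)
        show "0 < real m ^ n" using card_ge_2 by simp
        show "b \<in> W" by (rule b(1))
        show "b $ j = (real m ^ n) *\<^sub>R (real CARD('m) *\<^sub>R \<mu> (cyl (Suc n) (J \<omega> j)) - \<mu> (cyl n \<omega>))" for j
          using b(2) by simp
      qed
    qed
    have decay: "AE \<gamma> in tv. (\<forall>n\<ge>N. deficit u (cyl n (\<gamma> n)) \<le> \<delta> * measure tv (cyl n (\<gamma> n)))
      \<longrightarrow> (\<forall>\<^sub>F n in sequentially. measure tv (cyl n (\<gamma> n)) powr (p - 1) \<le> (real m powr (- s * (p - 1))) ^ n)"
      by (rule moment_decay[OF var.finite_measure_axioms _ r,
            where good = "\<lambda>n \<omega>. deficit u (cyl n \<omega>) \<le> \<delta> * measure tv (cyl n \<omega>)"]) (auto intro: step)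
    have light: "measure tv X \<le> ((1 / real m) ^ n) powr s"
      if "measure tv X powr (p - 1) \<le> (real m powr (- s * (p - 1))) ^ n" for X n
    proof (rule ccontr)
      assume "\<not> ?thesis"
      then have "(((1 / real m) ^ n) powr s) powr (p - 1) < measure tv X powr (p - 1)"
        using p by (intro powr_less_mono2) auto
      also have "(((1 / real m) ^ n) powr s) powr (p - 1) = (real m powr (- s * (p - 1))) ^ n"
        using card_ge_2 by (simp add: powr_def ln_realpow ln_div exp_of_nat_mult[symmetric] mult_ac del: power_divide)
      finally show False using that by simp
    qed
    show ?thesis using decay
    proof eventually_elim
      case (elim \<gamma>)
      show ?case
      proof
        assume "\<forall>n\<ge>N. deficit u (cyl n (\<gamma> n)) \<le> \<delta> * measure tv (cyl n (\<gamma> n))"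
        with elim have "\<forall>\<^sub>F n in sequentially.
          measure tv (cyl n (\<gamma> n)) powr (p - 1) \<le> (real m powr (- s * (p - 1))) ^ n" by blast
        then show "\<forall>\<^sub>F n in sequentially. ?light \<gamma> n" by eventually_elim (rule light)
      qed
    qed
  qed
  define X where "X = T - (\<Union>N. {\<gamma>\<in>T. \<forall>n\<ge>N. ?light \<gamma> n})"
  have X: "X \<in> sets B"
    unfolding X_def
  proof (intro sets.Diff sets.countable_UN)
    show "T \<in> sets B" using sets.top[of B] by simp
    show "range (\<lambda>N. {\<gamma>\<in>T. \<forall>n\<ge>N. ?light \<gamma> n}) \<subseteq> sets B"
      using sets_all_levels[where P = "\<lambda>n \<omega>. measure tv (cyl n \<omega>) \<le> ((1 / real m) ^ n) powr s"] by blast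
  qed
  have X_iff: "\<gamma> \<in> X \<longleftrightarrow> \<gamma> \<in> T \<and> \<not> (\<forall>\<^sub>F n in sequentially. ?light \<gamma> n)" for \<gamma>
    by (auto simp: X_def eventually_sequentially)
  have small: "measure tv X \<le> e / \<delta>" if e: "e > 0" for e
  proof -
    obtain N where N: "measure tv T - e < (\<Sum>\<omega>\<in>atoms (F N). norm (\<mu> (cyl N \<omega>)))"
      using variation_approx_level[OF e] by blast
    have part: "measure tv (X \<inter> cyl N \<omega>) \<le> (measure tv (cyl N \<omega>) - norm (\<mu> (cyl N \<omega>))) / \<delta>" for \<omega>
    proof -
      \<comment> \<open>the direction of \<open>\<mu>\<close> on the cylinder; an arbitrary unit vector if \<open>\<mu>\<close> vanishes there\<close>
      obtain u :: "real^'l" where u: "norm u = 1" "u \<bullet> \<mu> (cyl N \<omega>) = norm (\<mu> (cyl N \<omega>))"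
      proof (cases "\<mu> (cyl N \<omega>) = 0")
        case True
        obtain u :: "real^'l" where "norm u = 1" using vector_choose_size[of 1] by auto
        then show ?thesis using that True by simp
      next
        case False
        then show ?thesis
          by (intro that[of "sgn (\<mu> (cyl N \<omega>))"])
             (auto simp: norm_sgn sgn_div_norm power2_norm_eq_inner[symmetric] power2_eq_square)
      qed
      let ?bad = "{\<gamma>\<in>cyl N \<omega>. \<exists>n\<ge>N. \<delta> * measure tv (cyl n (\<gamma> n)) < deficit u (cyl n (\<gamma> n))}"
      have bad_eq: "?bad = cyl N \<omega> - {\<gamma>\<in>T. \<forall>n\<ge>N. deficit u (cyl n (\<gamma> n)) \<le> \<delta> * measure tv (cyl n (\<gamma> n))}"
        by (auto simp: not_le)
      have bad: "?bad \<in> sets B"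
        unfolding bad_eq
        by (intro sets.Diff cyl_sets sets_all_levels[where P = "\<lambda>n \<omega>. deficit u (cyl n \<omega>) \<le> \<delta> * measure tv (cyl n \<omega>)"])
      have "measure tv (X \<inter> cyl N \<omega>) \<le> measure tv ?bad"
      proof (rule var.finite_measure_mono_AE)
        show "AE \<gamma> in tv. \<gamma> \<in> X \<inter> cyl N \<omega> \<longrightarrow> \<gamma> \<in> ?bad"
          using light_if_good[OF u(1), of N] by eventually_elim (auto simp: X_iff not_le)
        show "?bad \<in> sets tv" unfolding sets_variation_measure by (rule bad)
      qed
      moreover have "\<delta> * measure tv ?bad \<le> measure tv (cyl N \<omega>) - norm (\<mu> (cyl N \<omega>))"
        using deficit_maximal[OF u(1) \<delta>, of N \<omega>] unfolding deficit_def[of u "cyl N \<omega>"] u(2) .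
      ultimately have "\<delta> * measure tv (X \<inter> cyl N \<omega>) \<le> measure tv (cyl N \<omega>) - norm (\<mu> (cyl N \<omega>))"
        using mult_left_mono[of "measure tv (X \<inter> cyl N \<omega>)" "measure tv ?bad" \<delta>] \<delta> by linarith
      then show ?thesis using \<delta> by (simp add: pos_le_divide_eq mult.commute)
    qed
    have T_eq: "{\<gamma>\<in>T. \<gamma> N \<in> atoms (F N)} = T" using path_atom by blast
    have "X = (\<Union>\<omega>\<in>atoms (F N). X \<inter> cyl N \<omega>)" using path_atom unfolding X_def cylinder_def by blast
    then have "measure tv X = measure tv (\<Union>\<omega>\<in>atoms (F N). X \<inter> cyl N \<omega>)" by simp
    also have "\<dots> = (\<Sum>\<omega>\<in>atoms (F N). measure tv (X \<inter> cyl N \<omega>))"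
    proof (rule var.finite_measure_finite_Union)
      show "disjoint_family_on (\<lambda>\<omega>. X \<inter> cyl N \<omega>) (atoms (F N))"
        unfolding disjoint_family_on_def cylinder_def by blast
    qed (use X in auto)
    also have "\<dots> \<le> (\<Sum>\<omega>\<in>atoms (F N). (measure tv (cyl N \<omega>) - norm (\<mu> (cyl N \<omega>))) / \<delta>)"
      by (intro sum_mono part)
    also have "\<dots> = (measure tv T - (\<Sum>\<omega>\<in>atoms (F N). norm (\<mu> (cyl N \<omega>)))) / \<delta>"
      using measure_level_sum[OF var.finite_measure_axioms sets_variation_measure order_refl, of N, unfolded T_eq]
      by (simp add: sum_divide_distrib[symmetric] sum_subtractf)
    also have "\<dots> \<le> e / \<delta>" using N \<delta> by (intro divide_right_mono) auto
    finally show ?thesis .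
  qed
  have "measure tv X \<le> 0 + e" if "e > 0" for e
    using small[of "e * \<delta>"] that \<delta> by simp
  then have "measure tv X \<le> 0" by (rule field_le_epsilon)
  then have "X \<in> null_sets tv" using X by (intro null_setsI) (auto simp: var.emeasure_eq_measure measure_le_0_iff)
  then have "AE \<gamma> in tv. \<gamma> \<notin> X" by (rule AE_not_in)
  then show ?thesis using AE_space[of tv] by eventually_elim (auto simp: X_iff)
qed

text \<open>A set charged by \<open>\<mu>\<close> is charged by the total variation, so it cannot have zero \<open>s\<close>-dimensional
  Hausdorff measure by the mass distribution principle.\<close>

lemma lower_hausdorff_dim_ge:
  fixes W :: "((real^'l::finite)^'m) set"
  assumes mu: "\<mu> \<in> measures_in M F J W" and W: "subspace W"
    and max: "\<And>w. w \<in> admissible W \<Longrightarrow> divergence w \<le> h"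
  shows "ereal (1 - h / ln (real m)) \<le> lower_hausdorff_dim F m \<mu>"
  unfolding lower_hausdorff_dim_def
proof (rule Inf_greatest, clarify)
  fix \<alpha> E assume E: "E \<in> sets B" "\<mu> E \<noteq> 0" "hausdorff_dim T dst E \<le> \<alpha>"
  have vm: "vector_measure B \<mu>" and bv: "bounded_variation_on B \<mu>"
    using mu by (simp_all add: measures_in_def)
  interpret tree_vector_measure M F m J \<mu>
    by unfold_locales (rule vm bv)+
  have "ereal (1 - h / ln (real m)) \<le> hausdorff_dim T dst E"
    unfolding hausdorff_dim_def
  proof (rule Inf_greatest, clarify)
    fix s assume s: "0 \<le> s" "hausdorff_measure T dst s E = 0"
    show "ereal (1 - h / ln (real m)) \<le> ereal s"
    proof (rule ccontr)
      assume "\<not> ?thesis"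
      then have lt: "s < 1 - h / ln (real m)" by simp
      show False
      proof (cases "s = 0")
        case True
        then have "E = {}" using hausdorff_measure_0_empty s by simp
        then show False using E vector_measure_empty[OF vm] by simp
      next
        case False
        then have "measure tv E = 0"
          using s by (intro frostman[OF var.finite_measure_axioms _ _ E(1) _ variation_light[OF mu W max lt]]) auto
        then show False using norm_le[OF E(1)] E(2) by simp
      qed
    qed
  qed
  then show "ereal (1 - h / ln (real m)) \<le> \<alpha>" using E(3) by (rule order_trans)
qed

end

section \<open>A measure of extremal dimension\<close>

context tree_vector_measure
begin

lemma set_integral_generated_martingale:
  assumes A: "A \<in> sets (F n)"
  shows "(LINT x:A|M. generated_martingale F m \<mu> n x) = (\<Sum>\<omega>\<in>atoms (F n). if \<omega> \<subseteq> A then \<mu> (cyl n \<omega>) else 0)"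
    and "integrable M (generated_martingale F m \<mu> n)"
proof -
  have AM: "A \<in> events" using A subalg[of n] by (auto simp: subalgebra_def)
  have int: "integrable M (\<lambda>x. (real m ^ n * indicator \<omega> x) *\<^sub>R \<mu> (cyl n \<omega>))" if "\<omega> \<in> atoms (F n)" for \<omega>
    using atom_measurable[OF that] by (intro integrable_scaleR_left integrable_mult_right integrable_real_indicator) (auto simp: emeasure_eq_measure)
  show "integrable M (generated_martingale F m \<mu> n)"
    unfolding generated_martingale_def using int by (rule Bochner_Integration.integrable_sum)
  have eq: "indicator A x *\<^sub>R generated_martingale F m \<mu> n x
     = (\<Sum>\<omega>\<in>atoms (F n). (real m ^ n * indicator (A \<inter> \<omega>) x) *\<^sub>R \<mu> (cyl n \<omega>))" for x
    unfolding generated_martingale_def scaleR_sum_right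
    by (intro sum.cong) (auto simp: indicator_def)
  have int2: "integrable M (\<lambda>x. (real m ^ n * indicator (A \<inter> \<omega>) x) *\<^sub>R \<mu> (cyl n \<omega>))" if "\<omega> \<in> atoms (F n)" for \<omega>
    using atom_measurable[OF that] AM by (intro integrable_scaleR_left integrable_mult_right integrable_real_indicator) (auto simp: emeasure_eq_measure)
  have "(LINT x:A|M. generated_martingale F m \<mu> n x)
     = (\<Sum>\<omega>\<in>atoms (F n). LINT x|M. (real m ^ n * indicator (A \<inter> \<omega>) x) *\<^sub>R \<mu> (cyl n \<omega>))"
    unfolding set_lebesgue_integral_def eq using int2 by (rule Bochner_Integration.integral_sum)
  also have "\<dots> = (\<Sum>\<omega>\<in>atoms (F n). if \<omega> \<subseteq> A then \<mu> (cyl n \<omega>) else 0)"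
  proof (rule sum.cong[OF refl])
    fix \<omega> assume w: "\<omega> \<in> atoms (F n)"
    have AwM: "A \<inter> \<omega> \<in> events" using atom_measurable[OF w] AM by auto
    have "(LINT x|M. (real m ^ n * indicator (A \<inter> \<omega>) x) *\<^sub>R \<mu> (cyl n \<omega>)) = (real m ^ n * prob (A \<inter> \<omega>)) *\<^sub>R \<mu> (cyl n \<omega>)"
      using AwM sets.sets_into_space[OF AwM]
      by (subst integral_scaleR_left) (auto simp: emeasure_eq_measure Int_absorb2)
    also have "\<dots> = (if \<omega> \<subseteq> A then \<mu> (cyl n \<omega>) else 0)"
    proof (cases "\<omega> \<subseteq> A")
      case True
      then have "A \<inter> \<omega> = \<omega>" by auto
      then show ?thesis using True prob_atom[OF w] card_ge_2 by simp
    next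
      case False
      then have "A \<inter> \<omega> = {}" using atom_subset_or_disjoint[OF w A] by blast
      then show ?thesis using False by simp
    qed
    finally show "(LINT x|M. (real m ^ n * indicator (A \<inter> \<omega>) x) *\<^sub>R \<mu> (cyl n \<omega>)) = (if \<omega> \<subseteq> A then \<mu> (cyl n \<omega>) else 0)" .
  qed
  finally show "(LINT x:A|M. generated_martingale F m \<mu> n x) = (\<Sum>\<omega>\<in>atoms (F n). if \<omega> \<subseteq> A then \<mu> (cyl n \<omega>) else 0)" .
qed

lemma generated_vec_martingale: "vec_martingale M F (generated_martingale F m \<mu>)"
  unfolding vec_martingale_def
proof (intro conjI allI ballI)
  fix n
  show "generated_martingale F m \<mu> n \<in> borel_measurable (F n)"
    unfolding generated_martingale_def
    by (intro borel_measurable_sum borel_measurable_scaleR borel_measurable_times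
        borel_measurable_const borel_measurable_indicator atoms_sets)
  show "integrable M (generated_martingale F m \<mu> n)" by (rule set_integral_generated_martingale(2)[OF sets.top])
  fix A assume A: "A \<in> sets (F n)"
  then have A': "A \<in> sets (F (Suc n))" using sets_F_mono[of n "Suc n"] by auto
  have "(LINT x:A|M. generated_martingale F m \<mu> (Suc n) x)
     = (\<Sum>\<omega>\<in>atoms (F n). \<Sum>j\<in>UNIV. if J \<omega> j \<subseteq> A then \<mu> (cyl (Suc n) (J \<omega> j)) else 0)"
    unfolding set_integral_generated_martingale(1)[OF A'] by (rule sum_atoms_Suc)
  also have "\<dots> = (\<Sum>\<omega>\<in>atoms (F n). if \<omega> \<subseteq> A then \<mu> (cyl n \<omega>) else 0)"
  proof (rule sum.cong[OF refl])
    fix \<omega> assume w: "\<omega> \<in> atoms (F n)"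
    have "J \<omega> j \<subseteq> A \<longleftrightarrow> \<omega> \<subseteq> A" for j
    proof
      assume "J \<omega> j \<subseteq> A"
      moreover obtain x where "x \<in> J \<omega> j" using atoms_nonempty[OF J_atoms[OF w]] by blast
      ultimately show "\<omega> \<subseteq> A"
        using J_subset[OF w, of j] by (intro atom_subset_or_disjoint[OF w A, of x]) auto
    qed (use J_subset[OF w, of j] in blast)
    then show "(\<Sum>j\<in>UNIV. if J \<omega> j \<subseteq> A then \<mu> (cyl (Suc n) (J \<omega> j)) else 0) = (if \<omega> \<subseteq> A then \<mu> (cyl n \<omega>) else 0)"
      using vector_measure_children[OF vm w] by simp
  qed
  also have "\<dots> = (LINT x:A|M. generated_martingale F m \<mu> n x)"
    by (rule set_integral_generated_martingale(1)[OF A, symmetric])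
  finally show "(LINT x:A|M. generated_martingale F m \<mu> (Suc n) x) = (LINT x:A|M. generated_martingale F m \<mu> n x)" .
qed

lemma generated_martingale_bdd: "bdd_above (range (\<lambda>n. LINT x|M. norm (generated_martingale F m \<mu> n x)))"
proof (rule bdd_aboveI2)
  fix n
  have int: "integrable M (\<lambda>x. (real m ^ n * indicator \<omega> x) * norm (\<mu> (cyl n \<omega>)))" if "\<omega> \<in> atoms (F n)" for \<omega>
    using atom_measurable[OF that] by (intro integrable_mult_left integrable_mult_right integrable_real_indicator) (auto simp: emeasure_eq_measure)
  have "(LINT x|M. norm (generated_martingale F m \<mu> n x))
     \<le> (LINT x|M. (\<Sum>\<omega>\<in>atoms (F n). (real m ^ n * indicator \<omega> x) * norm (\<mu> (cyl n \<omega>))))"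
  proof (rule integral_mono)
    show "integrable M (\<lambda>x. norm (generated_martingale F m \<mu> n x))"
      by (intro integrable_norm set_integral_generated_martingale(2)[OF sets.top])
    show "norm (generated_martingale F m \<mu> n x) \<le> (\<Sum>\<omega>\<in>atoms (F n). (real m ^ n * indicator \<omega> x) * norm (\<mu> (cyl n \<omega>)))" for x
      unfolding generated_martingale_def by (rule order_trans[OF norm_sum]) (intro sum_mono, simp)
  qed (use int in \<open>rule Bochner_Integration.integrable_sum\<close>)
  also have "\<dots> = (\<Sum>\<omega>\<in>atoms (F n). LINT x|M. (real m ^ n * indicator \<omega> x) * norm (\<mu> (cyl n \<omega>)))"
    using int by (rule Bochner_Integration.integral_sum)
  also have "\<dots> = (\<Sum>\<omega>\<in>atoms (F n). norm (\<mu> (cyl n \<omega>)))"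
  proof (rule sum.cong[OF refl])
    fix \<omega> assume w: "\<omega> \<in> atoms (F n)"
    then show "(LINT x|M. (real m ^ n * indicator \<omega> x) * norm (\<mu> (cyl n \<omega>))) = norm (\<mu> (cyl n \<omega>))"
      using sets.sets_into_space[OF atom_measurable[OF w]] prob_atom[OF w] card_ge_2
      by (simp add: Int_absorb2)
  qed
  also have "\<dots> \<le> (\<Sum>\<omega>\<in>atoms (F n). measure tv (cyl n \<omega>))" by (intro sum_mono norm_le) simp
  also have "\<dots> = measure tv {\<gamma>\<in>T. \<gamma> n \<in> atoms (F n)}"
    by (rule measure_level_sum[OF var.finite_measure_axioms sets_variation_measure order_refl, symmetric])
  also have "\<dots> \<le> measure tv (space tv)" by (rule var.bounded_measure)
  finally show "(LINT x|M. norm (generated_martingale F m \<mu> n x)) \<le> measure tv (space tv)" .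
qed

end

context labelled_tree
begin

primrec path_of :: "(nat \<Rightarrow> 'm) \<Rightarrow> nat \<Rightarrow> 'a set" where
  "path_of x 0 = space M"
| "path_of x (Suc n) = J (path_of x n) (x n)"

lemma path_of_atoms: "path_of x n \<in> atoms (F n)"
  by (induction n) (auto simp: atoms_0 J_atoms)

lemma path_of_in_T: "path_of x \<in> T"
  unfolding paths_def using path_of_atoms J_subset[OF path_of_atoms] by simp

lemma path_of_Suc_eq:
  assumes "\<omega> \<in> atoms (F n)"
  shows "path_of x (Suc n) = J \<omega> j \<longleftrightarrow> path_of x n = \<omega> \<and> x n = j"
proof
  assume a: "path_of x (Suc n) = J \<omega> j"
  then have "path_of x n = \<omega>" by (rule parent_of_path[OF path_of_in_T assms])
  then show "path_of x n = \<omega> \<and> x n = j" using a J_inj[OF assms] by simp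
qed simp

text \<open>The word \<open>c\<close> lists the child labels on the way from the root to \<open>\<omega>\<close>.\<close>

definition codes :: "nat \<Rightarrow> (nat \<Rightarrow> 'm) \<Rightarrow> 'a set \<Rightarrow> bool" where
  "codes n c \<omega> \<longleftrightarrow> (\<forall>x. path_of x n = \<omega> \<longleftrightarrow> (\<forall>k<n. x k = c k))"

lemma codes_child:
  assumes "\<omega> \<in> atoms (F n)" "codes n c \<omega>"
  shows "codes (Suc n) (c(n := j)) (J \<omega> j)"
  unfolding codes_def path_of_Suc_eq[OF assms(1)]
proof
  fix x
  have 1: "path_of x n = \<omega> \<longleftrightarrow> (\<forall>k<n. x k = c k)" using assms(2) by (simp add: codes_def)
  show "(path_of x n = \<omega> \<and> x n = j) \<longleftrightarrow> (\<forall>k<Suc n. x k = (c(n := j)) k)"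
    unfolding 1 by (auto simp: less_Suc_eq)
qed

lemma codes_exists:
  assumes "\<omega> \<in> atoms (F n)"
  obtains c where "codes n c \<omega>"
  using assms
proof (induction n arbitrary: \<omega> thesis)
  case 0
  have "codes 0 undefined \<omega>" using 0 by (simp add: codes_def atoms_0)
  then show ?case by (rule 0)
next
  case (Suc n)
  obtain \<omega>' where w: "\<omega>' \<in> atoms (F n)" "\<omega> \<subseteq> \<omega>'" using parent_atom[OF Suc.prems(2)] .
  obtain j where j: "\<omega> = J \<omega>' j" using child_eq_J[OF w(1) Suc.prems(2) w(2)] .
  obtain c where "codes n c \<omega>'" using Suc.IH[OF _ w(1)] by blast
  then show ?case using codes_child[OF w(1)] Suc.prems(1) j by blast
qed

text \<open>The law of the path that picks each child independently with distribution \<open>p\<close>.\<close>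

definition bernoulli_measure :: "'m pmf \<Rightarrow> (nat \<Rightarrow> 'a set) measure" where
  "bernoulli_measure p = distr (Pi\<^sub>M UNIV (\<lambda>_ :: nat. measure_pmf p)) B path_of"

lemma sets_bernoulli_measure [simp]: "sets (bernoulli_measure p) = sets B"
  by (simp add: bernoulli_measure_def)

lemma vimage_cyl_path_of:
  assumes "codes n c \<omega>"
  shows "path_of -` cyl n \<omega> \<inter> space (Pi\<^sub>M UNIV (\<lambda>_. measure_pmf p))
     = {x \<in> space (Pi\<^sub>M UNIV (\<lambda>_. measure_pmf p)). \<forall>k\<in>{..<n}. x k \<in> {c k}}"
proof -
  have "path_of x \<in> cyl n \<omega> \<longleftrightarrow> (\<forall>k<n. x k = c k)" for x
    using assms path_of_in_T unfolding codes_def in_cyl by simp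
  then show ?thesis by blast
qed

lemma measurable_path_of [measurable]: "path_of \<in> measurable (Pi\<^sub>M UNIV (\<lambda>_ :: nat. measure_pmf p)) B"
proof (rule measurable_sigma_sets[OF sets_B])
  fix Y assume "Y \<in> {cyl n \<omega> |n \<omega>. \<omega> \<in> atoms (F n)}"
  then obtain n \<omega> where Y: "Y = cyl n \<omega>" "\<omega> \<in> atoms (F n)" by blast
  obtain c where c: "codes n c \<omega>" using codes_exists[OF Y(2)] .
  have "{x \<in> space (Pi\<^sub>M UNIV (\<lambda>_ :: nat. measure_pmf p)). \<forall>k\<in>{..<n}. x k \<in> {c k}}
     \<in> sets (Pi\<^sub>M UNIV (\<lambda>_. measure_pmf p))"
  proof (rule sets.sets_Collect_finite_All)
    fix k
    have "(\<lambda>x. x k) -` {c k} \<inter> space (Pi\<^sub>M UNIV (\<lambda>_ :: nat. measure_pmf p)) \<in> sets (Pi\<^sub>M UNIV (\<lambda>_. measure_pmf p))"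
      by (rule measurable_sets[OF measurable_component_singleton]) auto
    also have "(\<lambda>x. x k) -` {c k} \<inter> space (Pi\<^sub>M UNIV (\<lambda>_ :: nat. measure_pmf p))
       = {x \<in> space (Pi\<^sub>M UNIV (\<lambda>_. measure_pmf p)). x k \<in> {c k}}" by blast
    finally show "{x \<in> space (Pi\<^sub>M UNIV (\<lambda>_ :: nat. measure_pmf p)). x k \<in> {c k}} \<in> sets (Pi\<^sub>M UNIV (\<lambda>_. measure_pmf p))" .
  qed simp
  then show "path_of -` Y \<inter> space (Pi\<^sub>M UNIV (\<lambda>_ :: nat. measure_pmf p)) \<in> sets (Pi\<^sub>M UNIV (\<lambda>_. measure_pmf p))"
    unfolding Y vimage_cyl_path_of[OF c] .
qed (auto simp: cylinder_def path_of_in_T)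

lemma prob_space_bernoulli_measure: "prob_space (bernoulli_measure p)"
proof -
  interpret product_prob_space "\<lambda>_ :: nat. measure_pmf p" UNIV ..
  show ?thesis unfolding bernoulli_measure_def by (rule P.prob_space_distr[OF measurable_path_of])
qed

lemma measure_bernoulli_cyl:
  assumes "codes n c \<omega>"
  shows "measure (bernoulli_measure p) (cyl n \<omega>) = (\<Prod>k<n. pmf p (c k))"
proof -
  interpret product_prob_space "\<lambda>_ :: nat. measure_pmf p" UNIV ..
  have "emeasure (bernoulli_measure p) (cyl n \<omega>)
     = emeasure (Pi\<^sub>M UNIV (\<lambda>_ :: nat. measure_pmf p)) {x \<in> space (Pi\<^sub>M UNIV (\<lambda>_. measure_pmf p)). \<forall>k\<in>{..<n}. x k \<in> {c k}}"
    unfolding bernoulli_measure_def vimage_cyl_path_of[OF assms, symmetric]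
    by (rule emeasure_distr[OF measurable_path_of cyl_sets])
  also have "\<dots> = (\<Prod>k<n. emeasure (measure_pmf p) {c k})" by (rule emeasure_PiM_Collect) auto
  also have "\<dots> = ennreal (\<Prod>k<n. pmf p (c k))"
    by (simp add: emeasure_pmf_single prod_ennreal)
  finally show ?thesis by (simp add: measure_def prod_nonneg)
qed

lemma measure_bernoulli_child:
  assumes "\<omega> \<in> atoms (F n)"
  shows "measure (bernoulli_measure p) (cyl (Suc n) (J \<omega> j)) = measure (bernoulli_measure p) (cyl n \<omega>) * pmf p j"
proof -
  obtain c where c: "codes n c \<omega>" using codes_exists[OF assms] .
  show ?thesis
    unfolding measure_bernoulli_cyl[OF c] measure_bernoulli_cyl[OF codes_child[OF assms c]]
    by (simp add: lessThan_Suc mult.commute)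
qed

text \<open>The quotient of the two sides equals one at \<open>s = 0\<close>, and its derivative there is the entropy of
  \<open>p\<close> minus \<open>t ln m\<close>, which is negative.\<close>

lemma small_exponent:
  fixes p :: "'m pmf"
  assumes "- (\<Sum>j\<in>UNIV. pmf p j * ln (pmf p j)) < t * ln (real m)"
  obtains s where "s > 0" "(\<Sum>j\<in>UNIV. pmf p j powr (1 - s)) < real m powr (s * t)"
proof -
  define k where "k j = - ln (pmf p j) - t * ln (real m)" for j
  define f where "f s = (\<Sum>j\<in>UNIV. pmf p j * exp (s * k j))" for s
  have sum1: "(\<Sum>j\<in>UNIV. pmf p j) = 1" by (rule sum_pmf_eq_1) auto
  have "(f has_real_derivative (\<Sum>j\<in>UNIV. pmf p j * (k j * exp (0 * k j)))) (at 0)"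
    unfolding f_def by (auto intro!: derivative_eq_intros sum.cong)
  moreover have "(\<Sum>j\<in>UNIV. pmf p j * (k j * exp (0 * k j))) < 0"
  proof -
    have "(\<Sum>j\<in>UNIV. pmf p j * (k j * exp (0 * k j)))
       = - (\<Sum>j\<in>UNIV. pmf p j * ln (pmf p j)) - (\<Sum>j\<in>UNIV. pmf p j) * (t * ln (real m))"
      by (simp add: k_def algebra_simps sum_subtractf sum_negf sum_distrib_right sum_distrib_left)
    then show ?thesis using assms sum1 by simp
  qed
  ultimately obtain d where d: "d > 0" "\<And>h. 0 < h \<Longrightarrow> h < d \<Longrightarrow> f (0 + h) < f 0"
    using DERIV_neg_dec_right by blast
  define s where "s = d / 2"
  have s: "s > 0" "f s < 1" using d(1) d(2)[of "d/2"] sum1 by (auto simp: s_def f_def)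
  have m: "real m > 0" using card_ge_2 by simp
  have "pmf p j powr (1 - s) = real m powr (s * t) * (pmf p j * exp (s * k j))" for j
  proof (cases "pmf p j = 0")
    case False
    then have pos: "pmf p j > 0" by (simp add: pmf_pos)
    have "pmf p j powr (1 - s) = pmf p j * exp (- s * ln (pmf p j))"
      using pos by (simp add: powr_def left_diff_distrib exp_diff exp_minus divide_inverse)
    also have "exp (- s * ln (pmf p j)) = real m powr (s * t) * exp (s * k j)"
      using m by (simp add: powr_def k_def exp_add[symmetric] algebra_simps)
    finally show ?thesis by simp
  qed simp
  then have "(\<Sum>j\<in>UNIV. pmf p j powr (1 - s)) = real m powr (s * t) * f s"
    by (simp add: f_def sum_distrib_left)
  also have "\<dots> < real m powr (s * t)" using s m by simp
  finally show ?thesis using that s by blast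
qed

text \<open>The moments of exponent \<open>1 - s\<close> of a Bernoulli measure are multiplied by a constant smaller than
  \<open>m\<^sup>s\<^sup>t\<close> in each generation, so cylinders lighter than \<open>m\<^sup>-\<^sup>n\<^sup>t\<close> carry a summable mass.\<close>

lemma bernoulli_heavy:
  fixes p :: "'m pmf"
  assumes "- (\<Sum>j\<in>UNIV. pmf p j * ln (pmf p j)) < t * ln (real m)"
  shows "AE \<gamma> in bernoulli_measure p. \<forall>\<^sub>F n in sequentially.
     ((1 / real m) ^ n) powr t \<le> measure (bernoulli_measure p) (cyl n (\<gamma> n))"
proof -
  let ?\<nu> = "bernoulli_measure p"
  interpret nu: prob_space ?\<nu> by (rule prob_space_bernoulli_measure)
  have fin: "finite_measure ?\<nu>" by (rule nu.finite_measure_axioms)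
  obtain s where s: "s > 0" "(\<Sum>j\<in>UNIV. pmf p j powr (1 - s)) < real m powr (s * t)"
    using small_exponent[OF assms] .
  have "AE \<gamma> in ?\<nu>. (\<forall>n\<ge>(0::nat). True) \<longrightarrow> (\<forall>\<^sub>F n in sequentially.
      measure ?\<nu> (cyl n (\<gamma> n)) powr ((1 - s) - 1) \<le> (real m powr (s * t)) ^ n)"
  proof (rule moment_decay[OF fin sets_bernoulli_measure _ s(2), where good = "\<lambda>_ _. True"])
    fix n \<omega> assume "\<omega> \<in> atoms (F n)"
    then show "(\<Sum>j\<in>UNIV. measure ?\<nu> (cyl (Suc n) (J \<omega> j)) powr (1 - s))
       \<le> (\<Sum>j\<in>UNIV. pmf p j powr (1 - s)) * measure ?\<nu> (cyl n \<omega>) powr (1 - s)"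
      by (simp add: measure_bernoulli_child powr_mult sum_distrib_right mult.commute)
  qed (simp add: sum_nonneg)
  moreover have "AE \<gamma> in ?\<nu>. \<forall>n. measure ?\<nu> (cyl n (\<gamma> n)) \<noteq> 0"
    unfolding AE_all_countable
  proof
    fix n
    define Z where "Z = {\<omega>\<in>atoms (F n). measure ?\<nu> (cyl n \<omega>) = 0}"
    have "measure ?\<nu> {\<gamma>\<in>T. \<gamma> n \<in> Z} = (\<Sum>\<omega>\<in>Z. measure ?\<nu> (cyl n \<omega>))"
      by (rule measure_level_sum[OF fin sets_bernoulli_measure]) (auto simp: Z_def)
    also have "\<dots> = 0" by (intro sum.neutral) (auto simp: Z_def)
    finally have "{\<gamma>\<in>T. \<gamma> n \<in> Z} \<in> null_sets ?\<nu>"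
      using sets_level by (intro null_setsI) (auto simp: nu.emeasure_eq_measure)
    then have "AE \<gamma> in ?\<nu>. \<gamma> \<notin> {\<gamma>\<in>T. \<gamma> n \<in> Z}" by (rule AE_not_in)
    then show "AE \<gamma> in ?\<nu>. measure ?\<nu> (cyl n (\<gamma> n)) \<noteq> 0"
      using AE_space[of ?\<nu>]
    proof eventually_elim
      case (elim \<gamma>)
      then show ?case
        using path_atom[of \<gamma> n] by (simp add: Z_def bernoulli_measure_def)
    qed
  qed
  ultimately show ?thesis
  proof eventually_elim
    case (elim \<gamma>)
    then have "\<forall>\<^sub>F n in sequentially. measure ?\<nu> (cyl n (\<gamma> n)) powr (- s) \<le> (real m powr (s * t)) ^ n" by simp
    then show ?case
    proof eventually_elim
      case (elim n)
      show ?case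
      proof (rule ccontr)
        assume "\<not> ?thesis"
        then have lt: "measure ?\<nu> (cyl n (\<gamma> n)) < ((1 / real m) ^ n) powr t" by simp
        have pos: "measure ?\<nu> (cyl n (\<gamma> n)) > 0"
          using \<open>\<forall>n. measure ?\<nu> (cyl n (\<gamma> n)) \<noteq> 0\<close> by (simp add: zero_less_measure_iff)
        have "(real m powr (s * t)) ^ n = (((1 / real m) ^ n) powr t) powr (- s)"
          using card_ge_2 by (simp add: powr_def ln_realpow ln_div exp_of_nat_mult[symmetric] mult_ac del: power_divide)
        also have "\<dots> < measure ?\<nu> (cyl n (\<gamma> n)) powr (- s)"
          using s(1) pos lt by (intro powr_less_mono2_neg) auto
        finally show False using elim by simp
      qed
    qed
  qed
qed

text \<open>Some set of positive mass consists of paths whose cylinders are uniformly heavy from a fixed level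
  on; its dimension is controlled by counting.\<close>

lemma bernoulli_dim_le:
  fixes p :: "'m pmf" and a :: "'c::real_normed_vector"
  assumes "- (\<Sum>j\<in>UNIV. pmf p j * ln (pmf p j)) < t * ln (real m)" "0 < t" "t < t'" "a \<noteq> 0"
  shows "lower_hausdorff_dim F m (\<lambda>X. measure (bernoulli_measure p) X *\<^sub>R a) \<le> ereal t'"
proof -
  let ?\<nu> = "bernoulli_measure p"
  interpret nu: prob_space ?\<nu> by (rule prob_space_bernoulli_measure)
  define L where "L N = {\<gamma>\<in>T. \<forall>n\<ge>N. ((1 / real m) ^ n) powr t \<le> measure ?\<nu> (cyl n (\<gamma> n))}" for N
  have L: "L N \<in> sets B" for N unfolding L_def by (rule sets_all_levels)
  have "\<exists>N. measure ?\<nu> (L N) \<noteq> 0"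
  proof (rule ccontr)
    assume "\<not> ?thesis"
    then have "L N \<in> null_sets ?\<nu>" for N using L by (intro null_setsI) (auto simp: nu.emeasure_eq_measure)
    then have "AE \<gamma> in ?\<nu>. \<forall>N. \<gamma> \<notin> L N" unfolding AE_all_countable by (intro allI AE_not_in)
    moreover have "AE \<gamma> in ?\<nu>. \<exists>N. \<gamma> \<in> L N"
      using bernoulli_heavy[OF assms(1)] AE_space[of ?\<nu>]
      by eventually_elim (simp add: L_def eventually_sequentially bernoulli_measure_def)
    ultimately have "AE \<gamma> in ?\<nu>. False" by eventually_elim blast
    then show False by simp
  qed
  then obtain N where N: "measure ?\<nu> (L N) \<noteq> 0" by blast
  have "hausdorff_dim T dst (L N) \<le> ereal t'"
    using assms(2,3)
    by (intro hausdorff_dim_heavy[OF nu.finite_measure_axioms sets_bernoulli_measure, where N = N]) (auto simp: L_def)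
  then show ?thesis
    unfolding lower_hausdorff_dim_def using L[of N] N assms(4) by (intro Inf_lower) auto
qed

lemma pmf_of_direction:
  fixes v :: "real^'m"
  assumes v: "v \<in> zero_sum" "\<And>j. v $ j \<ge> -1"
  obtains p :: "'m pmf" where "\<And>j. pmf p j = (1 + v $ j) / real m"
    "- (\<Sum>j\<in>UNIV. pmf p j * ln (pmf p j)) = ln (real m) - divergence v"
proof -
  let ?f = "\<lambda>j. (1 + v $ j) / real m"
  have m: "real m > 0" using card_ge_2 by simp
  have nn: "0 \<le> 1 + v $ j" for j using v(2)[of j] by simp
  have sum1: "(\<Sum>j\<in>UNIV. ?f j) = 1"
    using zero_sum_sum[OF v(1)] m by (simp only: sum_divide_distrib[symmetric]) simp
  have "(\<integral>\<^sup>+ j. ennreal (?f j) \<partial>count_space UNIV) = 1"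
    using nn m sum1 by (simp add: nn_integral_count_space_finite)
  then have p: "pmf (embed_pmf ?f) j = ?f j" for j
    using nn m by (intro pmf_embed_pmf) auto
  have "?f j * ln (?f j) = (1 / real m) * ((1 + v $ j) * ln (1 + v $ j)) - ?f j * ln (real m)" for j
    using nn[of j] m by (cases "1 + v $ j = 0") (auto simp: ln_div field_simps)
  then have "(\<Sum>j\<in>UNIV. ?f j * ln (?f j)) = divergence v - (\<Sum>j\<in>UNIV. ?f j) * ln (real m)"
    by (simp only: sum_subtractf sum_distrib_left sum_distrib_right divergence_def card_m)
  then show ?thesis using that[of "embed_pmf ?f"] p sum1 by simp
qed

lemma divergence_le:
  fixes v :: "real^'m"
  assumes v: "v \<in> zero_sum" "\<And>j. v $ j \<ge> -1"
  shows "divergence v \<le> ln (real m)"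
proof -
  have m: "real m > 0" using card_ge_2 by simp
  have "(1 + v $ j) * ln (1 + v $ j) \<le> (1 + v $ j) * ln (real m)" for j
  proof (cases "1 + v $ j = 0")
    case False
    then have pos: "1 + v $ j > 0" using v(2)[of j] by simp
    then show ?thesis using zero_sum_le[OF v, of j] m by (intro mult_left_mono) auto
  qed simp
  then have "(\<Sum>j\<in>UNIV. (1 + v $ j) * ln (1 + v $ j)) \<le> (\<Sum>j\<in>UNIV. (1 + v $ j) * ln (real m))"
    by (rule sum_mono)
  also have "\<dots> = real m * ln (real m)"
    using zero_sum_sum[OF v(1)] by (simp only: sum_distrib_right[symmetric] card_m)
  finally show ?thesis using m by (simp add: divergence_def field_simps)
qed

text \<open>Take the Bernoulli measure with weights \<open>(1 + v) / m\<close> times the vector \<open>a\<close> with \<open>v \<otimes> a \<in> W\<close>: at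
  every atom the martingale increment is a scalar multiple of \<open>v \<otimes> a\<close>. The entropy of the weights is
  \<open>ln m\<close> minus the divergence of \<open>v\<close>.\<close>

lemma extremal_measure:
  fixes W :: "((real^'l::finite)^'m) set"
  assumes W: "subspace W" and v: "v \<in> admissible W"
  obtains \<mu> where "\<mu> \<in> measures_in M F J W" "lower_hausdorff_dim F m \<mu> \<le> ereal (1 - divergence v / ln (real m))"
proof -
  obtain a where a: "a \<noteq> 0" "tensor v a \<in> W" and v': "v \<in> zero_sum" "\<And>j. v $ j \<ge> -1"
    using v by (auto simp: admissible_def)
  obtain p where p: "\<And>j. pmf p j = (1 + v $ j) / real m"
    "- (\<Sum>j\<in>UNIV. pmf p j * ln (pmf p j)) = ln (real m) - divergence v"
    using pmf_of_direction[OF v'] by blast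
  have L: "ln (real m) > 0" using card_ge_2 by simp
  let ?\<nu> = "bernoulli_measure p"
  let ?\<mu> = "\<lambda>X. measure ?\<nu> X *\<^sub>R a"
  interpret nu: prob_space ?\<nu> by (rule prob_space_bernoulli_measure)
  have vm: "vector_measure B ?\<mu>"
    using vector_measure_of_measure[OF nu.finite_measure_axioms sets_bernoulli_measure]
    unfolding vector_measure_def by (auto intro!: sums_scaleR_left)
  have bv: "bounded_variation_on B ?\<mu>"
    unfolding bounded_variation_on_def
  proof (intro exI[of _ "norm a"] allI impI)
    fix P assume P: "finite P" "P \<subseteq> sets B" "disjoint P"
    have "(\<Sum>A\<in>P. norm (?\<mu> A)) = (\<Sum>A\<in>P. measure ?\<nu> A) * norm a"
      by (simp add: sum_distrib_right)
    also have "(\<Sum>A\<in>P. measure ?\<nu> A) = measure ?\<nu> (\<Union>A\<in>P. A)"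
      using P by (intro nu.finite_measure_finite_Union[symmetric]) (auto simp: disjoint_family_on_def disjoint_def)
    also have "\<dots> * norm a \<le> 1 * norm a" by (intro mult_right_mono nu.prob_le_1) auto
    finally show "(\<Sum>A\<in>P. norm (?\<mu> A)) \<le> norm a" by simp
  qed
  interpret tree_vector_measure M F m J ?\<mu> by unfold_locales (rule vm bv)+
  have "generated_martingale F m ?\<mu> \<in> martingale_space M F J W"
    unfolding martingale_space_def
  proof (intro CollectI conjI allI ballI generated_vec_martingale generated_martingale_bdd)
    fix n \<omega> assume w: "\<omega> \<in> atoms (F n)"
    let ?b = "(real m ^ n * measure ?\<nu> (cyl n \<omega>)) *\<^sub>R tensor v a"
    have "generated_martingale F m ?\<mu> (Suc n) x - generated_martingale F m ?\<mu> n x = ?b $ j"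
      if x: "x \<in> J \<omega> j" for j x
    proof -
      have "generated_martingale F m ?\<mu> (Suc n) x = (real m ^ Suc n) *\<^sub>R ?\<mu> (cyl (Suc n) (J \<omega> j))"
        by (rule generated_martingale_eq[OF J_atoms[OF w] x])
      moreover have "generated_martingale F m ?\<mu> n x = (real m ^ n) *\<^sub>R ?\<mu> (cyl n \<omega>)"
        using x J_subset[OF w] by (intro generated_martingale_eq[OF w]) auto
      moreover have "real m ^ Suc n * (measure ?\<nu> (cyl n \<omega>) * pmf p j)
         = real m ^ n * measure ?\<nu> (cyl n \<omega>) * (1 + v $ j)"
        using card_ge_2 by (simp add: p)
      ultimately show ?thesis
        by (simp add: measure_bernoulli_child[OF w] tensor_def distrib_left scaleR_add_left del: power_Suc)
    qed
    then show "\<exists>b\<in>W. \<forall>j. \<forall>x\<in>J \<omega> j. generated_martingale F m ?\<mu> (Suc n) x - generated_martingale F m ?\<mu> n x = b $ j"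
      using subspace_scale[OF W a(2)] by blast
  qed
  then have mem: "?\<mu> \<in> measures_in M F J W" using vm bv by (simp add: measures_in_def)
  define d where "d = 1 - divergence v / ln (real m)"
  have d0: "d \<ge> 0" using divergence_le[OF v'] L by (simp add: d_def)
  have "lower_hausdorff_dim F m ?\<mu> \<le> ereal t'" if t: "d < t'" for t'
  proof (rule bernoulli_dim_le[where t = "(d + t') / 2"])
    have "d * ln (real m) < (d + t') / 2 * ln (real m)" using t L by (intro mult_strict_right_mono) auto
    then show "- (\<Sum>j\<in>UNIV. pmf p j * ln (pmf p j)) < (d + t') / 2 * ln (real m)"
      using L unfolding p(2) by (simp add: d_def left_diff_distrib)
  qed (use t d0 a in auto)
  then have "lower_hausdorff_dim F m ?\<mu> \<le> z" if "ereal d < z" for z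
    using that by (cases z) auto
  then have "lower_hausdorff_dim F m ?\<mu> \<le> ereal d" by (rule dense_ge)
  then show ?thesis using that[OF mem] by (simp add: d_def)
qed

end

section \<open>The dimension estimate\<close>

theorem theorem1p11:
  fixes M :: "'a measure" and F :: "nat \<Rightarrow> 'a measure"
    and J :: "'a set \<Rightarrow> 'm::finite \<Rightarrow> 'a set"
    and W :: "((real^'l::finite)^'m) set"
  assumes "CARD('m) \<ge> 3"
    and "uniform_filtration M F CARD('m)"
    and "child_labelling F J"
    and "subspace W" and "W \<subseteq> zero_sum"
  shows "\<exists>D. (kappa W has_real_derivative D) (at_left 1) \<and>
    (\<forall>\<mu> \<in> measures_in M F J W.
       lower_hausdorff_dim F CARD('m) \<mu> \<ge> ereal (1 + D / ln (real CARD('m)))) \<and>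
    (\<exists>\<mu> \<in> measures_in M F J W.
       lower_hausdorff_dim F CARD('m) \<mu> = ereal (1 + D / ln (real CARD('m))))"
proof -
  have dim_eq: "1 + (- x) / y = 1 - x / y" for x y :: real by simp
  interpret labelled_tree M F "CARD('m)" J
    by (intro labelled_tree.intro labelled_tree_axioms.intro) (use assms in auto)
  obtain v where v: "v \<in> admissible W" "\<forall>w\<in>admissible W. divergence w \<le> divergence v"
    by (rule divergence_attained[OF assms(4)])
  have lower: "ereal (1 + (- divergence v) / ln (real CARD('m))) \<le> lower_hausdorff_dim F CARD('m) \<mu>"
    if "\<mu> \<in> measures_in M F J W" for \<mu>
    unfolding dim_eq by (rule lower_hausdorff_dim_ge[OF that assms(4) bspec[OF v(2)]])
  obtain \<mu> where \<mu>: "\<mu> \<in> measures_in M F J W"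
    "lower_hausdorff_dim F CARD('m) \<mu> \<le> ereal (1 - divergence v / ln (real CARD('m)))"
    by (rule extremal_measure[OF assms(4) v(1)])
  show ?thesis
  proof (intro exI[of _ "- divergence v"] conjI ballI)
    show "(kappa W has_real_derivative - divergence v) (at_left 1)"
      by (rule kappa_has_left_derivative[OF assms(4) v(1) bspec[OF v(2)]])
    show "\<exists>\<mu>\<in>measures_in M F J W. lower_hausdorff_dim F CARD('m) \<mu> = ereal (1 + (- divergence v) / ln (real CARD('m)))"
    proof (rule bexI[OF antisym \<mu>(1)])
      show "lower_hausdorff_dim F CARD('m) \<mu> \<le> ereal (1 + (- divergence v) / ln (real CARD('m)))"
        unfolding dim_eq by (rule \<mu>(2))
    qed (rule lower[OF \<mu>(1)])
  qed (rule lower)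
qed

end
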